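(* Let $\Omega\subset\mathbb{R}^2$ be a circular or elliptical domain and let $f\in C_c^\infty(\Omega)$. Let $u\colon\mathbb{R}^2\times[0,\infty)\to\mathbb{R}$ be the solution of the wave equation $$(\partial_t^2-\Delta)u=0 \ \text{ on } \mathbb{R}^2\times(0,\infty),\qquad u(\cdot,0)=f,\qquad (\partial_t u)(\cdot,0)=0 \ \text{ on } \mathbb{R}^2 .$$ Then, for every $x\in\Omega$, $$f(x)=\frac{1}{\pi}\int_{\partial\Omega}\int_{\|x-y\|}^\infty \frac{\partial_\nu u(y,t)}{\sqrt{t^2-\|x-y\|^2}}\,dt\,d\sigma(y).$$
   Context: A circular domain is an open disc in $\mathbb{R}^2$. An elliptical domain is a bounded domain $\Omega\subset\mathbb{R}^2$ whose boundary is an ellipse, $\partial\Omega=Q\left(\left\{(x_1,x_2)\in\mathbb{R}^2 : \frac{x_1^2}{e_1^2}+\frac{x_2^2}{e_2^2}=1\right\}\right)$, for numbers $e_1,e_2>0$ and an orthogonal transform $Q\in\mathbb{R}^{2\times2}$. $C_c^\infty(\Omega)$ is the set of smooth real-valued functions with compact support in $\Omega$, extended by zero to $\mathbb{R}^2$. $\|\cdot\|$ is the Euclidean norm, $\Delta$ is the Laplacian in the spatial variable, and $\sigma$ is the standard surface (arc length) measure on $\partial\Omega$. For $x\in\partial\Omega$, $\nu(x)$ is the outward unit normal vector, and $\partial_\nu u(x,t)=\langle\nabla u(x,t),\nu(x)\rangle$ with $\nabla$ the gradient in the spatial variable. *)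

theory Defs
  imports "HOL-Analysis.Analysis"
begin

definition circular_domain :: "(real^2) set \<Rightarrow> bool" where
  "circular_domain \<Omega> \<longleftrightarrow> (\<exists>c r. r > 0 \<and> \<Omega> = ball c r)"

definition elliptical_domain :: "(real^2) set \<Rightarrow> bool" where
  "elliptical_domain \<Omega> \<longleftrightarrow> open \<Omega> \<and> connected \<Omega> \<and> bounded \<Omega> \<and>
     (\<exists>e1 e2 (Q :: real^2^2). e1 > 0 \<and> e2 > 0 \<and> orthogonal_matrix Q \<and>
        frontier \<Omega> = (\<lambda>v. Q *v v) ` {x. (x$1)\<^sup>2 / e1\<^sup>2 + (x$2)\<^sup>2 / e2\<^sup>2 = 1})"

(* The sets S of interest are convex with nonempty interior (the whole space, or a closed
   half-space), so that the derivative within S is unique also at boundary points. *)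
primrec Ck_on :: "nat \<Rightarrow> ('a::real_normed_vector \<Rightarrow> real) \<Rightarrow> 'a set \<Rightarrow> bool" where
  "Ck_on 0 g S \<longleftrightarrow> continuous_on S g"
| "Ck_on (Suc k) g S \<longleftrightarrow> g differentiable_on S \<and>
     (\<forall>v. Ck_on k (\<lambda>x. frechet_derivative g (at x within S) v) S)"

definition smooth_compact_support :: "(real^2) set \<Rightarrow> (real^2 \<Rightarrow> real) \<Rightarrow> bool" where
  "smooth_compact_support \<Omega> f \<longleftrightarrow> (\<forall>k. Ck_on k f UNIV) \<and>
     compact (closure {x. f x \<noteq> 0}) \<and> closure {x. f x \<noteq> 0} \<subseteq> \<Omega>"

definition laplacian :: "('a::euclidean_space \<Rightarrow> real) \<Rightarrow> 'a \<Rightarrow> real" where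
  "laplacian g x = (\<Sum>b\<in>Basis. (deriv ^^ 2) (\<lambda>s. g (x + s *\<^sub>R b)) 0)"

definition gradient :: "('a::real_inner \<Rightarrow> real) \<Rightarrow> 'a \<Rightarrow> 'a" where
  "gradient g x = (THE D. GDERIV g x :> D)"

(* Classical solution of the Cauchy problem, twice continuously differentiable up to t = 0.
   Values u x t with t < 0 are irrelevant: every condition is imposed on t >= 0 only. *)
definition wave_solution :: "(real^2 \<Rightarrow> real) \<Rightarrow> (real^2 \<Rightarrow> real \<Rightarrow> real) \<Rightarrow> bool" where
  "wave_solution f u \<longleftrightarrow>
     Ck_on 2 (\<lambda>(x, t). u x t) (UNIV \<times> {0..}) \<and>
     (\<forall>x. \<forall>t>0. (deriv ^^ 2) (u x) t - laplacian (\<lambda>z. u z t) x = 0) \<and>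
     (\<forall>x. u x 0 = f x) \<and>
     (\<forall>x. (u x has_real_derivative 0) (at 0 within {0..}))"

(* n is a unit vector orthogonal to the tangent line of the boundary at y, and it points
   from the inside to the outside. *)
definition is_outward_unit_normal :: "'a::real_inner set \<Rightarrow> 'a \<Rightarrow> 'a \<Rightarrow> bool" where
  "is_outward_unit_normal \<Omega> y n \<longleftrightarrow> norm n = 1 \<and>
     ((\<lambda>z. inner n (z - y) / norm (z - y)) \<longlongrightarrow> 0) (at y within frontier \<Omega>) \<and>
     (\<forall>\<^sub>F s in at_right 0. y - s *\<^sub>R n \<in> \<Omega> \<and> y + s *\<^sub>R n \<notin> closure \<Omega>)"

definition outward_unit_normal :: "'a::real_inner set \<Rightarrow> 'a \<Rightarrow> 'a" where
  "outward_unit_normal \<Omega> y = (THE n. is_outward_unit_normal \<Omega> y n)"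

definition normal_derivative :: "'a::real_inner set \<Rightarrow> ('a \<Rightarrow> real) \<Rightarrow> 'a \<Rightarrow> real" where
  "normal_derivative \<Omega> g y = inner (gradient g y) (outward_unit_normal \<Omega> y)"

definition regular_parametrization :: "(real \<Rightarrow> 'a::euclidean_space) \<Rightarrow> 'a set \<Rightarrow> bool" where
  "regular_parametrization \<gamma> C \<longleftrightarrow>
     simple_path \<gamma> \<and> pathfinish \<gamma> = pathstart \<gamma> \<and> path_image \<gamma> = C \<and>
     \<gamma> C1_differentiable_on {0..1} \<and> (\<forall>t\<in>{0..1}. vector_derivative \<gamma> (at t) \<noteq> 0)"

(* Arc length measure of a closed C^1 Jordan curve C: the image of |\<gamma>'(t)| dt under a
   regular parametrization \<gamma> of C. By the substitution rule the choice of \<gamma> does not matter. *)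
definition arc_length_measure :: "'a::euclidean_space set \<Rightarrow> 'a measure" where
  "arc_length_measure C = (let \<gamma> = (SOME \<gamma>. regular_parametrization \<gamma> C) in
     distr (density (restrict_space lborel {0..1}) (\<lambda>t. ennreal (norm (vector_derivative \<gamma> (at t)))))
       borel \<gamma>)"

end

theory Submission
  imports Defs "HOL-Real_Asymp.Real_Asymp" "HOL-Complex_Analysis.Cauchy_Integral_Formula"
begin

text \<open>
  By Poisson's formula (the weighted mean of \<open>u\<close> over the section at time \<open>s\<close> of the backward light cone has
  vanishing \<open>s\<close>-derivative, being the integral of a divergence on the sphere), the spatial gradient of \<open>u\<close> at
  \<open>(y, t)\<close> is the time derivative of a mean of the gradient of \<open>f\<close> over the disc of radius \<open>t\<close> around \<open>y\<close>.
  Replace the singular weight \<open>1/sqrt (t\<^sup>2 - a\<^sup>2)\<close>, \<open>a = \<bar>x - y\<bar>\<close>, by the real part of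
  \<open>1/sqrt (t\<^sup>2 - a\<^sup>2 - \<i>\<epsilon>)\<close>. By an Abel transform the time integral becomes a planar integral of the
  gradient of \<open>f\<close> at \<open>z\<close> against the real part of \<open>1/(\<bar>z - y\<bar>\<^sup>2 - \<bar>x - y\<bar>\<^sup>2 - \<i>\<epsilon>)\<close>.
  For the boundary point \<open>y = c + A(cos \<theta>, sin \<theta>)\<close> of the ellipse and \<open>z = x + r S(cos \<phi>, sin \<phi>)\<close>,
  where \<open>S\<close> is the inverse transpose of \<open>A\<close>, the denominator is \<open>\<alpha> - 2r cos (\<theta> - \<phi>) - \<i>\<epsilon>\<close> with
  \<open>\<bar>\<alpha>\<bar> < 2r\<close> as long as \<open>z\<close> lies inside. So the boundary integral is explicit, and for \<open>\<epsilon> \<longlongrightarrow> 0\<close> it tends to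
  \<open>- \<pi> \<bar>det A\<bar> / r\<close> times the derivative of \<open>f\<close> along the ray through \<open>z\<close>. Polar coordinates around \<open>x\<close> and
  the fundamental theorem of calculus on each ray leave \<open>f x\<close>.
\<close>

section \<open>Polar coordinates in the plane\<close>

text \<open>The imaginary shift serves two ends. For \<open>t < a\<close> the shifted root tends to
  an imaginary number, so its real part produces the lower limit of the time integral by itself. And
  without the shift the planar kernel is singular on the circle
  \<open>norm (z - y) = norm (x - y)\<close>, where a principal value would be needed. The shape of
  the domain enters because \<open>(norm (z - y))^2 - (norm (x - y))^2\<close> is affine in
  \<open>y\<close>, hence a trigonometric polynomial of degree one on an ellipse. The inversion is
  exact because the limit of the integral of \<open>cos\<close> against this kernel does not depend
  on the constant term, as long as that term is smaller than the amplitude: the positions of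
  \<open>x\<close> and \<open>z\<close> leave no trace but the factor 1/r, which the polar Jacobian
  cancels, while \<open>\<bar>det A\<bar>\<close> cancels the Jacobian of \<open>S\<close>. The
  limits of integrals are taken by dominated convergence, which is why uniform bounds accompany the
  formulas.\<close>

definition dir :: "real \<Rightarrow> real^2" where
  "dir \<theta> = vector [cos \<theta>, sin \<theta>]"

lemma dir_nth [simp]: "dir \<theta> $ 1 = cos \<theta>" "dir \<theta> $ 2 = sin \<theta>"
  by (simp_all add: dir_def)

lemma inner_vec2: "(v::real^2) \<bullet> w = v$1 * w$1 + v$2 * w$2"
  by (simp add: inner_vec_def sum_2)

lemma vec2_eq_iff: "(v::real^2) = w \<longleftrightarrow> v$1 = w$1 \<and> v$2 = w$2"
  by (simp add: vec_eq_iff forall_2)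

lemma norm_vec2_sq: "(norm (v::real^2))\<^sup>2 = (v$1)\<^sup>2 + (v$2)\<^sup>2"
  by (simp add: norm_eq_sqrt_inner inner_vec2 power2_eq_square)

lemma matvec2_nth [simp]:
  "((A::real^2^2) *v v) $ 1 = A$1$1 * v$1 + A$1$2 * v$2"
  "((A::real^2^2) *v v) $ 2 = A$2$1 * v$1 + A$2$2 * v$2"
  by (simp_all add: matrix_vector_mult_def sum_2)

lemma continuous_on_vec2 [continuous_intros]:
  assumes "continuous_on S f" "continuous_on S g"
  shows "continuous_on S (\<lambda>x. vector [f x, g x] :: real^2)"
proof -
  have "(\<lambda>x. vector [f x, g x] :: real^2) = (\<lambda>x. f x *\<^sub>R axis 1 1 + g x *\<^sub>R axis 2 1)"
    by (auto simp: vec2_eq_iff axis_def)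
  then show ?thesis
    by (simp only:) (intro continuous_intros assms)
qed

lemma continuous_on_dir [continuous_intros]:
  fixes f :: "'a::t2_space \<Rightarrow> real"
  shows "continuous_on S f \<Longrightarrow> continuous_on S (\<lambda>x. dir (f x))"
  unfolding dir_def by (rule continuous_on_vec2 continuous_on_cos continuous_on_sin | assumption)+

lemma norm_dir [simp]: "norm (dir \<theta>) = 1"
  by (simp add: norm_eq_sqrt_inner inner_vec2 flip: power2_eq_square)

lemma vec2_measurable_pair [measurable]:
  "(\<lambda>(a, b). vector [a, b] :: real^2) \<in> borel \<Otimes>\<^sub>M borel \<rightarrow>\<^sub>M borel"
  unfolding borel_prod split_beta
  by (intro borel_measurable_continuous_onI continuous_intros)

lemma Basis_vec2: "(Basis :: (real^2) set) = {axis 1 1, axis 2 1}"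
  by (auto simp: Basis_vec_def UNIV_2)

text \<open>Joins two models of the plane: the change of variables theorem speaks of
  \<open>real^2\<close>, Fubini's theorem of the pair measure. By uniqueness of Lebesgue measure it
  is enough to compare open boxes.\<close>

lemma lborel_vec2:
  "(lborel :: (real^2) measure) = distr (lborel \<Otimes>\<^sub>M lborel) borel (\<lambda>(a, b). vector [a, b])"
proof (rule lborel_eqI)
  fix l u :: "real^2"
  assume le: "\<And>b. b \<in> Basis \<Longrightarrow> l \<bullet> b \<le> u \<bullet> b"
  have le': "l $ 1 \<le> u $ 1" "l $ 2 \<le> u $ 2"
    using le[of "axis 1 1"] le[of "axis 2 1"] by (auto simp: Basis_vec2 inner_axis)
  have "(\<lambda>(a, b). vector [a, b] :: real^2) -` box l u = {l$1<..<u$1} \<times> {l$2<..<u$2}"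
    by (auto simp: box_def Basis_vec2 inner_axis)
  then have "emeasure (distr (lborel \<Otimes>\<^sub>M lborel) borel (\<lambda>(a, b). vector [a, b])) (box l u)
      = emeasure (lborel \<Otimes>\<^sub>M lborel) ({l$1<..<u$1} \<times> {l$2<..<u$2})"
    by (subst emeasure_distr) (auto simp: space_pair_measure)
  also have "\<dots> = ennreal (u$1 - l$1) * ennreal (u$2 - l$2)"
    using le' by (subst lborel.emeasure_pair_measure_Times) auto
  also have "\<dots> = ennreal (\<Prod>b\<in>Basis. (u - l) \<bullet> b)"
    using le' by (simp add: Basis_vec2 inner_axis axis_eq_axis ennreal_mult inner_diff_left)
  finally show "emeasure (distr (lborel \<Otimes>\<^sub>M lborel) borel (\<lambda>(a, b). vector [a, b])) (box l u)
      = ennreal (\<Prod>b\<in>Basis. (u - l) \<bullet> b)" .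
qed auto

lemma
  fixes h :: "real^2 \<Rightarrow> 'a::{banach, second_countable_topology}"
  assumes [measurable]: "h \<in> borel_measurable borel"
  shows integrable_lborel_vec2:
      "integrable lborel h \<longleftrightarrow> integrable (lborel \<Otimes>\<^sub>M lborel) (\<lambda>(a, b). h (vector [a, b]))"
    and integral_lborel_vec2:
      "integral\<^sup>L lborel h = integral\<^sup>L (lborel \<Otimes>\<^sub>M lborel) (\<lambda>(a, b). h (vector [a, b]))"
  by (subst lborel_vec2, subst integrable_distr_eq integral_distr; simp add: split_beta')+

text \<open>Off the axis only, because the angle ranges over an open interval that misses the ray
  \<open>\<theta> = 0\<close>; what is left out is a null set.\<close>

lemma polar_surj:
  fixes v :: "real^2"
  assumes "v $ 2 \<noteq> 0"
  obtains r \<theta> where "0 < r" "0 < \<theta>" "\<theta> < 2 * pi" "v = r *\<^sub>R dir \<theta>"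
proof -
  have pos: "norm v > 0" using assms by (metis zero_index zero_less_norm_iff)
  have "(v$1 / norm v)\<^sup>2 + (v$2 / norm v)\<^sup>2 = ((v$1)\<^sup>2 + (v$2)\<^sup>2) / (norm v)\<^sup>2"
    by (simp only: power_divide add_divide_distrib)
  also have "\<dots> = 1"
    using pos unfolding norm_vec2_sq[symmetric] by (simp only: divide_self_if) simp
  finally obtain t where t: "0 \<le> t" "t < 2*pi" "v$1 / norm v = cos t" "v$2 / norm v = sin t"
    using sincos_total_2pi by blast
  then have v: "v$1 = norm v * cos t" "v$2 = norm v * sin t"
    using pos by (simp_all add: nonzero_divide_eq_eq mult.commute)
  have "t \<noteq> 0" using v(2) assms by auto
  with t(1) have "0 < t" by simp
  from that[OF pos this t(2)] v show ?thesis
    by (simp add: vec2_eq_iff)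
qed

lemma dir_inj:
  assumes "r > 0" "r' > 0" "0 < \<theta>" "\<theta> < 2 * pi" "0 < \<theta>'" "\<theta>' < 2 * pi"
    and "r *\<^sub>R dir \<theta> = r' *\<^sub>R dir \<theta>'"
  shows "r = r'" "\<theta> = \<theta>'"
proof -
  show r: "r = r'" using arg_cong[OF assms(7), of norm] assms(1,2) by simp
  have "cos \<theta> = cos \<theta>'" "sin \<theta> = sin \<theta>'"
    using assms(1,7) unfolding r by (auto simp: vec2_eq_iff)
  then have "sin (\<theta> - \<theta>') = 0" "cos (\<theta> - \<theta>') = 1"
    by (auto simp: sin_diff cos_diff simp flip: power2_eq_square)
  then obtain n :: int where n: "\<theta> - \<theta>' = real_of_int n * (2 * pi)"
    using cos_one_2pi_int[of "\<theta> - \<theta>'"] by (auto simp: mult_ac)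
  then have "\<bar>real_of_int n * (2 * pi)\<bar> < 1 * (2 * pi)" using assms by linarith
  then have "\<bar>n\<bar> < 1" unfolding abs_mult by simp
  then show "\<theta> = \<theta>'" using n by simp
qed

lemma has_derivative_dir [derivative_intros]:
  assumes "(f has_derivative f') (at x within S)"
  shows "((\<lambda>x. dir (f x)) has_derivative (\<lambda>h. f' h *\<^sub>R vector [- sin (f x), cos (f x)])) (at x within S)"
proof -
  have 1: "dir = (\<lambda>t. cos t *\<^sub>R axis 1 1 + sin t *\<^sub>R axis 2 1)"
    by (simp add: fun_eq_iff vec2_eq_iff axis_def)
  have 2: "vector [a, b] = a *\<^sub>R axis 1 1 + b *\<^sub>R (axis 2 1 :: real^2)" for a b
    by (simp add: vec2_eq_iff axis_def)
  have "((\<lambda>x. cos (f x) *\<^sub>R axis 1 1 + sin (f x) *\<^sub>R (axis 2 1 :: real^2)) has_derivative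
      (\<lambda>h. (f' h * - sin (f x)) *\<^sub>R axis 1 1 + (f' h * cos (f x)) *\<^sub>R axis 2 1)) (at x within S)"
    by (rule has_derivative_add has_derivative_scaleR_left has_derivative_cos has_derivative_sin assms)+
  then show ?thesis
    unfolding 1 2 scaleR_add_right scaleR_scaleR .
qed

text \<open>Polar coordinates followed by an affine map, with Jacobian \<open>r * det M\<close>.
  They serve twice: with \<open>M = mat 1\<close> for circular means, and with the inverse transpose
  of the ellipse matrix for the rays through \<open>x\<close>.\<close>

lemma polar_coordinates_lborel:
  fixes h :: "real^2 \<Rightarrow> real" and M :: "real^2^2"
  assumes h: "integrable lborel h" and M: "det M \<noteq> 0"
  shows "integrable (lborel \<Otimes>\<^sub>M lborel)
           (\<lambda>(r, \<theta>). indicator ({0<..} \<times> {0<..<2*pi}) (r, \<theta>) * (r * h (c + r *\<^sub>R (M *v dir \<theta>))))"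
      (is "integrable _ ?P")
    and "integral\<^sup>L (lborel \<Otimes>\<^sub>M lborel)
           (\<lambda>(r, \<theta>). indicator ({0<..} \<times> {0<..<2*pi}) (r, \<theta>) * (r * h (c + r *\<^sub>R (M *v dir \<theta>))))
         = integral\<^sup>L lborel h / \<bar>det M\<bar>"
proof -
  define S :: "(real^2) set" where "S = {p. 0 < p$1 \<and> 0 < p$2 \<and> p$2 < 2 * pi}"
  define g :: "real^2 \<Rightarrow> real^2" where "g p = c + p$1 *\<^sub>R (M *v dir (p$2))" for p
  define g' :: "real^2 \<Rightarrow> real^2 \<Rightarrow> real^2" where
    "g' p = (\<lambda>v. v$1 *\<^sub>R (M *v dir (p$2)) + (p$1 * v$2) *\<^sub>R (M *v vector [- sin (p$2), cos (p$2)]))" for p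
  \<comment> \<open>The change of variables theorem takes vector-valued integrands, so
    \<open>h\<close> is carried along as a map into \<open>real^1\<close>.\<close>
  define f :: "real^2 \<Rightarrow> real^1" where "f z = vec (h z)" for z
  have hm [measurable]: "h \<in> borel_measurable borel"
    using h by auto
  have "open S"
    unfolding S_def by (intro open_Collect_conj open_Collect_less continuous_intros)
  then have Sm: "S \<in> sets borel" by simp
  have der: "(g has_derivative g' p) (at p within S)" for p
  proof -
    have *: "((\<lambda>p::real^2. p $ i) has_derivative (\<lambda>v. v $ i)) (at p within S)" for i
      by (simp add: bounded_linear_vec_nth bounded_linear_imp_has_derivative)
    have "((\<lambda>p. M *v dir (p$2)) has_derivative (\<lambda>v. M *v (v$2 *\<^sub>R vector [- sin (p$2), cos (p$2)])))
        (at p within S)"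
      by (intro bounded_linear.has_derivative[OF matrix_vector_mul_bounded_linear] has_derivative_dir *)
    from has_derivative_add[OF has_derivative_const[of c] has_derivative_scaleR[OF *[of 1] this]]
    show ?thesis
      unfolding g_def[abs_def] g'_def by (simp add: algebra_simps matrix_vector_mult_scaleR)
  qed
  have deteq: "det (matrix (g' p)) = p$1 * det M" for p
  proof -
    have 1: "matrix (g' p) $ i $ 1 = (M *v dir (p$2)) $ i"
      "matrix (g' p) $ i $ 2 = p$1 * (M *v vector [- sin (p$2), cos (p$2)]) $ i" for i
      by (simp_all add: matrix_def g'_def axis_def)
    have "det (matrix (g' p)) = p$1 * det M * ((cos (p$2))\<^sup>2 + (sin (p$2))\<^sup>2)"
      unfolding det_2 1 matvec2_nth dir_nth vector_2 by algebra
    then show ?thesis by simp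
  qed
  obtain N where "N ** M = mat 1" "M ** N = mat 1"
    using M invertible_det_nz[of M] by (auto simp: invertible_def)
  then have N: "N *v (M *v v) = v" "M *v (N *v v) = v" for v
    by (simp_all add: matrix_vector_mul_assoc)
  have inj: "inj_on g S"
  proof (rule inj_onI)
    fix p q assume pq: "p \<in> S" "q \<in> S" "g p = g q"
    then have "M *v (p$1 *\<^sub>R dir (p$2)) = M *v (q$1 *\<^sub>R dir (q$2))"
      by (simp add: g_def matrix_vector_mult_scaleR)
    then have "N *v (M *v (p$1 *\<^sub>R dir (p$2))) = N *v (M *v (q$1 *\<^sub>R dir (q$2)))"
      by (simp only:)
    then have "p$1 *\<^sub>R dir (p$2) = q$1 *\<^sub>R dir (q$2)"
      unfolding N .
    moreover have "0 < p$1" "0 < q$1" "0 < p$2" "p$2 < 2 * pi" "0 < q$2" "q$2 < 2 * pi"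
      using pq by (auto simp: S_def)
    ultimately have "p$1 = q$1" "p$2 = q$2"
      using dir_inj[of "p$1" "q$1" "p$2" "q$2"] by blast+
    then show "p = q"
      unfolding vec2_eq_iff by blast
  qed
  \<comment> \<open>The image misses at most the line through \<open>c\<close> on which the second
    coordinate of \<open>N *v (z - c)\<close> vanishes; the second row of \<open>N\<close> is a
    normal vector of that line.\<close>
  have neg: "negligible (- g ` S)"
  proof (rule negligible_subset)
    have "N $ 2 \<noteq> 0"
    proof
      assume "N $ 2 = 0"
      then have "(N *v (M *v axis 2 1)) $ 2 = 0"
        by (simp only: matvec2_nth) simp
      then show False
        by (simp add: N axis_def del: matvec2_nth)
    qed
    then show "negligible {z. (N $ 2) \<bullet> z = (N $ 2) \<bullet> c}"
      by (intro negligible_hyperplane) auto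
    show "- g ` S \<subseteq> {z. (N $ 2) \<bullet> z = (N $ 2) \<bullet> c}"
    proof (rule subsetI, rule CollectI, rule ccontr)
      fix z assume z: "z \<in> - g ` S" and "(N $ 2) \<bullet> z \<noteq> (N $ 2) \<bullet> c"
      then have "(N *v (z - c)) $ 2 \<noteq> 0"
        by (simp add: inner_vec2 algebra_simps)
      then obtain r t where rt: "0 < r" "0 < t" "t < 2 * pi" "N *v (z - c) = r *\<^sub>R dir t"
        using polar_surj by blast
      then have "M *v (N *v (z - c)) = r *\<^sub>R (M *v dir t)"
        by (simp add: matrix_vector_mult_scaleR)
      then have "z - c = r *\<^sub>R (M *v dir t)"
        by (simp only: N)
      then have "z = g (vector [r, t])"
        by (simp add: g_def algebra_simps)
      moreover have "vector [r, t] \<in> S" using rt by (simp add: S_def)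
      ultimately show False using z by blast
    qed
  qed
  have hU: "h absolutely_integrable_on UNIV" "integral UNIV h = integral\<^sup>L lborel h"
    unfolding set_integrable_def using h integral_lborel[OF h]
    by (simp_all add: integrable_completion)
  have hgS: "h absolutely_integrable_on (g ` S)" "integral (g ` S) h = integral\<^sup>L lborel h"
  proof -
    have neg': "negligible {x \<in> UNIV - g ` S. h x \<noteq> 0}" "negligible {x \<in> g ` S - UNIV. h x \<noteq> 0}"
      by (rule negligible_subset[OF neg], blast) simp
    show "h absolutely_integrable_on (g ` S)"
      by (rule absolutely_integrable_spike_set[OF hU(1) neg'])
    show "integral (g ` S) h = integral\<^sup>L lborel h"
      using integral_spike_set[OF neg'] hU(2) by simp
  qed
  have vec1: "f = (\<lambda>z. h z *\<^sub>R vec 1)"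
    by (simp add: f_def vec_eq_iff fun_eq_iff)
  have fU: "f absolutely_integrable_on (g ` S)" "integral (g ` S) f = vec (integral\<^sup>L lborel h)"
  proof -
    show "f absolutely_integrable_on (g ` S)"
      unfolding vec1 using hgS(1) by simp
    have "integral (g ` S) f = integral (g ` S) h *\<^sub>R vec 1"
      unfolding vec1
      using has_integral_linear[OF integrable_integral[OF set_lebesgue_integral_eq_integral(1)[OF hgS(1)]]
        bounded_linear_scaleR_left[of "vec 1 :: real^1"]]
      by (simp add: o_def integral_unique)
    then show "integral (g ` S) f = vec (integral\<^sup>L lborel h)"
      by (simp add: hgS vec_eq_iff)
  qed
  have *: "(\<lambda>x. \<bar>det (matrix (g' x))\<bar> *\<^sub>R f(g x)) absolutely_integrable_on S \<and>
           integral S (\<lambda>x. \<bar>det (matrix (g' x))\<bar> *\<^sub>R f(g x)) = vec (integral\<^sup>L lborel h)"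
  proof -
    have "S \<in> sets lebesgue" using Sm by simp
    show ?thesis
      by (rule iffD2[OF has_absolute_integral_change_of_variables[OF \<open>S \<in> sets lebesgue\<close> der inj]])
        (rule conjI fU)+
  qed
  define F where "F = (\<lambda>x. \<bar>det (matrix (g' x))\<bar> *\<^sub>R f (g x))"
  have F: "F absolutely_integrable_on S" "integral S F = vec (integral\<^sup>L lborel h)"
    using * by (simp_all add: F_def)
  have F1: "F x $ 1 = \<bar>det M\<bar> * (x$1 * h (g x))" if "x \<in> S" for x
    using that by (simp add: F_def deteq f_def abs_mult S_def)
  have gm [measurable]: "g \<in> borel_measurable borel"
    unfolding g_def[abs_def]
    by (intro borel_measurable_continuous_onI continuous_intros
      linear_continuous_on_compose[OF _ matrix_vector_mul_linear])
  define G where "G x = indicator S x * (x$1 * h (g x))" for x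
  have Gm [measurable]: "G \<in> borel_measurable borel"
    unfolding G_def using Sm by measurable
  have "integrable lebesgue (\<lambda>x. (indicator S x *\<^sub>R F x) $ 1)"
    using F(1) unfolding set_integrable_def
    by (rule integrable_bounded_linear[OF bounded_linear_vec_nth])
  moreover have eq: "(\<lambda>x. (indicator S x *\<^sub>R F x) $ 1) = (\<lambda>x. \<bar>det M\<bar> * G x)"
    by (auto simp: fun_eq_iff G_def F1 indicator_def)
  ultimately have "integrable lebesgue G"
    using M by simp
  then have G: "integrable lborel G"
    by (simp add: integrable_completion)
  have "\<bar>det M\<bar> * integral\<^sup>L lborel G = (\<integral>x. (indicator S x *\<^sub>R F x) $ 1 \<partial>lebesgue)"
    unfolding eq by (simp add: integral_completion)
  also have "\<dots> = (LINT x:S|lebesgue. F x) $ 1"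
    unfolding set_lebesgue_integral_def using F(1)[unfolded set_integrable_def]
    by (rule integral_bounded_linear[OF bounded_linear_vec_nth])
  also have "\<dots> = integral\<^sup>L lborel h"
    by (simp add: set_lebesgue_integral_eq_integral(2)[OF F(1)] F(2))
  finally have G2: "integral\<^sup>L lborel G = integral\<^sup>L lborel h / \<bar>det M\<bar>"
    using M by (simp add: field_simps)
  have P: "?P = (\<lambda>(r, \<theta>). G (vector [r, \<theta>]))"
    by (auto simp: fun_eq_iff G_def g_def S_def indicator_def)
  show "integrable (lborel \<Otimes>\<^sub>M lborel) ?P"
    using G unfolding P by (simp add: integrable_lborel_vec2)
  show "integral\<^sup>L (lborel \<Otimes>\<^sub>M lborel) ?P = integral\<^sup>L lborel h / \<bar>det M\<bar>"
    using G2 unfolding P by (simp add: integral_lborel_vec2)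
qed

section \<open>Poisson's formula\<close>

text \<open>By the mean value theorem, used in both orders, one and the same second difference
  \<open>D\<close> is \<open>h^2\<close> times a value of \<open>Fab\<close> and \<open>h^2\<close>
  times a value of \<open>Fba\<close>, both taken close to the origin. Continuity at the origin then
  forbids different values there.\<close>

lemma mixed_partials_eq:
  fixes F Fa Fb Fab Fba :: "real \<Rightarrow> real \<Rightarrow> real"
  assumes e: "e > 0"
    and Fa: "\<And>a b. \<bar>a\<bar> < e \<Longrightarrow> \<bar>b\<bar> < e \<Longrightarrow> ((\<lambda>a. F a b) has_real_derivative Fa a b) (at a)"
    and Fb: "\<And>a b. \<bar>a\<bar> < e \<Longrightarrow> \<bar>b\<bar> < e \<Longrightarrow> ((\<lambda>b. F a b) has_real_derivative Fb a b) (at b)"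
    and Fab: "\<And>a b. \<bar>a\<bar> < e \<Longrightarrow> \<bar>b\<bar> < e \<Longrightarrow> ((\<lambda>b. Fa a b) has_real_derivative Fab a b) (at b)"
    and Fba: "\<And>a b. \<bar>a\<bar> < e \<Longrightarrow> \<bar>b\<bar> < e \<Longrightarrow> ((\<lambda>a. Fb a b) has_real_derivative Fba a b) (at a)"
    and cab: "isCont (\<lambda>(a, b). Fab a b) (0, 0)"
    and cba: "isCont (\<lambda>(a, b). Fba a b) (0, 0)"
  shows "Fab 0 0 = Fba 0 0"
proof (rule ccontr)
  assume ne: "Fab 0 0 \<noteq> Fba 0 0"
  define d where "d = \<bar>Fab 0 0 - Fba 0 0\<bar> / 2"
  have d: "d > 0" using ne by (simp add: d_def)
  obtain e1 where e1: "e1 > 0" "\<And>p. dist p (0, 0) < e1 \<Longrightarrow> dist ((\<lambda>(a, b). Fab a b) p) (Fab 0 0) < d"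
    using cab d unfolding continuous_at_eps_delta by (metis case_prod_conv)
  obtain e2 where e2: "e2 > 0" "\<And>p. dist p (0, 0) < e2 \<Longrightarrow> dist ((\<lambda>(a, b). Fba a b) p) (Fba 0 0) < d"
    using cba d unfolding continuous_at_eps_delta by (metis case_prod_conv)
  define h where "h = min (e / 2) (min (e1 / 2) (e2 / 2))"
  have h: "0 < h" "h < e" "2 * h \<le> e1" "2 * h \<le> e2"
    using e e1 e2 by (auto simp: h_def)
  have near: "dist (a, b) (0, 0) < k" if "0 < a" "a < h" "0 < b" "b < h" "2 * h \<le> k" for a b k :: real
  proof -
    have "dist (a, b) (0, 0) \<le> \<bar>a\<bar> + \<bar>b\<bar>"
      by (simp add: dist_Pair_Pair dist_real_def sqrt_sum_squares_le_sum_abs)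
    then show ?thesis using that by linarith
  qed
  define D where "D = F h h - F h 0 - F 0 h + F 0 0"
  obtain a where a: "0 < a" "a < h" "D = h * (Fa a h - Fa a 0)"
  proof -
    have "\<exists>z>0. z < h \<and> (F h h - F h 0) - (F 0 h - F 0 0) = (h - 0) * (Fa z h - Fa z 0)"
      by (rule MVT2[of 0 h "\<lambda>a. F a h - F a 0"]) (use h in \<open>auto intro!: derivative_intros Fa\<close>)
    with that show ?thesis by (auto simp: D_def)
  qed
  obtain b where b: "0 < b" "b < h" "Fa a h - Fa a 0 = h * Fab a b"
  proof -
    have "\<exists>z>0. z < h \<and> Fa a h - Fa a 0 = (h - 0) * Fab a z"
      by (rule MVT2[of 0 h "\<lambda>b. Fa a b"]) (use h a in \<open>auto intro!: derivative_intros Fab\<close>)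
    with that show ?thesis by auto
  qed
  obtain b' where b': "0 < b'" "b' < h" "D = h * (Fb h b' - Fb 0 b')"
  proof -
    have "\<exists>z>0. z < h \<and> (F h h - F 0 h) - (F h 0 - F 0 0) = (h - 0) * (Fb h z - Fb 0 z)"
      by (rule MVT2[of 0 h "\<lambda>b. F h b - F 0 b"]) (use h in \<open>auto intro!: derivative_intros Fb\<close>)
    with that show ?thesis by (auto simp: D_def)
  qed
  obtain a' where a': "0 < a'" "a' < h" "Fb h b' - Fb 0 b' = h * Fba a' b'"
  proof -
    have "\<exists>z>0. z < h \<and> Fb h b' - Fb 0 b' = (h - 0) * Fba z b'"
      by (rule MVT2[of 0 h "\<lambda>a. Fb a b'"]) (use h b' in \<open>auto intro!: derivative_intros Fba\<close>)
    with that show ?thesis by auto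
  qed
  have "Fab a b = Fba a' b'"
    using a(3) b(3) b'(3) a'(3) h(1) by simp
  moreover have "\<bar>Fab a b - Fab 0 0\<bar> < d"
    using e1(2)[OF near[OF a(1,2) b(1,2) h(3)]] by (simp add: dist_real_def)
  moreover have "\<bar>Fba a' b' - Fba 0 0\<bar> < d"
    using e2(2)[OF near[OF a'(1,2) b'(1,2) h(4)]] by (simp add: dist_real_def)
  ultimately have "\<bar>Fab 0 0 - Fba 0 0\<bar> < 2 * d" by linarith
  then show False by (simp add: d_def)
qed

text \<open>The upper hemisphere projected to the plane: with the radius \<open>s = t sin \<phi>\<close>, Poisson's weight
  \<open>s/sqrt (t\<^sup>2 - s\<^sup>2) ds\<close> becomes the smooth \<open>t sin \<phi> d\<phi>\<close>.\<close>

definition sph :: "real \<Rightarrow> real \<Rightarrow> real^2" where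
  "sph \<theta> \<phi> = sin \<phi> *\<^sub>R dir \<theta>"

lemma sph_nth [simp]: "sph \<theta> \<phi> $ 1 = sin \<phi> * cos \<theta>" "sph \<theta> \<phi> $ 2 = sin \<phi> * sin \<theta>"
  by (simp_all add: sph_def)

lemma continuous_on_sph [continuous_intros]:
  fixes f g :: "'a::t2_space \<Rightarrow> real"
  assumes "continuous_on S f" "continuous_on S g"
  shows "continuous_on S (\<lambda>x. sph (f x) (g x))"
  unfolding sph_def by (intro continuous_intros assms)

lemma has_derivative_comp_line:
  fixes h :: "real^2 \<Rightarrow> real" and g :: "real \<Rightarrow> real^2"
  assumes "(h has_derivative (\<lambda>v. v$1 * h1 + v$2 * h2)) (at (g t))"
    and "(g has_vector_derivative g') (at t)"
  shows "((\<lambda>t. h (g t)) has_real_derivative (g'$1 * h1 + g'$2 * h2)) (at t)"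
proof -
  have "((\<lambda>t. h (g t)) has_derivative (\<lambda>s. (s *\<^sub>R g')$1 * h1 + (s *\<^sub>R g')$2 * h2)) (at t)"
    using has_derivative_compose[OF assms(2)[unfolded has_vector_derivative_def] assms(1)] .
  moreover have "(\<lambda>s. (s *\<^sub>R g')$1 * h1 + (s *\<^sub>R g')$2 * h2) = (*) (g'$1 * h1 + g'$2 * h2)"
    by (simp add: fun_eq_iff algebra_simps)
  ultimately show ?thesis
    unfolding has_field_derivative_def by simp
qed

text \<open>This will be the derivative of the cone mean, with \<open>r\<close> the remaining time.
  In the angles the weighted integrand is a divergence: \<open>A\<close> is the
  \<open>\<phi>\<close>-derivative of \<open>sin \<phi> * cos \<phi>\<close> times the radial
  component of \<open>(h1, h2)\<close>, which is zero at both ends, and \<open>B\<close> is the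
  \<open>\<theta>\<close>-derivative of the angular component, which is periodic.\<close>

lemma sphere_divergence:
  fixes h1 h2 h11 h12 h21 h22 :: "real^2 \<Rightarrow> real" and y :: "real^2" and r :: real
  assumes h1: "\<And>z. (h1 has_derivative (\<lambda>v. v$1 * h11 z + v$2 * h12 z)) (at z)"
    and h2: "\<And>z. (h2 has_derivative (\<lambda>v. v$1 * h21 z + v$2 * h22 z)) (at z)"
    and c: "continuous_on UNIV h11" "continuous_on UNIV h12" "continuous_on UNIV h21" "continuous_on UNIV h22"
  defines "I \<equiv> (\<lambda>e z. r * (h11 z + h22 z - (e$1)\<^sup>2 * h11 z - e$1 * e$2 * (h12 z + h21 z) - (e$2)\<^sup>2 * h22 z)
      - 2 * (e$1 * h1 z + e$2 * h2 z) :: real)"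
  shows "integral (cbox (0, 0) (2 * pi, pi / 2)) (\<lambda>(\<theta>, \<phi>). sin \<phi> * I (sph \<theta> \<phi>) (y + r *\<^sub>R sph \<theta> \<phi>)) = 0"
proof -
  define P :: "real \<Rightarrow> real \<Rightarrow> real^2" where "P \<theta> \<phi> = y + r *\<^sub>R sph \<theta> \<phi>" for \<theta> \<phi>
  have ch: "continuous_on UNIV h1" "continuous_on UNIV h2"
    using has_derivative_continuous[OF h1] has_derivative_continuous[OF h2]
    by (simp_all add: continuous_on_eq_continuous_at)
  have cP: "continuous_on X (\<lambda>p. P (fst p) (snd p))" for X
    unfolding P_def by (intro continuous_intros)
  have cc [continuous_intros]: "continuous_on X (\<lambda>p. g (P (fst p) (snd p)))"
    if "continuous_on UNIV g" for g :: "real^2 \<Rightarrow> real" and X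
    using continuous_on_compose2[OF that cP] by simp
  have dth: "((\<lambda>\<theta>. P \<theta> \<phi>) has_vector_derivative r *\<^sub>R (sin \<phi> *\<^sub>R vector [- sin \<theta>, cos \<theta>])) (at \<theta>)" for \<theta> \<phi>
  proof -
    have "((\<lambda>\<theta>. P \<theta> \<phi>) has_derivative (\<lambda>h. 0 + r *\<^sub>R (sin \<phi> *\<^sub>R (h *\<^sub>R vector [- sin \<theta>, cos \<theta>])))) (at \<theta>)"
      unfolding P_def sph_def
      by (rule has_derivative_add has_derivative_const has_derivative_scaleR_right has_derivative_dir has_derivative_ident)+
    then show ?thesis
      unfolding has_vector_derivative_def by (simp add: mult_ac)
  qed
  have dph: "((\<lambda>\<phi>. P \<theta> \<phi>) has_vector_derivative r *\<^sub>R (cos \<phi> *\<^sub>R dir \<theta>)) (at \<phi>)" for \<theta> \<phi>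
  proof -
    have "((\<lambda>\<phi>. P \<theta> \<phi>) has_derivative (\<lambda>h. 0 + r *\<^sub>R ((h * cos \<phi>) *\<^sub>R dir \<theta>))) (at \<phi>)"
      unfolding P_def sph_def
      by (rule has_derivative_add has_derivative_const has_derivative_scaleR_right has_derivative_scaleR_left
          has_derivative_sin has_derivative_ident)+
    then show ?thesis
      unfolding has_vector_derivative_def by (simp add: mult_ac)
  qed
  define A where "A \<theta> \<phi> = cos (2 * \<phi>) * (cos \<theta> * h1 (P \<theta> \<phi>) + sin \<theta> * h2 (P \<theta> \<phi>))
     + sin \<phi> * cos \<phi> * (cos \<theta> * (r * cos \<phi> * (cos \<theta> * h11 (P \<theta> \<phi>) + sin \<theta> * h12 (P \<theta> \<phi>)))
        + sin \<theta> * (r * cos \<phi> * (cos \<theta> * h21 (P \<theta> \<phi>) + sin \<theta> * h22 (P \<theta> \<phi>))))" for \<theta> \<phi>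
  define B where "B \<theta> \<phi> = - cos \<theta> * h1 (P \<theta> \<phi>) - sin \<theta> * h2 (P \<theta> \<phi>)
     - sin \<theta> * (r * sin \<phi> * (- sin \<theta> * h11 (P \<theta> \<phi>) + cos \<theta> * h12 (P \<theta> \<phi>)))
     + cos \<theta> * (r * sin \<phi> * (- sin \<theta> * h21 (P \<theta> \<phi>) + cos \<theta> * h22 (P \<theta> \<phi>)))" for \<theta> \<phi>
  have cA: "continuous_on X (\<lambda>(\<theta>, \<phi>). A \<theta> \<phi>)" and cB: "continuous_on X (\<lambda>(\<theta>, \<phi>). B \<theta> \<phi>)" for X
    unfolding A_def B_def split_beta
    by (intro continuous_intros ch c)+
  have A0: "integral (cbox 0 (pi/2)) (\<lambda>\<phi>. A \<theta> \<phi>) = 0" for \<theta>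
  proof -
    have "((\<lambda>\<phi>. A \<theta> \<phi>) has_integral
       sin (pi/2) * cos (pi/2) * (cos \<theta> * h1 (P \<theta> (pi/2)) + sin \<theta> * h2 (P \<theta> (pi/2)))
       - sin 0 * cos 0 * (cos \<theta> * h1 (P \<theta> 0) + sin \<theta> * h2 (P \<theta> 0))) {0..pi/2}"
    proof (rule fundamental_theorem_of_calculus)
      fix \<phi> :: real
      have "((\<lambda>\<phi>. sin \<phi> * cos \<phi> * (cos \<theta> * h1 (P \<theta> \<phi>) + sin \<theta> * h2 (P \<theta> \<phi>))) has_real_derivative A \<theta> \<phi>) (at \<phi>)"
        by (rule derivative_eq_intros has_derivative_comp_line[OF h1 dph] has_derivative_comp_line[OF h2 dph] refl)+
          (simp add: A_def cos_double[of \<phi>, simplified mult.commute[of 2]] cos_double power2_eq_square algebra_simps)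
      then show "((\<lambda>\<phi>. sin \<phi> * cos \<phi> * (cos \<theta> * h1 (P \<theta> \<phi>) + sin \<theta> * h2 (P \<theta> \<phi>))) has_vector_derivative A \<theta> \<phi>)
          (at \<phi> within {0..pi/2})"
        by (simp add: has_real_derivative_iff_has_vector_derivative has_vector_derivative_at_within)
    qed simp
    then show ?thesis by (simp add: integral_unique)
  qed
  have B0: "integral (cbox 0 (2*pi)) (\<lambda>\<theta>. B \<theta> \<phi>) = 0" for \<phi>
  proof -
    have "((\<lambda>\<theta>. B \<theta> \<phi>) has_integral
       (- sin (2*pi) * h1 (P (2*pi) \<phi>) + cos (2*pi) * h2 (P (2*pi) \<phi>))
       - (- sin 0 * h1 (P 0 \<phi>) + cos 0 * h2 (P 0 \<phi>))) {0..2*pi}"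
    proof (rule fundamental_theorem_of_calculus)
      fix \<theta> :: real
      have "((\<lambda>\<theta>. - sin \<theta> * h1 (P \<theta> \<phi>) + cos \<theta> * h2 (P \<theta> \<phi>)) has_real_derivative B \<theta> \<phi>) (at \<theta>)"
        by (rule derivative_eq_intros has_derivative_comp_line[OF h1 dth] has_derivative_comp_line[OF h2 dth] refl)+
          (simp add: B_def algebra_simps)
      then show "((\<lambda>\<theta>. - sin \<theta> * h1 (P \<theta> \<phi>) + cos \<theta> * h2 (P \<theta> \<phi>)) has_vector_derivative B \<theta> \<phi>)
          (at \<theta> within {0..2*pi})"
        by (simp add: has_real_derivative_iff_has_vector_derivative has_vector_derivative_at_within)
    qed simp
    moreover have "P (2*pi) \<phi> = P 0 \<phi>" by (simp add: P_def sph_def dir_def)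
    ultimately show ?thesis by (simp add: integral_unique)
  qed
  have eq: "sin \<phi> * I (sph \<theta> \<phi>) (P \<theta> \<phi>) = A \<theta> \<phi> + B \<theta> \<phi>" for \<theta> \<phi>
  proof -
    have *: "S * (r * (a11 + a22 - (S * c)\<^sup>2 * a11 - S * c * (S * s) * (a12 + a21) - (S * s)\<^sup>2 * a22)
        - 2 * (S * c * a1 + S * s * a2))
      = (1 - 2 * S\<^sup>2) * (c * a1 + s * a2) + S * C * (c * (r * C * (c * a11 + s * a12)) + s * (r * C * (c * a21 + s * a22)))
       + (- c * a1 - s * a2 - s * (r * S * (- s * a11 + c * a12)) + c * (r * S * (- s * a21 + c * a22)))"
      if "c\<^sup>2 + s\<^sup>2 = 1" "C\<^sup>2 + S\<^sup>2 = 1" for S C c s a1 a2 a11 a12 a21 a22 :: real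
      using that by algebra
    have cd: "cos (2 * \<phi>) = 1 - 2 * (sin \<phi>)\<^sup>2"
      by (simp add: cos_double_sin)
    show ?thesis
      unfolding I_def A_def B_def sph_nth cd by (rule *) simp_all
  qed
  have "integral (cbox (0, 0) (2 * pi, pi / 2)) (\<lambda>(\<theta>, \<phi>). A \<theta> \<phi> + B \<theta> \<phi>)
     = integral (cbox (0, 0) (2 * pi, pi / 2)) (\<lambda>(\<theta>, \<phi>). A \<theta> \<phi>)
     + integral (cbox (0, 0) (2 * pi, pi / 2)) (\<lambda>(\<theta>, \<phi>). B \<theta> \<phi>)"
    using integral_add[OF integrable_continuous[OF cA] integrable_continuous[OF cB]]
    unfolding split_beta .
  also have "integral (cbox (0, 0) (2 * pi, pi / 2)) (\<lambda>(\<theta>, \<phi>). A \<theta> \<phi>) = 0"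
    by (subst integral_prod_continuous[OF cA]) (simp add: A0[simplified])
  also have "integral (cbox (0, 0) (2 * pi, pi / 2)) (\<lambda>(\<theta>, \<phi>). B \<theta> \<phi>) = 0"
    by (subst integral_prod_continuous[OF cB])
      (simp only: prod.case integral_swap_continuous[OF cB], simp add: B0[simplified])
  finally show ?thesis
    by (simp add: eq flip: P_def)
qed

section \<open>Partial derivatives on the closed half-space and the constancy of the cone
  mean\<close>

lemma Ck_on_Suc_has_derivative:
  assumes "Ck_on (Suc k) g S" "x \<in> S"
  shows "(g has_derivative frechet_derivative g (at x within S)) (at x within S)"
  using assms by (auto simp: differentiable_on_def frechet_derivative_works)

text \<open>Records the total derivative through its coordinates, so that the chain rule along any
  curve is available and the next order can be expressed in the same way.\<close>

definition has_partials2 :: "(real^2 \<Rightarrow> real) \<Rightarrow> (real^2 \<Rightarrow> real) \<Rightarrow> (real^2 \<Rightarrow> real) \<Rightarrow> bool" where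
  "has_partials2 f f1 f2 \<longleftrightarrow> (\<forall>z. (f has_derivative (\<lambda>v. v$1 * f1 z + v$2 * f2 z)) (at z))"

text \<open>The derivative is relative to \<open>S\<close>: on the half-space it is one-sided in
  time at \<open>t = 0\<close>, where the initial values are read off.\<close>

definition has_partials3 ::
  "((real^2) \<times> real \<Rightarrow> real) \<Rightarrow> ((real^2) \<times> real \<Rightarrow> real) \<Rightarrow> ((real^2) \<times> real \<Rightarrow> real) \<Rightarrow>
   ((real^2) \<times> real \<Rightarrow> real) \<Rightarrow> ((real^2) \<times> real) set \<Rightarrow> bool" where
  "has_partials3 U u1 u2 u3 S \<longleftrightarrow>
     (\<forall>p\<in>S. (U has_derivative (\<lambda>h. fst h$1 * u1 p + fst h$2 * u2 p + snd h * u3 p)) (at p within S))"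

lemma linear_spacetime:
  fixes L :: "(real^2) \<times> real \<Rightarrow> real"
  assumes "linear L"
  shows "L h = fst h$1 * L (axis 1 1, 0) + fst h$2 * L (axis 2 1, 0) + snd h * L (0, 1)"
proof -
  interpret L: linear L by fact
  have "h = (fst h$1) *\<^sub>R (axis 1 1, 0) + (fst h$2) *\<^sub>R (axis 2 1, 0) + snd h *\<^sub>R (0, 1)"
    by (simp add: prod_eq_iff vec2_eq_iff axis_def)
  then have "L h = L ((fst h$1) *\<^sub>R (axis 1 1, 0) + (fst h$2) *\<^sub>R (axis 2 1, 0) + snd h *\<^sub>R (0, 1))"
    by simp
  then show ?thesis by (simp only: L.add L.scaleR real_scaleR_def)
qed

lemma linear_plane:
  fixes L :: "real^2 \<Rightarrow> real"
  assumes "linear L"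
  shows "L h = h$1 * L (axis 1 1) + h$2 * L (axis 2 1)"
proof -
  interpret L: linear L by fact
  have "h = (h$1) *\<^sub>R axis 1 1 + (h$2) *\<^sub>R axis 2 1"
    by (simp add: vec2_eq_iff axis_def)
  then have "L h = L ((h$1) *\<^sub>R axis 1 1 + (h$2) *\<^sub>R axis 2 1)"
    by simp
  then show ?thesis by (simp only: L.add L.scaleR real_scaleR_def)
qed

lemma Ck_on_Suc_partials3:
  assumes "Ck_on (Suc k) U S"
  obtains u1 u2 u3 where "has_partials3 U u1 u2 u3 S" "Ck_on k u1 S" "Ck_on k u2 S" "Ck_on k u3 S"
proof (rule that)
  let ?D = "\<lambda>p. frechet_derivative U (at p within S)"
  show "has_partials3 U (\<lambda>p. ?D p (axis 1 1, 0)) (\<lambda>p. ?D p (axis 2 1, 0)) (\<lambda>p. ?D p (0, 1)) S"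
    unfolding has_partials3_def
  proof
    fix p assume "p \<in> S"
    from Ck_on_Suc_has_derivative[OF assms this]
    show "(U has_derivative (\<lambda>h. fst h$1 * ?D p (axis 1 1, 0) + fst h$2 * ?D p (axis 2 1, 0)
        + snd h * ?D p (0, 1))) (at p within S)"
      by (subst linear_spacetime[symmetric]) (simp_all add: has_derivative_linear)
  qed
qed (use assms in auto)

lemma Ck_on_Suc_partials2:
  assumes "Ck_on (Suc k) f UNIV"
  obtains f1 f2 where "has_partials2 f f1 f2" "Ck_on k f1 UNIV" "Ck_on k f2 UNIV"
proof (rule that)
  let ?D = "\<lambda>p. frechet_derivative f (at p)"
  show "has_partials2 f (\<lambda>p. ?D p (axis 1 1)) (\<lambda>p. ?D p (axis 2 1))"
    unfolding has_partials2_def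
  proof
    fix p
    from Ck_on_Suc_has_derivative[OF assms, of p]
    show "(f has_derivative (\<lambda>h. h$1 * ?D p (axis 1 1) + h$2 * ?D p (axis 2 1))) (at p)"
      by (subst linear_plane[symmetric]) (simp_all add: has_derivative_linear)
  qed
qed (use assms in auto)

abbreviation halfspace :: "((real^2) \<times> real) set" where
  "halfspace \<equiv> UNIV \<times> {0..}"

lemma has_partials3_at:
  assumes "has_partials3 U u1 u2 u3 halfspace" "snd p > 0"
  shows "(U has_derivative (\<lambda>h. fst h$1 * u1 p + fst h$2 * u2 p + snd h * u3 p)) (at p)"
proof -
  have "p \<in> interior halfspace" using assms(2)
    by (cases p) (simp add: interior_Times)
  then have 1: "at p within halfspace = at p" by (rule at_within_interior)
  have "p \<in> halfspace" using assms(2) by (cases p) simp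
  from assms(1)[unfolded has_partials3_def, rule_format, OF this] show ?thesis
    unfolding 1 .
qed

lemma has_partials3_comp:
  assumes "has_partials3 U u1 u2 u3 halfspace" "snd (g t) > 0"
    and "(g has_vector_derivative (a, b)) (at t)"
  shows "((\<lambda>t. U (g t)) has_real_derivative (a$1 * u1 (g t) + a$2 * u2 (g t) + b * u3 (g t))) (at t)"
proof -
  have "((\<lambda>t. U (g t)) has_derivative (\<lambda>s. fst (s *\<^sub>R (a, b))$1 * u1 (g t) + fst (s *\<^sub>R (a, b))$2 * u2 (g t)
      + snd (s *\<^sub>R (a, b)) * u3 (g t))) (at t)"
    using has_derivative_compose[OF assms(3)[unfolded has_vector_derivative_def] has_partials3_at[OF assms(1,2)]] .
  moreover have "(\<lambda>s. fst (s *\<^sub>R (a, b))$1 * u1 (g t) + fst (s *\<^sub>R (a, b))$2 * u2 (g t)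
      + snd (s *\<^sub>R (a, b)) * u3 (g t)) = (*) (a$1 * u1 (g t) + a$2 * u2 (g t) + b * u3 (g t))"
    by (simp add: fun_eq_iff algebra_simps)
  ultimately show ?thesis
    unfolding has_field_derivative_def by simp
qed

lemma has_vector_derivative_line: "((\<lambda>s. z + s *\<^sub>R a) has_vector_derivative a) (at s within S)"
proof -
  have "((\<lambda>s. z + s *\<^sub>R a) has_derivative (\<lambda>h. 0 + h *\<^sub>R a)) (at s within S)"
    by (rule has_derivative_add has_derivative_const has_derivative_scaleR_left has_derivative_ident)+
  then show ?thesis by (simp add: has_vector_derivative_def)
qed

lemma has_vector_derivative_affine_spacetime:
  fixes c b :: real
  shows "((\<lambda>s. (z + s *\<^sub>R a, c + s * b)) has_vector_derivative (a, b)) (at s)"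
  using has_vector_derivative_Pair[OF has_vector_derivative_line has_vector_derivative_line[of c b]] by simp

lemma continuous_halfspace_isCont:
  assumes "continuous_on halfspace g" "snd p > 0"
  shows "isCont g p"
proof -
  have "p \<in> interior halfspace" using assms(2) by (cases p) (simp add: interior_Times)
  then show ?thesis using continuous_on_interior[OF assms(1)] by blast
qed

text \<open>Differentiation along \<open>a\<close> commutes with differentiation in time. The
  derivative of the cone mean uses it in this combined form, with \<open>a\<close> the direction
  \<open>sph \<theta> \<phi>\<close>.\<close>

lemma mixed_partials_spacetime:
  fixes a :: "real^2"
  assumes U: "has_partials3 U u1 u2 u3 halfspace"
    and u1: "has_partials3 u1 u11 u12 u13 halfspace"
    and u2: "has_partials3 u2 u21 u22 u23 halfspace"
    and u3: "has_partials3 u3 u31 u32 u33 halfspace"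
    and c: "continuous_on halfspace u13" "continuous_on halfspace u23"
      "continuous_on halfspace u31" "continuous_on halfspace u32"
    and p: "snd p > 0"
  shows "a$1 * u13 p + a$2 * u23 p = a$1 * u31 p + a$2 * u32 p"
proof -
  define Q where "Q r s = (fst p + r *\<^sub>R a, snd p + s)" for r s :: real
  have Q0: "Q 0 0 = p" by (simp add: Q_def)
  have dr: "((\<lambda>r. Q r s) has_vector_derivative (a, 0)) (at r)" for r s
    using has_vector_derivative_affine_spacetime[of "fst p" a "snd p + s" 0 r] by (simp add: Q_def)
  have ds: "((\<lambda>s. Q r s) has_vector_derivative (0, 1)) (at s)" for r s
    using has_vector_derivative_affine_spacetime[of "fst p + r *\<^sub>R a" 0 "snd p" 1 s] by (simp add: Q_def)
  have pos: "snd (Q r s) > 0" if "\<bar>s\<bar> < snd p" for r s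
    using that by (auto simp: Q_def)
  have "isCont (\<lambda>q. Q (fst q) (snd q)) (0, 0)"
    unfolding Q_def by (intro continuous_intros)
  then have cc: "isCont (\<lambda>q. g (Q (fst q) (snd q))) (0, 0)" if "continuous_on halfspace g" for g :: "_ \<Rightarrow> real"
    using continuous_halfspace_isCont[OF that p]
    by (intro isCont_o2[where f = "\<lambda>q. Q (fst q) (snd q)" and g = g]) (simp_all add: Q0)
  have "a$1 * u13 (Q 0 0) + a$2 * u23 (Q 0 0) = a$1 * u31 (Q 0 0) + a$2 * u32 (Q 0 0)"
  proof (rule mixed_partials_eq[where F = "\<lambda>r s. U (Q r s)" and Fa = "\<lambda>r s. a$1 * u1 (Q r s) + a$2 * u2 (Q r s)"
        and Fb = "\<lambda>r s. u3 (Q r s)"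
        and Fab = "\<lambda>r s. a$1 * u13 (Q r s) + a$2 * u23 (Q r s)"
        and Fba = "\<lambda>r s. a$1 * u31 (Q r s) + a$2 * u32 (Q r s)", OF p])
    fix r s :: real assume s: "\<bar>s\<bar> < snd p"
    show "((\<lambda>r. U (Q r s)) has_real_derivative a$1 * u1 (Q r s) + a$2 * u2 (Q r s)) (at r)"
      using has_partials3_comp[OF U pos[OF s] dr] by simp
    show "((\<lambda>s. U (Q r s)) has_real_derivative u3 (Q r s)) (at s)"
      using has_partials3_comp[OF U pos[OF s] ds] by simp
    show "((\<lambda>r. u3 (Q r s)) has_real_derivative a$1 * u31 (Q r s) + a$2 * u32 (Q r s)) (at r)"
      using has_partials3_comp[OF u3 pos[OF s] dr] by simp
    show "((\<lambda>s. a$1 * u1 (Q r s) + a$2 * u2 (Q r s)) has_real_derivative a$1 * u13 (Q r s) + a$2 * u23 (Q r s)) (at s)"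
      using DERIV_add[OF DERIV_cmult[OF has_partials3_comp[OF u1 pos[OF s] ds], of "a$1"]
          DERIV_cmult[OF has_partials3_comp[OF u2 pos[OF s] ds], of "a$2"]] by simp
  qed (unfold split_beta', (intro continuous_intros cc c)+)
  then show ?thesis by (simp add: Q0)
qed

lemma mixed_partials_plane:
  assumes f: "has_partials2 f f1 f2" and f1: "has_partials2 f1 f11 f12" and f2: "has_partials2 f2 f21 f22"
    and c: "continuous_on UNIV f12" "continuous_on UNIV f21"
  shows "f12 z = f21 z"
proof -
  define Q where "Q r s = z + vector [r, s]" for r s :: real
  have Q0: "Q 0 0 = z" by (simp add: Q_def vec2_eq_iff)
  have dr: "((\<lambda>r. Q r s) has_vector_derivative vector [1, 0]) (at r)" for r s
  proof -
    have "(\<lambda>r. Q r s) = (\<lambda>r. (z + vector [0, s]) + r *\<^sub>R vector [1, 0])" by (simp add: Q_def fun_eq_iff vec2_eq_iff)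
    then show ?thesis by (simp only: has_vector_derivative_line)
  qed
  have ds: "((\<lambda>s. Q r s) has_vector_derivative vector [0, 1]) (at s)" for r s
  proof -
    have "(\<lambda>s. Q r s) = (\<lambda>s. (z + vector [r, 0]) + s *\<^sub>R vector [0, 1])" by (simp add: Q_def fun_eq_iff vec2_eq_iff)
    then show ?thesis by (simp only: has_vector_derivative_line)
  qed
  have cc: "isCont (\<lambda>q. g (Q (fst q) (snd q))) (0, 0)" if "continuous_on UNIV g" for g :: "_ \<Rightarrow> real"
  proof -
    have "continuous_on UNIV (\<lambda>q. Q (fst q) (snd q))"
      unfolding Q_def by (intro continuous_intros)
    from continuous_on_compose2[OF that this] show ?thesis
      by (simp add: continuous_on_eq_continuous_at)
  qed
  note h = f[unfolded has_partials2_def, rule_format] f1[unfolded has_partials2_def, rule_format]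
    f2[unfolded has_partials2_def, rule_format]
  have "f12 (Q 0 0) = f21 (Q 0 0)"
  proof (rule mixed_partials_eq[where F = "\<lambda>r s. f (Q r s)" and Fa = "\<lambda>r s. f1 (Q r s)"
        and Fb = "\<lambda>r s. f2 (Q r s)"
        and Fab = "\<lambda>r s. f12 (Q r s)" and Fba = "\<lambda>r s. f21 (Q r s)", OF zero_less_one])
    fix r s :: real
    show "((\<lambda>r. f (Q r s)) has_real_derivative f1 (Q r s)) (at r)"
      using has_derivative_comp_line[OF h(1) dr] by simp
    show "((\<lambda>s. f (Q r s)) has_real_derivative f2 (Q r s)) (at s)"
      using has_derivative_comp_line[OF h(1) ds] by simp
    show "((\<lambda>r. f2 (Q r s)) has_real_derivative f21 (Q r s)) (at r)"
      using has_derivative_comp_line[OF h(3) dr] by simp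
    show "((\<lambda>s. f1 (Q r s)) has_real_derivative f12 (Q r s)) (at s)"
      using has_derivative_comp_line[OF h(2) ds] by simp
  qed (unfold split_beta', (intro cc c)+)
  then show ?thesis by (simp add: Q0)
qed

text \<open>Translates the iterated one-variable derivatives of the wave equation into second
  partials. The equality of \<open>deriv (u x)\<close> with \<open>u3\<close> holds at all positive
  times, hence in a neighbourhood of \<open>t\<close>, and can be differentiated once more.\<close>

lemma wave_equation_partials:
  assumes w: "\<And>x t. t > 0 \<Longrightarrow> (deriv ^^ 2) (u x) t - laplacian (\<lambda>z. u z t) x = 0"
    and U: "has_partials3 (\<lambda>(x, t). u x t) u1 u2 u3 halfspace"
    and u1: "has_partials3 u1 u11 u12 u13 halfspace"
    and u2: "has_partials3 u2 u21 u22 u23 halfspace"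
    and u3: "has_partials3 u3 u31 u32 u33 halfspace"
    and t: "t > 0"
  shows "u33 (x, t) = u11 (x, t) + u22 (x, t)"
proof -
  have "(u x has_real_derivative u3 (x, s)) (at s)" if "s > 0" for s
    using has_partials3_comp[OF U, of "\<lambda>s. (x, s)" s 0 1] that
      has_vector_derivative_affine_spacetime[of x 0 0 1 s] by simp
  then have "eventually (\<lambda>s. deriv (u x) s = u3 (x, s)) (nhds t)"
    using eventually_nhds_in_open[of "{0<..}" t] t
    by (auto elim!: eventually_mono intro: DERIV_imp_deriv)
  then have "deriv (deriv (u x)) t = deriv (\<lambda>s. u3 (x, s)) t"
    by (rule deriv_cong_ev) simp
  also have "\<dots> = u33 (x, t)"
    using has_partials3_comp[OF u3, of "\<lambda>s. (x, s)" t 0 1] t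
      has_vector_derivative_affine_spacetime[of x 0 0 1 t] by (intro DERIV_imp_deriv) simp
  finally have 1: "(deriv ^^ 2) (u x) t = u33 (x, t)"
    by (simp add: numeral_2_eq_2)
  have line: "((\<lambda>s. (x + s *\<^sub>R b, t)) has_vector_derivative (b, 0)) (at s)" for b s
    using has_vector_derivative_affine_spacetime[of x b t 0 s] by simp
  have D: "deriv (\<lambda>s. u (x + s *\<^sub>R b) t) = (\<lambda>s. b$1 * u1 (x + s *\<^sub>R b, t) + b$2 * u2 (x + s *\<^sub>R b, t))" for b
    using has_partials3_comp[OF U _ line, of _ b] t
    by (intro ext DERIV_imp_deriv) simp
  have D1: "deriv (\<lambda>s. u1 (x + s *\<^sub>R b, t)) 0 = b$1 * u11 (x, t) + b$2 * u12 (x, t)" for b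
    using has_partials3_comp[OF u1 _ line, of 0 b] t
    by (intro DERIV_imp_deriv) simp
  have D2: "deriv (\<lambda>s. u2 (x + s *\<^sub>R b, t)) 0 = b$1 * u21 (x, t) + b$2 * u22 (x, t)" for b
    using has_partials3_comp[OF u2 _ line, of 0 b] t
    by (intro DERIV_imp_deriv) simp
  have "laplacian (\<lambda>z. u z t) x = u11 (x, t) + u22 (x, t)"
    unfolding laplacian_def Basis_vec2
    by (simp add: axis_eq_axis numeral_2_eq_2 D) (simp add: axis_def D1 D2)
  with 1 w[OF t, of x] show ?thesis by simp
qed

lemma integral_sph_const:
  "integral (cbox (0, 0) (2 * pi, pi / 2)) (\<lambda>(\<theta>, \<phi>). sin \<phi> * c) = 2 * pi * c"
proof -
  have "integral (cbox (0, 0) (2 * pi, pi / 2)) (\<lambda>(\<theta>::real, \<phi>). sin \<phi> * c)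
     = integral (cbox 0 (2 * pi)) (\<lambda>\<theta>::real. integral (cbox 0 (pi / 2)) (\<lambda>\<phi>. sin \<phi> * c))"
    by (subst integral_prod_continuous) (auto simp: split_beta' intro!: continuous_intros)
  moreover have "((\<lambda>\<phi>. sin \<phi> * c) has_integral (- cos (pi/2) * c - - cos 0 * c)) {0..pi/2}"
    by (rule fundamental_theorem_of_calculus)
      (auto intro!: derivative_eq_intros simp flip: has_real_derivative_iff_has_vector_derivative)
  ultimately show ?thesis by (simp add: integral_unique)
qed

text \<open>The mean \<open>Z s\<close> is constant: at \<open>s = T\<close> the cone has shrunk to
  its apex and \<open>Z\<close> gives \<open>2 * pi * u y T\<close>, while at \<open>s = 0\<close>
  it sees the initial data alone. From here on \<open>u\<close> can be expressed through
  \<open>f\<close>.\<close>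

theorem wave_solution_poisson:
  assumes w: "wave_solution f u" and f: "has_partials2 f f1 f2" and T: "T > 0"
  shows "2 * pi * u y T = integral (cbox (0, 0) (2 * pi, pi / 2))
    (\<lambda>(\<theta>, \<phi>). sin \<phi> * (f (y + T *\<^sub>R sph \<theta> \<phi>)
        + T * (sph \<theta> \<phi> $ 1 * f1 (y + T *\<^sub>R sph \<theta> \<phi>) + sph \<theta> \<phi> $ 2 * f2 (y + T *\<^sub>R sph \<theta> \<phi>))))"
proof -
  define U where "U = (\<lambda>(x, t). u x t)"
  have wC: "Ck_on (Suc (Suc 0)) U halfspace"
    and wE: "\<And>x t. t > 0 \<Longrightarrow> (deriv ^^ 2) (u x) t - laplacian (\<lambda>z. u z t) x = 0"
    and w0: "\<And>x. u x 0 = f x" and w1: "\<And>x. (u x has_real_derivative 0) (at 0 within {0..})"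
    using w by (simp_all add: wave_solution_def U_def numeral_2_eq_2)
  obtain u1 u2 u3 where U: "has_partials3 U u1 u2 u3 halfspace" and
    C: "Ck_on (Suc 0) u1 halfspace" "Ck_on (Suc 0) u2 halfspace" "Ck_on (Suc 0) u3 halfspace"
    by (rule Ck_on_Suc_partials3[OF wC])
  obtain u11 u12 u13 where u1: "has_partials3 u1 u11 u12 u13 halfspace" and
    c1: "Ck_on 0 u11 halfspace" "Ck_on 0 u12 halfspace" "Ck_on 0 u13 halfspace"
    by (rule Ck_on_Suc_partials3[OF C(1)])
  obtain u21 u22 u23 where u2: "has_partials3 u2 u21 u22 u23 halfspace" and
    c2: "Ck_on 0 u21 halfspace" "Ck_on 0 u22 halfspace" "Ck_on 0 u23 halfspace"
    by (rule Ck_on_Suc_partials3[OF C(2)])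
  obtain u31 u32 u33 where u3: "has_partials3 u3 u31 u32 u33 halfspace" and
    c3: "Ck_on 0 u31 halfspace" "Ck_on 0 u32 halfspace" "Ck_on 0 u33 halfspace"
    by (rule Ck_on_Suc_partials3[OF C(3)])
  note c = c1[unfolded Ck_on.simps] c2[unfolded Ck_on.simps] c3[unfolded Ck_on.simps]
  have cU: "continuous_on halfspace U" "continuous_on halfspace u1" "continuous_on halfspace u2" "continuous_on halfspace u3"
    using wC C by (auto intro!: differentiable_imp_continuous_on)
  have eq: "u33 (x, t) = u11 (x, t) + u22 (x, t)" if "t > 0" for x t
    using wave_equation_partials[OF wE U[unfolded U_def] u1 u2 u3 that] .
  have U_at0: "(U has_derivative (\<lambda>h. fst h$1 * u1 (x, 0) + fst h$2 * u2 (x, 0) + snd h * u3 (x, 0)))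
      (at (x, 0) within S)" if "S \<subseteq> halfspace" for S x
  proof -
    have "(x, 0) \<in> halfspace" by simp
    from U[unfolded has_partials3_def, rule_format, OF this] show ?thesis
      using that by (rule has_derivative_subset)
  qed
  have u3_0: "u3 (x, 0) = 0" for x
  proof -
    have "((\<lambda>s. (x, s)) has_derivative (\<lambda>s. (0, s))) (at 0 within {0..})"
      by (rule has_derivative_Pair has_derivative_ident has_derivative_const)+
    from has_derivative_in_compose[OF this U_at0]
    have "(u x has_derivative (\<lambda>s. s * u3 (x, 0))) (at 0 within {0..})"
      by (auto simp: U_def)
    then have "(u x has_vector_derivative u3 (x, 0)) (at 0 within {0..})"
      by (simp add: has_vector_derivative_def)
    moreover have "(u x has_vector_derivative 0) (at 0 within {0..})"
      using w1[of x] by (simp add: has_real_derivative_iff_has_vector_derivative)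
    ultimately show ?thesis
      by (intro vector_derivative_unique_within) (simp_all add: at_within_Ici_at_right)
  qed
  have u12_0: "u1 (x, 0) = f1 x \<and> u2 (x, 0) = f2 x" for x
  proof -
    have "((\<lambda>z. (z, 0 :: real)) has_derivative (\<lambda>v. (v, 0))) (at x)"
      by (rule has_derivative_Pair has_derivative_ident has_derivative_const)+
    from has_derivative_in_compose[OF this U_at0]
    have "((\<lambda>z. U (z, 0)) has_derivative (\<lambda>v. v$1 * u1 (x, 0) + v$2 * u2 (x, 0))) (at x)"
      by auto
    then have "(f has_derivative (\<lambda>v. v$1 * u1 (x, 0) + v$2 * u2 (x, 0))) (at x)"
      by (simp add: U_def w0)
    note eq = has_derivative_unique[OF this f[unfolded has_partials2_def, rule_format]]
    show ?thesis
      using fun_cong[OF eq, of "vector [1, 0]"] fun_cong[OF eq, of "vector [0, 1]"] by simp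
  qed
  let ?B = "cbox (0, 0) (2 * pi, pi / 2) :: (real \<times> real) set"
  \<comment> \<open>\<open>P s q\<close> lies in the section at time \<open>s\<close> of the
    backward cone with apex \<open>(y, T)\<close>. \<open>F s\<close> is the integrand of Poisson's
    formula started at time \<open>s\<close>, with the initial value \<open>U\<close> and the
    initial velocity \<open>u3\<close> read there.\<close>
  define P where "P s q = (y + (T - s) *\<^sub>R sph (fst q) (snd q), s)" for s q
  define F where "F s q = sin (snd q) * (U (P s q) + (T - s) *
     (sph (fst q) (snd q) $ 1 * u1 (P s q) + sph (fst q) (snd q) $ 2 * u2 (P s q) + u3 (P s q)))" for s q
  define I where "I s e z = (T - s) * (u11 (z, s) + u22 (z, s) - (e$1)\<^sup>2 * u11 (z, s)
      - e$1 * e$2 * (u12 (z, s) + u21 (z, s)) - (e$2)\<^sup>2 * u22 (z, s)) - 2 * (e$1 * u1 (z, s) + e$2 * u2 (z, s))"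
    for s and e z :: "real^2"
  define F' where "F' s q = sin (snd q) * I s (sph (fst q) (snd q)) (y + (T - s) *\<^sub>R sph (fst q) (snd q))" for s q
  have cP: "continuous_on X (\<lambda>x. P (fst x) (snd x))" for X
    unfolding P_def by (intro continuous_intros)
  have cg: "continuous_on ({0..T} \<times> ?B) (\<lambda>x. g (P (fst x) (snd x)))" if "continuous_on halfspace g" for g :: "_ \<Rightarrow> real"
    by (rule continuous_on_compose2[OF that cP]) (auto simp: P_def)
  have cF: "continuous_on ({0..T} \<times> ?B) (\<lambda>x. F (fst x) (snd x))"
    unfolding F_def by (intro continuous_intros cg cU)
  have cF': "continuous_on ({0..T} \<times> ?B) (\<lambda>x. F' (fst x) (snd x))"
    unfolding F'_def I_def P_def[symmetric] by (intro continuous_intros cg cU c)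
  \<comment> \<open>Once the wave equation has replaced the second time derivative, the mixed
    derivatives cancel through the symmetry hypothesis, and the integrand of
    \<open>sphere_divergence\<close> remains.\<close>
  have poly: "m * (- a * p1 + - b * p2 + 1 * p3
          + ((0 - 1) * (a * p1 + b * p2 + p3) +
             (a * (- a * p11 + - b * p12 + 1 * p13) + b * (- a * p21 + - b * p22 + 1 * p23)
             + (- a * p31 + - b * p32 + 1 * (p11 + p22))) * (T - s)))
      = m * ((T - s) * (p11 + p22 - a\<^sup>2 * p11 - a * b * (p12 + p21) - b\<^sup>2 * p22) - 2 * (a * p1 + b * p2))"
    if "a * p13 + b * p23 = a * p31 + b * p32"
    for m a b s p1 p2 p3 p11 p12 p13 p21 p22 p23 p31 p32 :: real
  proof -
    have p: "b * p32 = a * p13 + b * p23 - a * p31" using that by simp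
    have "- b * p32 = - (a * p13 + b * p23 - a * p31)" unfolding p[symmetric] by simp
    then show ?thesis by (simp add: algebra_simps power2_eq_square)
  qed
  define Z where "Z s = integral ?B (F s)" for s
  have "continuous_on {0..T} Z"
    unfolding Z_def using cF by (intro integral_continuous_on_param) (simp add: split_beta')
  \<comment> \<open>The open interval suffices, since \<open>Z\<close> is continuous up to the ends;
    at \<open>s = 0\<close> the partials are one-sided derivatives only.\<close>
  moreover have "(Z has_real_derivative 0) (at s)" if s: "0 < s" "s < T" for s
  proof -
    have "(Z has_real_derivative integral ?B (F' s)) (at s within {0<..<T})"
      unfolding Z_def
    proof (rule leibniz_rule_field_derivative)
      fix s q assume s: "s \<in> {0<..<T}"
      then have pos: "0 < snd (P s q)" by (simp add: P_def)
      define e where "e = sph (fst q) (snd q)"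
      have dP: "((\<lambda>s. P s q) has_vector_derivative (- e, 1)) (at s)"
        using has_vector_derivative_affine_spacetime[of "y + T *\<^sub>R e" "- e" 0 1 s]
        by (simp add: P_def e_def algebra_simps)
      have Pe: "(y + (T - s) *\<^sub>R e, s) = P s q"
        by (simp add: P_def e_def)
      have sym: "e$1 * u13 (P s q) + e$2 * u23 (P s q) = e$1 * u31 (P s q) + e$2 * u32 (P s q)"
        by (rule mixed_partials_spacetime[OF U u1 u2 u3 _ _ _ _ pos]) (intro c)+
      have eqP: "u33 (P s q) = u11 (P s q) + u22 (P s q)"
        using eq s by (simp add: P_def)
      have "((\<lambda>s. sin (snd q) * (U (P s q) + (T - s) * (e $ 1 * u1 (P s q) + e $ 2 * u2 (P s q) + u3 (P s q))))
        has_real_derivative sin (snd q) * ((- e)$1 * u1 (P s q) + (- e)$2 * u2 (P s q) + 1 * u3 (P s q)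
          + ((0 - 1) * (e $ 1 * u1 (P s q) + e $ 2 * u2 (P s q) + u3 (P s q)) +
             (e $ 1 * ((- e)$1 * u11 (P s q) + (- e)$2 * u12 (P s q) + 1 * u13 (P s q))
             + e $ 2 * ((- e)$1 * u21 (P s q) + (- e)$2 * u22 (P s q) + 1 * u23 (P s q))
             + ((- e)$1 * u31 (P s q) + (- e)$2 * u32 (P s q) + 1 * u33 (P s q))) * (T - s)))) (at s)"
        by (rule DERIV_cmult DERIV_add DERIV_mult DERIV_diff DERIV_const DERIV_ident
            has_partials3_comp[OF U pos dP] has_partials3_comp[OF u1 pos dP]
            has_partials3_comp[OF u2 pos dP] has_partials3_comp[OF u3 pos dP])+
      also have "(sin (snd q) * ((- e)$1 * u1 (P s q) + (- e)$2 * u2 (P s q) + 1 * u3 (P s q)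
          + ((0 - 1) * (e $ 1 * u1 (P s q) + e $ 2 * u2 (P s q) + u3 (P s q)) +
             (e $ 1 * ((- e)$1 * u11 (P s q) + (- e)$2 * u12 (P s q) + 1 * u13 (P s q))
             + e $ 2 * ((- e)$1 * u21 (P s q) + (- e)$2 * u22 (P s q) + 1 * u23 (P s q))
             + ((- e)$1 * u31 (P s q) + (- e)$2 * u32 (P s q) + 1 * u33 (P s q))) * (T - s)))) = F' s q"
        unfolding F'_def I_def e_def[symmetric] Pe eqP vector_uminus_component by (rule poly[OF sym])
      finally show "((\<lambda>s. F s q) has_real_derivative F' s q) (at s within {0<..<T})"
        unfolding F_def e_def by (rule has_field_derivative_at_within)
    next
      show "F s integrable_on ?B" if "s \<in> {0<..<T}" for s
      proof -
        have "continuous_on ?B (\<lambda>q. F (fst (s, q)) (snd (s, q)))"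
          by (rule continuous_on_compose2[OF cF, of ?B "\<lambda>q. (s, q)"])
            (use that in \<open>auto intro!: continuous_intros\<close>)
        then show ?thesis by (simp add: integrable_continuous)
      qed
      show "continuous_on ({0<..<T} \<times> ?B) (\<lambda>(x, t). F' x t)"
        unfolding split_beta' by (rule continuous_on_subset[OF cF']) auto
    qed (use s in auto)
    moreover have "integral ?B (F' s) = 0"
    proof -
      have d: "((\<lambda>z. g (z, s)) has_derivative (\<lambda>v. v$1 * g1 (z, s) + v$2 * g2 (z, s))) (at z)"
        if "has_partials3 g g1 g2 g3 halfspace" for g g1 g2 g3 z
      proof -
        have "((\<lambda>z. (z, s)) has_derivative (\<lambda>v. (v, 0))) (at z)"
          by (rule has_derivative_Pair has_derivative_ident has_derivative_const)+
        from has_derivative_compose[OF this has_partials3_at[OF that]] s show ?thesis by simp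
      qed
      have cs: "continuous_on UNIV (\<lambda>z. g (z, s))" if "continuous_on halfspace g" for g :: "_ \<Rightarrow> real"
        by (rule continuous_on_compose2[OF that]) (use s in \<open>auto intro!: continuous_intros\<close>)
      show ?thesis
        using sphere_divergence[OF d[OF u1] d[OF u2] cs[OF c(1)] cs[OF c(2)] cs[OF c(4)] cs[OF c(5)], where y = y and r = "T - s"]
        unfolding F'_def I_def split_beta' .
    qed
    moreover have "at s within {0<..<T} = at s"
      using s by (intro at_within_open) auto
    ultimately show ?thesis by simp
  qed
  ultimately have Z: "Z T = Z 0"
    using DERIV_isconst_end[OF T] by blast
  have ZT: "Z T = 2 * pi * u y T"
  proof -
    have "F T = (\<lambda>(\<theta>, \<phi>). sin \<phi> * u y T)"
      by (simp add: fun_eq_iff F_def P_def U_def)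
    then show ?thesis unfolding Z_def by (simp only: integral_sph_const)
  qed
  have F0: "F 0 = (\<lambda>(\<theta>, \<phi>). sin \<phi> * (f (y + T *\<^sub>R sph \<theta> \<phi>)
        + T * (sph \<theta> \<phi> $ 1 * f1 (y + T *\<^sub>R sph \<theta> \<phi>) + sph \<theta> \<phi> $ 2 * f2 (y + T *\<^sub>R sph \<theta> \<phi>))))"
    by (simp add: fun_eq_iff F_def P_def U_def u3_0 u12_0 w0)
  show ?thesis
    unfolding ZT[symmetric] Z unfolding Z_def F0 ..
qed

section \<open>Spherical means\<close>

abbreviation sphbox :: "(real \<times> real) set" where
  "sphbox \<equiv> cbox (0, 0) (2 * pi, pi / 2)"

text \<open>For smooth \<open>g\<close> this is the wave with initial value 0 and initial velocity
  \<open>g\<close>. In planar coordinates, for \<open>t > 0\<close>, it is the integral of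
  \<open>g z / sqrt (t^2 - (norm (z - y))^2)\<close> over the disc of radius \<open>t\<close> around
  \<open>y\<close>, divided by \<open>2 * pi\<close>.\<close>

definition sph_mean :: "(real^2 \<Rightarrow> real) \<Rightarrow> real^2 \<Rightarrow> real \<Rightarrow> real" where
  "sph_mean g y t = integral sphbox (\<lambda>q. sin (snd q) * (t * g (y + t *\<^sub>R sph (fst q) (snd q)))) / (2 * pi)"

text \<open>The right-hand side of \<open>wave_solution_poisson\<close> divided by
  \<open>2 * pi\<close>, with \<open>g\<close> as initial value. It is also the time derivative of
  \<open>sph_mean g\<close> when \<open>g1\<close> and \<open>g2\<close> are the partials of
  \<open>g\<close>.\<close>

definition sph_mean' :: "(real^2 \<Rightarrow> real) \<Rightarrow> (real^2 \<Rightarrow> real) \<Rightarrow> (real^2 \<Rightarrow> real) \<Rightarrow> real^2 \<Rightarrow> real \<Rightarrow> real" where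
  "sph_mean' g g1 g2 y t = integral sphbox (\<lambda>q. sin (snd q) * (g (y + t *\<^sub>R sph (fst q) (snd q))
     + t * (sph (fst q) (snd q) $ 1 * g1 (y + t *\<^sub>R sph (fst q) (snd q))
          + sph (fst q) (snd q) $ 2 * g2 (y + t *\<^sub>R sph (fst q) (snd q))))) / (2 * pi)"

lemma has_partials2_continuous: "has_partials2 g g1 g2 \<Longrightarrow> continuous_on UNIV g"
  unfolding has_partials2_def
  by (meson continuous_at_imp_continuous_on has_derivative_continuous)

lemma has_partials2_comp:
  assumes "has_partials2 g g1 g2" "(\<gamma> has_vector_derivative v) (at t)"
  shows "((\<lambda>t. g (\<gamma> t)) has_real_derivative (v$1 * g1 (\<gamma> t) + v$2 * g2 (\<gamma> t))) (at t)"
  using has_derivative_comp_line[OF _ assms(2)] assms(1) unfolding has_partials2_def by blast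

lemma continuous_on_comp_UNIV:
  "continuous_on UNIV g \<Longrightarrow> continuous_on S f \<Longrightarrow> continuous_on S (\<lambda>x. g (f x))"
  by (rule continuous_on_compose2) auto

lemma sph_mean_has_derivative:
  assumes g: "has_partials2 g g1 g2" and c: "continuous_on UNIV g1" "continuous_on UNIV g2"
  shows "(sph_mean g y has_real_derivative sph_mean' g g1 g2 y t) (at t)"
proof -
  have "((\<lambda>t. integral sphbox (\<lambda>q. sin (snd q) * (t * g (y + t *\<^sub>R sph (fst q) (snd q)))))
    has_real_derivative integral sphbox (\<lambda>q. sin (snd q) * (g (y + t *\<^sub>R sph (fst q) (snd q))
     + t * (sph (fst q) (snd q) $ 1 * g1 (y + t *\<^sub>R sph (fst q) (snd q))
          + sph (fst q) (snd q) $ 2 * g2 (y + t *\<^sub>R sph (fst q) (snd q)))))) (at t within UNIV)"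
  proof (rule leibniz_rule_field_derivative)
    fix t and q :: "real \<times> real"
    let ?e = "sph (fst q) (snd q)"
    have "((\<lambda>t. sin (snd q) * (t * g (y + t *\<^sub>R ?e))) has_real_derivative
        sin (snd q) * (1 * g (y + t *\<^sub>R ?e) + (?e$1 * g1 (y + t *\<^sub>R ?e) + ?e$2 * g2 (y + t *\<^sub>R ?e)) * t)) (at t)"
      by (rule DERIV_cmult DERIV_mult DERIV_ident has_partials2_comp[OF g has_vector_derivative_line])+
    then show "((\<lambda>t. sin (snd q) * (t * g (y + t *\<^sub>R ?e))) has_real_derivative
        sin (snd q) * (g (y + t *\<^sub>R ?e) + t * (?e$1 * g1 (y + t *\<^sub>R ?e) + ?e$2 * g2 (y + t *\<^sub>R ?e)))) (at t within UNIV)"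
      by (simp add: mult.commute)
  next
    show "(\<lambda>q. sin (snd q) * (t * g (y + t *\<^sub>R sph (fst q) (snd q)))) integrable_on sphbox" for t
      by (intro integrable_continuous continuous_intros continuous_on_comp_UNIV[OF has_partials2_continuous[OF g]])
    show "continuous_on (UNIV \<times> sphbox) (\<lambda>(t, q). sin (snd q) * (g (y + t *\<^sub>R sph (fst q) (snd q))
     + t * (sph (fst q) (snd q) $ 1 * g1 (y + t *\<^sub>R sph (fst q) (snd q))
          + sph (fst q) (snd q) $ 2 * g2 (y + t *\<^sub>R sph (fst q) (snd q)))))"
      unfolding split_beta'
      by (intro continuous_intros continuous_on_comp_UNIV[OF has_partials2_continuous[OF g]]
          continuous_on_comp_UNIV[OF c(1)] continuous_on_comp_UNIV[OF c(2)])
  qed auto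
  then show ?thesis
    unfolding sph_mean_def[abs_def] sph_mean'_def by (rule DERIV_cdivide)
qed

lemma sph_mean'_continuous:
  assumes g: "continuous_on UNIV g" and c: "continuous_on UNIV g1" "continuous_on UNIV g2"
  shows "continuous_on UNIV (\<lambda>(y, t). sph_mean' g g1 g2 y t)"
proof -
  have "continuous_on UNIV (\<lambda>p. integral sphbox (\<lambda>q. sin (snd q) * (g (fst p + snd p *\<^sub>R sph (fst q) (snd q))
     + snd p * (sph (fst q) (snd q) $ 1 * g1 (fst p + snd p *\<^sub>R sph (fst q) (snd q))
          + sph (fst q) (snd q) $ 2 * g2 (fst p + snd p *\<^sub>R sph (fst q) (snd q))))))"
    by (rule integral_continuous_on_param, unfold split_beta')
     (intro continuous_intros continuous_on_comp_UNIV[OF g]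
          continuous_on_comp_UNIV[OF c(1)] continuous_on_comp_UNIV[OF c(2)])
  then show ?thesis
    unfolding sph_mean'_def[abs_def] split_beta' by (intro continuous_intros) auto
qed

lemma GDERIV_gradient:
  assumes "GDERIV g y :> D"
  shows "gradient g y = D"
  unfolding gradient_def
proof (rule the_equality)
  show "GDERIV g y :> D" by fact
  fix E assume "GDERIV g y :> E"
  with assms have "(\<lambda>h. h \<bullet> D) = (\<lambda>h. h \<bullet> E)"
    unfolding gderiv_def by (rule has_derivative_unique)
  then show "E = D" by (metis vector_eq_ldot)
qed

text \<open>Formally the partials of \<open>u\<close> are waves with initial values
  \<open>f1\<close> and \<open>f2\<close>. As \<open>u\<close> is only known to be twice
  continuously differentiable, Poisson's formula is differentiated under the integral instead; with
  \<open>f12 = f21\<close> the result is Poisson's formula for \<open>f1\<close> and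
  \<open>f2\<close>.\<close>

lemma wave_solution_gradient:
  assumes w: "wave_solution f u" and f: "has_partials2 f f1 f2"
    and f1: "has_partials2 f1 f11 f12" and f2: "has_partials2 f2 f21 f22"
    and c: "continuous_on UNIV f11" "continuous_on UNIV f12" "continuous_on UNIV f21" "continuous_on UNIV f22"
    and t: "t > 0"
  shows "gradient (\<lambda>z. u z t) y = vector [sph_mean' f1 f11 f12 y t, sph_mean' f2 f21 f22 y t]"
proof -
  have "Ck_on (Suc (Suc 0)) (\<lambda>(x, t). u x t) halfspace"
    using w by (simp add: wave_solution_def numeral_2_eq_2)
  from Ck_on_Suc_partials3[OF this] obtain u1 u2 u3 where
    U: "has_partials3 (\<lambda>(x, t). u x t) u1 u2 u3 halfspace" by metis
  have "((\<lambda>z. (z, t)) has_derivative (\<lambda>v. (v, 0))) (at y)"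
    by (rule has_derivative_Pair has_derivative_ident has_derivative_const)+
  from has_derivative_compose[OF this has_partials3_at[OF U]] t
  have "((\<lambda>z. u z t) has_derivative (\<lambda>v. v$1 * u1 (y, t) + v$2 * u2 (y, t))) (at y)"
    by simp
  moreover have "(\<lambda>v. v$1 * u1 (y, t) + v$2 * u2 (y, t)) = (\<lambda>v. v \<bullet> (vector [u1 (y, t), u2 (y, t)] :: real^2))"
    by (simp add: inner_vec2)
  ultimately have "GDERIV (\<lambda>z. u z t) y :> vector [u1 (y, t), u2 (y, t)]"
    by (simp add: gderiv_def)
  then have grad: "gradient (\<lambda>z. u z t) y = vector [u1 (y, t), u2 (y, t)]"
    by (rule GDERIV_gradient)
  have sym: "f12 z = f21 z" for z
    by (rule mixed_partials_plane[OF f f1 f2 c(2,3)])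
  have cf: "continuous_on UNIV f" "continuous_on UNIV f1" "continuous_on UNIV f2"
    using f f1 f2 has_partials2_continuous by blast+
  have dir: "n$1 * u1 (y, t) + n$2 * u2 (y, t) = n$1 * sph_mean' f1 f11 f12 y t + n$2 * sph_mean' f2 f21 f22 y t"
    (is "?L = _") for n :: "real^2"
  proof -
    have "((\<lambda>s. u (y + s *\<^sub>R n) t) has_real_derivative ?L) (at 0)"
      using has_partials3_comp[OF U, of "\<lambda>s. (y + s *\<^sub>R n, t)" 0 n 0] t
        has_vector_derivative_affine_spacetime[of y n t 0 0] by simp
    then have 1: "((\<lambda>s. 2 * pi * u (y + s *\<^sub>R n) t) has_real_derivative 2 * pi * ?L) (at 0)"
      by (rule DERIV_cmult)
    define P where "P s q = y + t *\<^sub>R sph (fst q) (snd q) + s *\<^sub>R n" for s and q :: "real \<times> real"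
    define E where "E q = sph (fst q) (snd q)" for q :: "real \<times> real"
    define F where "F s q = sin (snd q) * (f (P s q) + t * (E q $ 1 * f1 (P s q) + E q $ 2 * f2 (P s q)))" for s q
    define F' where "F' s q = sin (snd q) * (n$1 * f1 (P s q) + n$2 * f2 (P s q)
       + t * (E q $ 1 * (n$1 * f11 (P s q) + n$2 * f12 (P s q))
          + E q $ 2 * (n$1 * f21 (P s q) + n$2 * f22 (P s q))))" for s q
    have cP: "continuous_on X (\<lambda>x. P (fst x) (snd x))" for X
      unfolding P_def by (intro continuous_intros)
    note cc = continuous_on_comp_UNIV[OF _ cP]
    have cE: "continuous_on X (\<lambda>x. E (snd x))" for X :: "(real \<times> real \<times> real) set"
      unfolding E_def by (intro continuous_intros)
    have cF: "continuous_on X (\<lambda>x. F (fst x) (snd x))" for X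
      unfolding F_def by (intro continuous_intros cc cE cf)
    have cF': "continuous_on X (\<lambda>x. F' (fst x) (snd x))" for X
      unfolding F'_def by (intro continuous_intros cc cE cf c)
    have "((\<lambda>s. integral sphbox (F s)) has_real_derivative integral sphbox (F' 0)) (at 0 within UNIV)"
    proof (rule leibniz_rule_field_derivative)
      fix s q
      have dP: "((\<lambda>s. P s q) has_vector_derivative n) (at s)"
        unfolding P_def by (rule has_vector_derivative_line)
      show "((\<lambda>s. F s q) has_real_derivative F' s q) (at s within UNIV)"
        unfolding F_def F'_def
        by (rule DERIV_cmult DERIV_add has_partials2_comp[OF f dP] has_partials2_comp[OF f1 dP] has_partials2_comp[OF f2 dP])+
    next
      show "F s integrable_on sphbox" for s
      proof (rule integrable_continuous)
        have "continuous_on sphbox (\<lambda>q. (s, q))" by (intro continuous_intros)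
        from continuous_on_comp_UNIV[OF cF this] show "continuous_on sphbox (F s)" by simp
      qed
    qed (auto simp: split_beta' cF')
    moreover have "2 * pi * u (y + s *\<^sub>R n) t = integral sphbox (F s)" for s
      unfolding wave_solution_poisson[OF w f t] F_def P_def E_def split_beta'
      by (simp only: add_ac)
    ultimately have "((\<lambda>s. 2 * pi * u (y + s *\<^sub>R n) t) has_real_derivative integral sphbox (F' 0)) (at 0)"
      by simp
    from DERIV_unique[OF 1 this] have "2 * pi * ?L = integral sphbox (F' 0)" .
    moreover have "integral sphbox (F' 0) = 2 * pi * (n$1 * sph_mean' f1 f11 f12 y t + n$2 * sph_mean' f2 f21 f22 y t)"
    proof -
      define A where "A g g1 g2 = (\<lambda>q. sin (snd q) * (g (P 0 q) + t * (E q $ 1 * g1 (P 0 q) + E q $ 2 * g2 (P 0 q))))"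
        for g g1 g2 :: "real^2 \<Rightarrow> real"
      have I: "A g g1 g2 integrable_on sphbox" if "continuous_on UNIV g" "continuous_on UNIV g1" "continuous_on UNIV g2"
        for g g1 g2
        unfolding A_def P_def E_def
        by (intro integrable_continuous continuous_intros continuous_on_comp_UNIV[OF that(1)]
           continuous_on_comp_UNIV[OF that(2)] continuous_on_comp_UNIV[OF that(3)])
      have "F' 0 = (\<lambda>q. n$1 * A f1 f11 f12 q + n$2 * A f2 f21 f22 q)"
        unfolding F'_def A_def fun_eq_iff sym by (simp add: algebra_simps)
      then have "integral sphbox (F' 0) = n$1 * integral sphbox (A f1 f11 f12) + n$2 * integral sphbox (A f2 f21 f22)"
        using integral_add[OF integrable_on_cmult_left[OF I[OF cf(2) c(1,2)]] integrable_on_cmult_left[OF I[OF cf(3) c(3,4)]],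
            of "n$1" "n$2"]
        by simp
      then show ?thesis
        by (simp add: A_def P_def E_def sph_mean'_def field_simps)
    qed
    ultimately show ?thesis by simp
  qed
  show ?thesis
    unfolding grad using dir[of "vector [1, 0]"] dir[of "vector [0, 1]"] by (simp add: vec2_eq_iff)
qed

text \<open>Only a cap of height \<open>O(R\<^sup>2/t\<^sup>2)\<close> contributes. Its indicator is dominated by
  \<open>4\<rho>\<^sup>4/(\<rho>\<^sup>2 + 1 - cos \<phi>)\<^sup>2\<close> with \<open>\<rho> = R/t\<close>, whose integral against \<open>sin \<phi>\<close> is elementary.\<close>

lemma sin_cap_bound:
  fixes h :: "real \<Rightarrow> real"
  assumes c: "continuous_on {0..pi/2} h"
    and M: "\<And>\<phi>. \<phi> \<in> {0..pi/2} \<Longrightarrow> \<bar>h \<phi>\<bar> \<le> M" and z: "\<And>\<phi>. \<phi> \<in> {0..pi/2} \<Longrightarrow> R < t * sin \<phi> \<Longrightarrow> h \<phi> = 0"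
    and R: "R > 0" and t: "t \<ge> 0"
  shows "\<bar>integral {0..pi/2} (\<lambda>\<phi>. sin \<phi> * h \<phi>)\<bar> \<le> M * (1 + 4 * R\<^sup>2) / (1 + t\<^sup>2)"
proof -
  let ?I = "integral {0..pi/2} (\<lambda>\<phi>. sin \<phi> * h \<phi>)"
  have M0: "M \<ge> 0" using M[of 0] by simp
  have int: "(\<lambda>\<phi>. sin \<phi> * h \<phi>) integrable_on {0..pi/2}"
    by (intro integrable_continuous_interval continuous_intros c)
  have 1: "\<bar>?I\<bar> \<le> M"
  proof -
    have "((\<lambda>\<phi>. M * sin \<phi>) has_integral (- M * cos (pi/2) - - M * cos 0)) {0..pi/2}"
      by (rule fundamental_theorem_of_calculus)
       (auto intro!: derivative_eq_intros simp flip: has_real_derivative_iff_has_vector_derivative)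
    then have i: "(\<lambda>\<phi>. M * sin \<phi>) integrable_on {0..pi/2}" "integral {0..pi/2} (\<lambda>\<phi>. M * sin \<phi>) = M"
      by (auto simp: integral_unique)
    have "norm ?I \<le> integral {0..pi/2} (\<lambda>\<phi>. M * sin \<phi>)"
    proof (rule integral_norm_bound_integral[OF int i(1)])
      fix \<phi> :: real assume \<phi>: "\<phi> \<in> {0..pi/2}"
      then have "0 \<le> sin \<phi>" by (intro sin_ge_zero) auto
      then show "norm (sin \<phi> * h \<phi>) \<le> M * sin \<phi>"
        using mult_right_mono[OF M[OF \<phi>], of "sin \<phi>"] by (simp add: abs_mult mult.commute)
    qed
    then show ?thesis using i(2) by simp
  qed
  have 2: "t\<^sup>2 * \<bar>?I\<bar> \<le> M * (4 * R\<^sup>2)"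
  proof (cases "t = 0")
    case False
    with t have t: "t > 0" by simp
    define \<rho> where "\<rho> = R / t"
    have \<rho>: "\<rho> > 0" using R t by (simp add: \<rho>_def)
    have pos: "\<rho>\<^sup>2 + 1 - cos \<phi> > 0" for \<phi>
      using \<rho> cos_le_one[of \<phi>] zero_less_power[OF \<rho>, of 2] by linarith
    have "((\<lambda>\<phi>. M * (4 * \<rho>^4) * (sin \<phi> / (\<rho>\<^sup>2 + 1 - cos \<phi>)\<^sup>2)) has_integral
      (- (M * (4 * \<rho>^4)) / (\<rho>\<^sup>2 + 1 - cos (pi/2)) - - (M * (4 * \<rho>^4)) / (\<rho>\<^sup>2 + 1 - cos 0))) {0..pi/2}"
    proof (rule fundamental_theorem_of_calculus)
      fix \<phi> :: real
      have ne: "\<rho>\<^sup>2 + 1 - cos \<phi> \<noteq> 0" using pos[of \<phi>] by simp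
      have "((\<lambda>\<phi>. - (M * (4 * \<rho>^4)) / (\<rho>\<^sup>2 + 1 - cos \<phi>)) has_real_derivative
         M * (4 * \<rho>^4) * (sin \<phi> / (\<rho>\<^sup>2 + 1 - cos \<phi>)\<^sup>2)) (at \<phi>)"
        using ne by (auto intro!: derivative_eq_intros simp: power2_eq_square)
      then show "((\<lambda>\<phi>. - (M * (4 * \<rho>^4)) / (\<rho>\<^sup>2 + 1 - cos \<phi>)) has_vector_derivative
         M * (4 * \<rho>^4) * (sin \<phi> / (\<rho>\<^sup>2 + 1 - cos \<phi>)\<^sup>2)) (at \<phi> within {0..pi/2})"
        by (simp add: has_real_derivative_iff_has_vector_derivative has_vector_derivative_at_within)
    qed simp
    then have i: "(\<lambda>\<phi>. M * (4 * \<rho>^4) * (sin \<phi> / (\<rho>\<^sup>2 + 1 - cos \<phi>)\<^sup>2)) integrable_on {0..pi/2}"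
      "integral {0..pi/2} (\<lambda>\<phi>. M * (4 * \<rho>^4) * (sin \<phi> / (\<rho>\<^sup>2 + 1 - cos \<phi>)\<^sup>2))
        = M * (4 * \<rho>^4) / \<rho>\<^sup>2 - M * (4 * \<rho>^4) / (\<rho>\<^sup>2 + 1)"
      by (auto simp: integral_unique)
    have "norm ?I \<le> integral {0..pi/2} (\<lambda>\<phi>. M * (4 * \<rho>^4) * (sin \<phi> / (\<rho>\<^sup>2 + 1 - cos \<phi>)\<^sup>2))"
    proof (rule integral_norm_bound_integral[OF int i(1)])
      fix \<phi> :: real assume \<phi>: "\<phi> \<in> {0..pi/2}"
      then have s0: "0 \<le> sin \<phi>" by (intro sin_ge_zero) auto
      have c0: "0 \<le> cos \<phi>" using \<phi> by (intro cos_ge_zero) auto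
      show "norm (sin \<phi> * h \<phi>) \<le> M * (4 * \<rho>^4) * (sin \<phi> / (\<rho>\<^sup>2 + 1 - cos \<phi>)\<^sup>2)"
      proof (cases "R < t * sin \<phi>")
        case True
        then show ?thesis using z[OF \<phi>] M0 s0 \<rho> by simp
      next
        case False
        then have "sin \<phi> \<le> \<rho>" using t by (simp add: \<rho>_def field_simps)
        then have "(sin \<phi>)\<^sup>2 \<le> \<rho>\<^sup>2" using s0 by (intro power_mono)
        then have "1 - (cos \<phi>)\<^sup>2 \<le> \<rho>\<^sup>2" by (simp add: sin_squared_eq)
        moreover have "(cos \<phi>)\<^sup>2 \<le> cos \<phi>" using c0 cos_le_one[of \<phi>]
          by (simp add: power2_eq_square mult_left_le)
        ultimately have "\<rho>\<^sup>2 + 1 - cos \<phi> \<le> 2 * \<rho>\<^sup>2" by linarith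
        then have "(\<rho>\<^sup>2 + 1 - cos \<phi>)\<^sup>2 \<le> (2 * \<rho>\<^sup>2)\<^sup>2"
          using pos[of \<phi>] by (intro power_mono) auto
        also have "\<dots> = 4 * \<rho>^4" by (simp add: power_mult_distrib flip: power_mult)
        finally have "1 \<le> 4 * \<rho>^4 / (\<rho>\<^sup>2 + 1 - cos \<phi>)\<^sup>2"
          using pos[of \<phi>] by (simp add: le_divide_eq)
        then have "M * sin \<phi> * 1 \<le> M * sin \<phi> * (4 * \<rho>^4 / (\<rho>\<^sup>2 + 1 - cos \<phi>)\<^sup>2)"
          using M0 s0 by (intro mult_left_mono) auto
        moreover have "norm (sin \<phi> * h \<phi>) \<le> M * sin \<phi>"
          using mult_right_mono[OF M[OF \<phi>] s0] s0 by (simp add: abs_mult mult.commute)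
        ultimately show ?thesis by (simp add: mult_ac)
      qed
    qed
    also have "\<dots> \<le> M * (4 * \<rho>^4) / \<rho>\<^sup>2"
      unfolding i(2) using M0 by simp
    also have "\<dots> = M * 4 * \<rho>\<^sup>2"
      using \<rho> by (simp add: power4_eq_xxxx power2_eq_square)
    finally have "t\<^sup>2 * \<bar>?I\<bar> \<le> t\<^sup>2 * (M * 4 * \<rho>\<^sup>2)"
      by (intro mult_left_mono) auto
    then show ?thesis using t by (simp add: \<rho>_def power_divide)
  qed (use M0 in simp)
  have "\<bar>?I\<bar> * (1 + t\<^sup>2) \<le> M * (1 + 4 * R\<^sup>2)"
    using 1 2 by (simp add: algebra_simps)
  moreover have "1 + t\<^sup>2 > 0" by (simp add: add_pos_nonneg)
  ultimately show ?thesis by (simp add: le_divide_eq)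
qed

lemma sphbox_cap_bound:
  fixes h :: "real \<times> real \<Rightarrow> real"
  assumes c: "continuous_on sphbox h" and M: "\<And>q. q \<in> sphbox \<Longrightarrow> \<bar>h q\<bar> \<le> M"
    and z: "\<And>q. q \<in> sphbox \<Longrightarrow> R < t * sin (snd q) \<Longrightarrow> h q = 0"
    and R: "R > 0" and t: "t \<ge> 0"
  shows "\<bar>integral sphbox (\<lambda>q. sin (snd q) * h q)\<bar> \<le> 2 * pi * (M * (1 + 4 * R\<^sup>2) / (1 + t\<^sup>2))"
proof -
  let ?G = "\<lambda>\<theta>. integral {0..pi/2} (\<lambda>\<phi>. sin \<phi> * h (\<theta>, \<phi>))"
  have c': "continuous_on sphbox (\<lambda>q. sin (snd q) * h q)"
    by (intro continuous_intros c)
  have eq: "integral sphbox (\<lambda>q. sin (snd q) * h q) = integral {0..2*pi} ?G"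
    using integral_prod_continuous[OF c'] by simp
  have cG: "continuous_on (cbox 0 (2*pi)) ?G"
    using integral_continuous_on_param[of "cbox 0 (2*pi)" 0 "pi/2" "\<lambda>\<theta> \<phi>. sin \<phi> * h (\<theta>, \<phi>)"] c'
    by (simp add: split_beta' cbox_Pair_eq)
  have "norm (integral (cbox 0 (2*pi)) ?G) \<le> M * (1 + 4 * R\<^sup>2) / (1 + t\<^sup>2) * measure lborel (cbox 0 (2 * pi))"
  proof (rule integrable_bound)
    have "M \<ge> 0" using M[of "(0, 0)"] by (force simp: cbox_Pair_eq)
    then show "0 \<le> M * (1 + 4 * R\<^sup>2) / (1 + t\<^sup>2)"
      by (intro divide_nonneg_pos mult_nonneg_nonneg) (auto simp: add_pos_nonneg)
    show "?G integrable_on cbox 0 (2*pi)" by (rule integrable_continuous[OF cG])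
    fix \<theta> :: real assume \<theta>: "\<theta> \<in> cbox 0 (2*pi)"
    have "continuous_on {0..pi/2} (\<lambda>\<phi>. h (\<theta>, \<phi>))"
      by (rule continuous_on_compose2[OF c]) (use \<theta> in \<open>auto intro!: continuous_intros simp: cbox_Pair_eq\<close>)
    then show "norm (?G \<theta>) \<le> M * (1 + 4 * R\<^sup>2) / (1 + t\<^sup>2)"
      unfolding real_norm_def
      by (rule sin_cap_bound[where h = "\<lambda>\<phi>. h (\<theta>, \<phi>)", OF _ _ _ R t]) (use \<theta> M z in \<open>auto simp: cbox_Pair_eq\<close>)
  qed
  then show ?thesis unfolding eq by (simp add: mult.commute)
qed

lemma compact_support_bounded:
  fixes g :: "real^2 \<Rightarrow> real"
  assumes "continuous_on UNIV g" "\<And>z. norm z > R \<Longrightarrow> g z = 0"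
  obtains M where "M \<ge> 0" "\<And>z. \<bar>g z\<bar> \<le> M"
proof -
  have "bounded (g ` cball 0 R)"
    by (intro compact_imp_bounded compact_continuous_image continuous_on_subset[OF assms(1)]) auto
  then obtain B where "\<forall>z\<in>cball 0 R. \<bar>g z\<bar> \<le> B"
    by (auto simp: bounded_iff)
  then have B: "\<bar>g z\<bar> \<le> B" if "norm z \<le> R" for z
    using that by (simp add: mem_cball_0)
  have "\<bar>g z\<bar> \<le> max 0 B" for z
    using B[of z] assms(2)[of z] by (cases "norm z \<le> R") auto
  with that[of "max 0 B"] show ?thesis by auto
qed

lemma norm_sph: "norm (sph \<theta> \<phi>) = \<bar>sin \<phi>\<bar>"
  by (simp add: sph_def)

lemma sph_far:
  assumes "norm y \<le> R1" "R0 + R1 < t * sin \<phi>"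
  shows "norm (y + t *\<^sub>R sph \<theta> \<phi>) > R0"
proof -
  have "t * sin \<phi> \<le> norm (t *\<^sub>R sph \<theta> \<phi>)"
    by (simp add: norm_sph flip: abs_mult)
  also have "\<dots> \<le> norm (y + t *\<^sub>R sph \<theta> \<phi>) + norm y"
    using norm_triangle_ineq4[of "y + t *\<^sub>R sph \<theta> \<phi>" y] by simp
  finally show ?thesis using assms by linarith
qed

text \<open>The factor \<open>t\<close> in front of \<open>g1\<close> and \<open>g2\<close> would
  spoil the rate \<open>1 / t^2\<close> of the cap estimate, but it comes with a
  \<open>sin \<phi>\<close>, and \<open>t * sin \<phi>\<close> is at most \<open>R\<close> wherever
  the integrand does not vanish. The bound is uniform for base points in a ball, hence on the whole
  boundary.\<close>

lemma sph_mean'_decay: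
  assumes c: "continuous_on UNIV g" "continuous_on UNIV g1" "continuous_on UNIV g2"
    and z: "\<And>z. norm z > R0 \<Longrightarrow> g z = 0 \<and> g1 z = 0 \<and> g2 z = 0"
  obtains C where "C \<ge> 0" "\<And>y t. norm y \<le> R1 \<Longrightarrow> t \<ge> 0 \<Longrightarrow> \<bar>sph_mean' g g1 g2 y t\<bar> \<le> C / (1 + t\<^sup>2)"
proof -
  obtain M where M: "M \<ge> 0" "\<And>z. \<bar>g z\<bar> \<le> M"
    using compact_support_bounded[OF c(1), of R0] z by metis
  obtain M1 where M1: "M1 \<ge> 0" "\<And>z. \<bar>g1 z\<bar> \<le> M1"
    using compact_support_bounded[OF c(2), of R0] z by metis
  obtain M2 where M2: "M2 \<ge> 0" "\<And>z. \<bar>g2 z\<bar> \<le> M2"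
    using compact_support_bounded[OF c(3), of R0] z by metis
  define R where "R = max 1 (R0 + R1)"
  have R: "R > 0" "R0 + R1 \<le> R" by (auto simp: R_def)
  define K where "K = M + R * (M1 + M2)"
  have K: "K \<ge> 0" using M M1 M2 R by (simp add: K_def)
  show ?thesis
  proof (rule that[of "K * (1 + 4 * R\<^sup>2)"])
    show "0 \<le> K * (1 + 4 * R\<^sup>2)" using K by (intro mult_nonneg_nonneg) auto
    fix y :: "real^2" and t :: real assume y: "norm y \<le> R1" and t: "t \<ge> 0"
    define h where "h q = g (y + t *\<^sub>R sph (fst q) (snd q))
     + t * (sph (fst q) (snd q) $ 1 * g1 (y + t *\<^sub>R sph (fst q) (snd q))
          + sph (fst q) (snd q) $ 2 * g2 (y + t *\<^sub>R sph (fst q) (snd q)))" for q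
    have hz: "h q = 0" if "R < t * sin (snd q)" for q
      using z[OF sph_far[OF y, of R0 t "snd q" "fst q"]] that R by (simp add: h_def)
    have hb: "\<bar>h q\<bar> \<le> K" if q: "q \<in> sphbox" for q
    proof (cases "R < t * sin (snd q)")
      case True then show ?thesis using hz K by simp
    next
      case False
      let ?P = "y + t *\<^sub>R sph (fst q) (snd q)"
      have s: "0 \<le> sin (snd q)" using q by (intro sin_ge_zero) (auto simp: cbox_Pair_eq mem_Times_iff)
      have ts: "0 \<le> t * sin (snd q)" "t * sin (snd q) \<le> R" using s t False by auto
      have "\<bar>cos (fst q) * g1 ?P\<bar> \<le> 1 * M1" "\<bar>sin (fst q) * g2 ?P\<bar> \<le> 1 * M2"
        unfolding abs_mult by (intro mult_mono M1 M2; simp)+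
      then have A: "\<bar>cos (fst q) * g1 ?P + sin (fst q) * g2 ?P\<bar> \<le> M1 + M2"
        by linarith
      have "h q = g ?P + (t * sin (snd q)) * (cos (fst q) * g1 ?P + sin (fst q) * g2 ?P)"
        by (simp add: h_def algebra_simps)
      moreover have "\<bar>(t * sin (snd q)) * (cos (fst q) * g1 ?P + sin (fst q) * g2 ?P)\<bar> \<le> R * (M1 + M2)"
        unfolding abs_mult[of "t * sin (snd q)"] using ts A R by (intro mult_mono) auto
      ultimately show ?thesis
        using M(2)[of ?P] unfolding K_def by linarith
    qed
    have ch: "continuous_on sphbox h"
      unfolding h_def by (intro continuous_intros continuous_on_comp_UNIV[OF c(1)]
          continuous_on_comp_UNIV[OF c(2)] continuous_on_comp_UNIV[OF c(3)])
    have "\<bar>integral sphbox (\<lambda>q. sin (snd q) * h q)\<bar> \<le> 2 * pi * (K * (1 + 4 * R\<^sup>2) / (1 + t\<^sup>2))"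
      by (rule sphbox_cap_bound[OF ch hb hz R(1) t])
    then show "\<bar>sph_mean' g g1 g2 y t\<bar> \<le> K * (1 + 4 * R\<^sup>2) / (1 + t\<^sup>2)"
      unfolding sph_mean'_def h_def[symmetric] by (simp add: abs_divide divide_le_eq mult_ac)
  qed
qed

section \<open>Time integrals with a complex weight\<close>

text \<open>For \<open>\<zeta> = a^2 + \<i> * eps\<close> this is the smoothed root of
  \<open>t^2 - a^2\<close>. A nonreal \<open>\<zeta>\<close> keeps the radicand off the branch cut
  for every real \<open>t\<close>.\<close>

definition rt :: "complex \<Rightarrow> real \<Rightarrow> complex" where
  "rt \<zeta> t = csqrt (of_real (t\<^sup>2) - \<zeta>)"

lemma rt_arg_notin:
  assumes "Im \<zeta> \<noteq> 0"
  shows "of_real x - \<zeta> \<notin> \<real>\<^sub>\<le>\<^sub>0"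
  using assms by (auto simp: complex_nonpos_Reals_iff)

lemma rt_nonzero: "Im \<zeta> \<noteq> 0 \<Longrightarrow> rt \<zeta> t \<noteq> 0"
  using rt_arg_notin[of \<zeta> "t\<^sup>2"] by (auto simp: rt_def)

lemma rt_sq: "(rt \<zeta> t)\<^sup>2 = of_real (t\<^sup>2) - \<zeta>"
  by (simp add: rt_def)

lemma norm_rt: "cmod (rt \<zeta> t) = sqrt (cmod (of_real (t\<^sup>2) - \<zeta>))"
  by (simp add: rt_def)

lemma continuous_on_rt [continuous_intros]:
  assumes "Im \<zeta> \<noteq> 0" "continuous_on S f"
  shows "continuous_on S (\<lambda>x. rt \<zeta> (f x))"
proof -
  have "continuous_on (- \<real>\<^sub>\<le>\<^sub>0) csqrt" by (rule continuous_on_csqrt)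
  moreover have "continuous_on S (\<lambda>x. of_real ((f x)\<^sup>2) - \<zeta>)"
    by (intro continuous_intros assms)
  ultimately show ?thesis
    unfolding rt_def by (rule continuous_on_compose2) (use rt_arg_notin[OF assms(1)] in \<open>auto simp del: of_real_power\<close>)
qed

text \<open>The imaginary part controls \<open>\<sigma>\<close>, and then the real part controls
  \<open>\<tau>\<close>. Being homogeneous, the bound serves both \<open>rt\<close> (with
  \<open>\<sigma> = 1\<close>) and \<open>rt2\<close>.\<close>

lemma cmod_quadratic_lower:
  fixes \<zeta> :: complex
  assumes "Im \<zeta> \<noteq> 0"
  obtains c where "c > 0" "\<And>\<tau> \<sigma>. \<tau> \<ge> 0 \<Longrightarrow> \<sigma> \<ge> 0 \<Longrightarrow> c * (\<tau> + \<sigma>) \<le> cmod (of_real \<tau> - of_real \<sigma> * \<zeta>)"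
proof -
  define B where "B = 1 + (1 + \<bar>Re \<zeta>\<bar>) / \<bar>Im \<zeta>\<bar>"
  have B: "B > 0" using assms by (simp add: B_def add_pos_nonneg)
  have "1 / B * (\<tau> + \<sigma>) \<le> cmod (of_real \<tau> - of_real \<sigma> * \<zeta>)" if "\<tau> \<ge> 0" "\<sigma> \<ge> 0" for \<tau> \<sigma>
  proof -
    let ?m = "cmod (of_real \<tau> - of_real \<sigma> * \<zeta>)"
    have "\<sigma> * \<bar>Im \<zeta>\<bar> \<le> ?m"
      using abs_Im_le_cmod[of "of_real \<tau> - of_real \<sigma> * \<zeta>"] that by (simp add: abs_mult)
    then have s: "\<sigma> \<le> ?m / \<bar>Im \<zeta>\<bar>" using assms by (simp add: le_divide_eq)
    have "\<tau> - \<sigma> * \<bar>Re \<zeta>\<bar> \<le> \<bar>\<tau> - \<sigma> * Re \<zeta>\<bar>"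
    proof -
      have "\<sigma> * \<bar>Re \<zeta>\<bar> = \<bar>\<sigma> * Re \<zeta>\<bar>" using that by (simp add: abs_mult)
      then show ?thesis by linarith
    qed
    also have "\<dots> \<le> ?m"
      using abs_Re_le_cmod[of "of_real \<tau> - of_real \<sigma> * \<zeta>"] by simp
    finally have "\<tau> + \<sigma> \<le> ?m + \<sigma> * (1 + \<bar>Re \<zeta>\<bar>)" by (simp add: algebra_simps)
    also have "\<dots> \<le> ?m + ?m / \<bar>Im \<zeta>\<bar> * (1 + \<bar>Re \<zeta>\<bar>)"
      using s by (intro add_left_mono mult_right_mono) auto
    also have "\<dots> = B * ?m" by (simp add: B_def algebra_simps)
    finally show ?thesis using B by (simp add: field_simps)
  qed
  with B show ?thesis by (intro that[of "1 / B"]) auto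
qed

lemma integrable_inverse_one_plus_sq:
  "set_integrable lborel {0<..} (\<lambda>t::real. 1 / (1 + t\<^sup>2))"
proof -
  have "set_integrable lborel (einterval 0 \<infinity>) (\<lambda>t::real. 1 / (1 + t\<^sup>2))"
  proof (rule interval_integral_FTC_nonneg[where F = arctan and A = 0 and B = "pi / 2"])
    show "(arctan has_real_derivative 1 / (1 + x\<^sup>2)) (at x)" for x
      by (auto intro!: derivative_eq_intros simp: divide_inverse)
    show "isCont (\<lambda>t::real. 1 / (1 + t\<^sup>2)) x" for x
      by (intro continuous_intros) (metis add_pos_nonneg less_irrefl zero_le_power2 zero_less_one)
    show "((arctan \<circ> real_of_ereal) \<longlongrightarrow> 0) (at_right 0)"
      unfolding zero_ereal_def ereal_tendsto_simps
      using isCont_arctan[of 0] by (simp add: continuous_at filterlim_at_split)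
    show "((arctan \<circ> real_of_ereal) \<longlongrightarrow> pi / 2) (at_left \<infinity>)"
      unfolding ereal_tendsto_simps by (rule tendsto_arctan_at_top)
  qed (auto simp: add_nonneg_nonneg)
  moreover have "einterval 0 \<infinity> = {0<..}" by (auto simp: einterval_def)
  ultimately show ?thesis by simp
qed

lemma rt_lower:
  assumes "Im \<zeta> \<noteq> 0"
  obtains c where "c > 0" "\<And>t. c * sqrt (1 + t\<^sup>2) \<le> cmod (rt \<zeta> t)"
proof -
  obtain c where c: "c > 0" "\<And>\<tau> \<sigma>. \<tau> \<ge> 0 \<Longrightarrow> \<sigma> \<ge> 0 \<Longrightarrow> c * (\<tau> + \<sigma>) \<le> cmod (of_real \<tau> - of_real \<sigma> * \<zeta>)"
    using cmod_quadratic_lower[OF assms] by blast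
  have "sqrt c * sqrt (1 + t\<^sup>2) \<le> cmod (rt \<zeta> t)" for t
    unfolding norm_rt real_sqrt_mult[symmetric]
    using c(2)[of "t\<^sup>2" 1] by (simp add: add.commute)
  with c(1) show ?thesis by (intro that[of "sqrt c"]) auto
qed

lemma inverse_rt_has_vector_derivative:
  assumes "Im \<zeta> \<noteq> 0"
  shows "((\<lambda>t. 1 / rt \<zeta> t) has_vector_derivative - (of_real t / rt \<zeta> t ^ 3)) (at t)"
proof -
  have nz: "rt \<zeta> t \<noteq> 0" by (rule rt_nonzero[OF assms])
  have "((\<lambda>z. 1 / csqrt (z\<^sup>2 - \<zeta>)) has_field_derivative - (of_real t / rt \<zeta> t ^ 3)) (at (of_real t))"
  proof -
    have 1: "((\<lambda>z. csqrt (z\<^sup>2 - \<zeta>)) has_field_derivative (2 * of_real t / (2 * rt \<zeta> t))) (at (of_real t))"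
      unfolding rt_def of_real_power
      by (rule has_field_derivative_csqrt')
        (use rt_arg_notin[OF assms, of "t\<^sup>2"] in \<open>auto intro!: derivative_eq_intros\<close>)
    have "((\<lambda>z. inverse (csqrt (z\<^sup>2 - \<zeta>))) has_field_derivative
       - (inverse (csqrt ((of_real t)\<^sup>2 - \<zeta>)) * (2 * of_real t / (2 * rt \<zeta> t)) * inverse (csqrt ((of_real t)\<^sup>2 - \<zeta>))))
       (at (of_real t))"
      by (rule DERIV_inverse'[OF 1]) (use nz in \<open>simp add: rt_def\<close>)
    moreover have "csqrt ((of_real t)\<^sup>2 - \<zeta>) = rt \<zeta> t" by (simp add: rt_def)
    ultimately show ?thesis
      using nz by (simp add: inverse_eq_divide power3_eq_cube)
  qed
  from has_vector_derivative_real_field[OF this, of UNIV] show ?thesis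
    by (simp add: rt_def)
qed

text \<open>Moves the time derivative from \<open>k\<close> to the weight, so that the Abel integral
  \<open>sph_mean\<close> can be inserted for \<open>k\<close>. Both boundary terms vanish: at 0
  because \<open>k 0 = 0\<close>, at infinity because \<open>k\<close> is bounded and
  \<open>1 / rt \<zeta> t\<close> decays like \<open>1 / t\<close>.\<close>

lemma integral_by_parts_rt:
  fixes k k' :: "real \<Rightarrow> real"
  assumes \<zeta>: "Im \<zeta> \<noteq> 0"
    and k: "\<And>t. (k has_real_derivative k' t) (at t)" and k0: "k 0 = 0"
    and c: "continuous_on UNIV k'"
    and b': "\<And>t. t \<ge> 0 \<Longrightarrow> \<bar>k' t\<bar> \<le> C / (1 + t\<^sup>2)" and b: "\<And>t. t \<ge> 0 \<Longrightarrow> \<bar>k t\<bar> \<le> C"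
  shows "set_integrable lborel {0<..} (\<lambda>t. of_real (k' t) / rt \<zeta> t)"
    and "(LINT t:{0<..}|lborel. of_real (k' t) / rt \<zeta> t) = (LINT t:{0<..}|lborel. of_real (t * k t) / rt \<zeta> t ^ 3)"
proof -
  obtain d where d: "d > 0" "\<And>t. d * sqrt (1 + t\<^sup>2) \<le> cmod (rt \<zeta> t)"
    using rt_lower[OF \<zeta>] by blast
  have sq1: "1 \<le> sqrt (1 + t\<^sup>2)" for t :: real by simp
  have d': "d \<le> cmod (rt \<zeta> t)" for t
    using d(2)[of t] mult_left_mono[OF sq1[of t], of d] d(1) by linarith
  have C: "C \<ge> 0" using b[of 0] by simp
  have ck: "continuous_on UNIV k"
    using k by (meson DERIV_isCont continuous_at_imp_continuous_on)
  have nz: "rt \<zeta> t \<noteq> 0" for t by (rule rt_nonzero[OF \<zeta>])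
  have dom: "set_integrable lborel {0<..} (\<lambda>t. K * (1 / (1 + t\<^sup>2)))" for K :: real
    using integrable_inverse_one_plus_sq by (rule set_integrable_mult_right)
  have cont1: "continuous_on UNIV (\<lambda>t. of_real (k' t) / rt \<zeta> t)"
    by (intro continuous_intros c \<zeta>) (auto simp: nz)
  have cont2: "continuous_on UNIV (\<lambda>t. of_real (t * k t) / rt \<zeta> t ^ 3)"
    by (intro continuous_intros ck \<zeta>) (auto simp: nz)
  show i1: "set_integrable lborel {0<..} (\<lambda>t. of_real (k' t) / rt \<zeta> t)"
  proof (rule set_integrable_bound[OF dom[of "C / d"]])
    show "set_borel_measurable lborel {0<..} (\<lambda>t. of_real (k' t) / rt \<zeta> t)"
      unfolding set_borel_measurable_def
      using borel_measurable_continuous_onI[OF cont1] by measurable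
    show "AE t in lborel. t \<in> {0<..} \<longrightarrow> norm (of_real (k' t) / rt \<zeta> t) \<le> norm (C / d * (1 / (1 + t\<^sup>2)))"
    proof (intro AE_I2 impI)
      fix t :: real assume "t \<in> {0<..}"
      then have "\<bar>k' t\<bar> / cmod (rt \<zeta> t) \<le> (C / (1 + t\<^sup>2)) / d"
        using b'[of t] d' d(1) by (intro frac_le) (auto intro: order_trans[OF abs_ge_zero])
      then show "norm (of_real (k' t) / rt \<zeta> t) \<le> norm (C / d * (1 / (1 + t\<^sup>2)))"
        using C d(1) by (simp add: norm_divide abs_mult mult.commute)
    qed
  qed
  have i2: "set_integrable lborel {0<..} (\<lambda>t. of_real (t * k t) / rt \<zeta> t ^ 3)"
  proof (rule set_integrable_bound[OF dom[of "C / d ^ 3"]])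
    show "set_borel_measurable lborel {0<..} (\<lambda>t. of_real (t * k t) / rt \<zeta> t ^ 3)"
      unfolding set_borel_measurable_def
      using borel_measurable_continuous_onI[OF cont2] by measurable
    show "AE t in lborel. t \<in> {0<..} \<longrightarrow> norm (of_real (t * k t) / rt \<zeta> t ^ 3) \<le> norm (C / d ^ 3 * (1 / (1 + t\<^sup>2)))"
    proof (intro AE_I2 impI)
      fix t :: real assume t: "t \<in> {0<..}"
      define s where "s = sqrt (1 + t\<^sup>2)"
      have s: "t \<le> s" "s > 0" "s\<^sup>2 = 1 + t\<^sup>2" using t by (auto simp: s_def real_le_rsqrt add_pos_nonneg)
      have "\<bar>t * k t\<bar> / cmod (rt \<zeta> t) ^ 3 \<le> (s * C) / (d * s) ^ 3"
        using b[of t] d(2)[of t] d(1) t s by (intro frac_le) (auto simp: s_def abs_mult C intro!: mult_mono power_mono)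
      also have "\<dots> = C / d ^ 3 * (1 / s\<^sup>2)"
        using s d by (simp add: power_mult_distrib power3_eq_cube power2_eq_square)
      finally show "norm (of_real (t * k t) / rt \<zeta> t ^ 3) \<le> norm (C / d ^ 3 * (1 / (1 + t\<^sup>2)))"
        using C d(1) by (simp add: norm_divide norm_power norm_mult abs_mult s(3))
    qed
  qed
  define F where "F t = of_real (k t) * (1 / rt \<zeta> t)" for t
  define f where "f t = of_real (k' t) / rt \<zeta> t - of_real (t * k t) / rt \<zeta> t ^ 3" for t
  have "(LBINT t=0..\<infinity>. f t) = 0 - 0"
  proof (rule interval_integral_FTC_integrable)
    show "(F has_vector_derivative f t) (at t)" for t
    proof -
      have "((\<lambda>t. of_real (k t) :: complex) has_vector_derivative of_real (k' t)) (at t)"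
        using k[of t] by (rule has_vector_derivative_of_real[unfolded has_real_derivative_iff_has_vector_derivative[symmetric]])
      from has_vector_derivative_mult[OF this inverse_rt_has_vector_derivative[OF \<zeta>, of t]]
      show ?thesis unfolding F_def f_def by (simp add: algebra_simps)
    qed
    show "isCont f t" for t
      using continuous_on_diff[OF cont1 cont2] unfolding f_def by (simp add: continuous_on_eq_continuous_at)
    have "einterval 0 \<infinity> = {0<..}" by (auto simp: einterval_def)
    then show "set_integrable lborel (einterval 0 \<infinity>) f"
      unfolding f_def using i1 i2 by (auto intro: set_integral_diff)
    have "continuous_on UNIV F"
      unfolding F_def by (intro continuous_intros ck \<zeta>) (auto simp: nz)
    then have "isCont F 0" by (simp add: continuous_on_eq_continuous_at)
    then have "(F \<longlongrightarrow> 0) (at_right 0)"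
      by (simp add: continuous_at filterlim_at_split F_def k0)
    then show "((F \<circ> real_of_ereal) \<longlongrightarrow> 0) (at_right 0)"
      unfolding zero_ereal_def ereal_tendsto_simps .
    have "(F \<longlongrightarrow> 0) at_top"
    proof (rule Lim_null_comparison)
      show "eventually (\<lambda>t. norm (F t) \<le> C / (d * t)) at_top"
        using eventually_gt_at_top[of 0]
      proof eventually_elim
        case (elim t)
        have "t \<le> sqrt (1 + t\<^sup>2)" using elim by (simp add: real_le_rsqrt)
        then have "d * t \<le> cmod (rt \<zeta> t)"
          using d(2)[of t] mult_left_mono[of t "sqrt (1 + t\<^sup>2)" d] d(1) by linarith
        then have "\<bar>k t\<bar> / cmod (rt \<zeta> t) \<le> C / (d * t)"
          using b[of t] d(1) elim C by (intro frac_le) auto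
        then show ?case by (simp add: F_def norm_divide)
      qed
      show "((\<lambda>t. C / (d * t)) \<longlongrightarrow> 0) at_top"
        using d(1) by real_asymp
    qed
    then show "((F \<circ> real_of_ereal) \<longlongrightarrow> 0) (at_left \<infinity>)"
      unfolding ereal_tendsto_simps .
  qed auto
  then have "(LINT t:{0<..}|lborel. f t) = 0"
    by (simp add: interval_lebesgue_integral_0_infty)
  then show "(LINT t:{0<..}|lborel. of_real (k' t) / rt \<zeta> t) = (LINT t:{0<..}|lborel. of_real (t * k t) / rt \<zeta> t ^ 3)"
    unfolding f_def using set_integral_diff(2)[OF i1 i2] by simp
qed

section \<open>The Abel transform\<close>

lemma csqrt_scale:
  assumes "a > 0"
  shows "csqrt (of_real (a\<^sup>2) * w) = of_real a * csqrt w"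
proof (rule csqrt_unique)
  show "(of_real a * csqrt w)\<^sup>2 = of_real (a\<^sup>2) * w" by (simp add: power_mult_distrib)
  show "0 < Re (of_real a * csqrt w) \<or> Re (of_real a * csqrt w) = 0 \<and> 0 \<le> Im (of_real a * csqrt w)"
    using csqrt_principal[of w] assms by (auto simp: zero_less_mult_iff)
qed

text \<open>The root after the substitution \<open>r = t * s\<close> with
  \<open>s = sin \<phi>\<close>: it equals \<open>s * rt \<zeta> (r / s)\<close> for
  \<open>s > 0\<close> and stays meaningful at \<open>s = 0\<close>.\<close>

definition rt2 :: "complex \<Rightarrow> real \<Rightarrow> real \<Rightarrow> complex" where
  "rt2 \<zeta> r s = csqrt (of_real (r\<^sup>2) - of_real (s\<^sup>2) * \<zeta>)"

lemma rt2_arg_notin: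
  assumes "Im \<zeta> \<noteq> 0" "r > 0"
  shows "of_real (r\<^sup>2) - of_real (s\<^sup>2) * \<zeta> \<notin> \<real>\<^sub>\<le>\<^sub>0"
  using assms by (cases "s = 0") (auto simp: complex_nonpos_Reals_iff simp del: of_real_power)

lemma rt2_lower:
  assumes "Im \<zeta> \<noteq> 0"
  obtains c where "c > 0" "\<And>r s. c * sqrt (r\<^sup>2 + s\<^sup>2) \<le> cmod (rt2 \<zeta> r s)"
proof -
  obtain c where c: "c > 0" "\<And>\<tau> \<sigma>. \<tau> \<ge> 0 \<Longrightarrow> \<sigma> \<ge> 0 \<Longrightarrow> c * (\<tau> + \<sigma>) \<le> cmod (of_real \<tau> - of_real \<sigma> * \<zeta>)"
    using cmod_quadratic_lower[OF assms] by blast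
  have "sqrt c * sqrt (r\<^sup>2 + s\<^sup>2) \<le> cmod (rt2 \<zeta> r s)" for r s
    unfolding rt2_def norm_csqrt real_sqrt_mult[symmetric]
    using c(2)[of "r\<^sup>2" "s\<^sup>2"] by simp
  with c(1) show ?thesis by (intro that[of "sqrt c"]) auto
qed

text \<open>The inner integral that remains once the order of integration is exchanged; it turns the
  power -3/2 into the resolvent \<open>1 / (r^2 - \<zeta>)\<close>. The antiderivative
  \<open>\<Phi>\<close> is \<open>- cos \<phi>\<close> over
  \<open>(r^2 - \<zeta>) * rt2 \<zeta> r (sin \<phi>)\<close>, differentiated as a function of a
  complex variable.\<close>

lemma integral_sin_over_rt2_cubed:
  assumes \<zeta>: "Im \<zeta> \<noteq> 0" and r: "r > 0"
  shows "((\<lambda>\<phi>. of_real (sin \<phi>) / rt2 \<zeta> r (sin \<phi>) ^ 3) has_integral 1 / ((of_real (r\<^sup>2) - \<zeta>) * of_real r)) {0..pi/2}"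
proof -
  define W where "W z = of_real (r\<^sup>2) - (sin z)\<^sup>2 * \<zeta>" for z :: complex
  have W: "W (of_real \<phi>) = of_real (r\<^sup>2) - of_real ((sin \<phi>)\<^sup>2) * \<zeta>" for \<phi>
    by (simp add: W_def flip: sin_of_real)
  have Wn: "W (of_real \<phi>) \<notin> \<real>\<^sub>\<le>\<^sub>0" for \<phi>
    unfolding W by (rule rt2_arg_notin[OF \<zeta> r])
  have q: "of_real (r\<^sup>2) - \<zeta> \<noteq> 0" using rt_arg_notin[OF \<zeta>, of "r\<^sup>2"] by auto
  define \<Phi> where "\<Phi> z = - (cos z / csqrt (W z)) / (of_real (r\<^sup>2) - \<zeta>)" for z
  have csW: "csqrt (W (of_real \<phi>)) = rt2 \<zeta> r (sin \<phi>)" for \<phi>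
    by (simp add: rt2_def W)
  have "((\<lambda>\<phi>. of_real (sin \<phi>) / rt2 \<zeta> r (sin \<phi>) ^ 3) has_integral \<Phi> (of_real (pi/2)) - \<Phi> (of_real 0)) {0..pi/2}"
  proof (rule fundamental_theorem_of_calculus)
    fix \<phi> :: real
    let ?z = "of_real \<phi> :: complex"
    have nz: "csqrt (W ?z) \<noteq> 0" using Wn[of \<phi>] by auto
    have dW: "(W has_field_derivative - (2 * sin ?z * cos ?z) * \<zeta>) (at ?z)"
      unfolding W_def by (auto intro!: derivative_eq_intros)
    have dS: "((\<lambda>z. csqrt (W z)) has_field_derivative (- (2 * sin ?z * cos ?z) * \<zeta>) / (2 * csqrt (W ?z))) (at ?z)"
      by (rule has_field_derivative_csqrt'[OF dW Wn])
    have "(\<Phi> has_field_derivative - ((- sin ?z * csqrt (W ?z)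
        - cos ?z * ((- (2 * sin ?z * cos ?z) * \<zeta>) / (2 * csqrt (W ?z)))) / (csqrt (W ?z) * csqrt (W ?z)))
        / (of_real (r\<^sup>2) - \<zeta>)) (at ?z)"
      unfolding \<Phi>_def by (rule DERIV_cdivide DERIV_minus DERIV_divide DERIV_cos dS nz)+
    moreover have "- ((- sin ?z * csqrt (W ?z)
        - cos ?z * ((- (2 * sin ?z * cos ?z) * \<zeta>) / (2 * csqrt (W ?z)))) / (csqrt (W ?z) * csqrt (W ?z)))
        / (of_real (r\<^sup>2) - \<zeta>) = sin ?z / csqrt (W ?z) ^ 3"
    proof -
      define S where "S = csqrt (W ?z)"
      have S: "S \<noteq> 0" "S\<^sup>2 = of_real (r\<^sup>2) - (sin ?z)\<^sup>2 * \<zeta>" using nz by (simp_all add: S_def W_def)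
      have "S\<^sup>2 - (cos ?z)\<^sup>2 * \<zeta> = of_real (r\<^sup>2) - ((sin ?z)\<^sup>2 + (cos ?z)\<^sup>2) * \<zeta>"
        unfolding S(2) by (simp only: algebra_simps)
      also have "\<dots> = of_real (r\<^sup>2) - \<zeta>" by simp
      finally have *: "of_real (r\<^sup>2) - \<zeta> = S\<^sup>2 - (cos ?z)\<^sup>2 * \<zeta>" ..
      have "- ((- sin ?z * S - cos ?z * ((- (2 * sin ?z * cos ?z) * \<zeta>) / (2 * S))) / (S * S))
         = sin ?z * (S\<^sup>2 - (cos ?z)\<^sup>2 * \<zeta>) / S ^ 3"
        using S(1) by (simp add: field_simps power2_eq_square power3_eq_cube)
      then show ?thesis
        unfolding S_def[symmetric] * using q[unfolded *] by simp
    qed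
    ultimately have "(\<Phi> has_field_derivative sin ?z / csqrt (W ?z) ^ 3) (at ?z)"
      by simp
    from has_vector_derivative_real_field[OF this]
    have "((\<lambda>x. \<Phi> (of_real x)) has_vector_derivative sin ?z / csqrt (W ?z) ^ 3) (at \<phi> within {0..pi/2})" .
    then show "((\<lambda>x. \<Phi> (of_real x)) has_vector_derivative of_real (sin \<phi>) / rt2 \<zeta> r (sin \<phi>) ^ 3) (at \<phi> within {0..pi/2})"
      by (simp only: csW sin_of_real)
  qed simp
  moreover have "\<Phi> (of_real (pi/2)) = 0"
    unfolding \<Phi>_def cos_of_real by simp
  moreover have "\<Phi> (of_real 0) = - (1 / ((of_real (r\<^sup>2) - \<zeta>) * of_real r))"
  proof -
    have "csqrt (W (of_real 0)) = of_real r"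
      unfolding csW rt2_def using r by (simp add: csqrt_square)
    then show ?thesis unfolding \<Phi>_def by (simp add: mult.commute)
  qed
  ultimately show ?thesis by simp
qed

text \<open>Fubini, the substitution \<open>r = t * sin \<phi>\<close> in \<open>t\<close> for fixed
  \<open>\<phi>\<close>, and Fubini back. The first exchange rests on \<open>sin_cap_bound\<close>,
  the second on the homogeneous lower bound for \<open>rt2\<close>.\<close>

lemma abel_transform_integral:
  fixes N :: "real \<Rightarrow> real"
  assumes \<zeta>: "Im \<zeta> \<noteq> 0" and cN: "continuous_on UNIV N" and M: "\<And>r. \<bar>N r\<bar> \<le> M"
    and z: "\<And>r. r > R \<Longrightarrow> N r = 0" and R: "R > 0"
  shows "(LINT t:{0<..}|lborel. of_real (t * (t * integral {0..pi/2} (\<lambda>\<phi>. sin \<phi> * N (t * sin \<phi>)))) / rt \<zeta> t ^ 3)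
    = (LINT r:{0<..}|lborel. of_real (r * N r) / (of_real (r\<^sup>2) - \<zeta>))"
proof -
  let ?J = "{0..pi/2} :: real set"
  have nz: "rt \<zeta> t \<noteq> 0" for t by (rule rt_nonzero[OF \<zeta>])
  have M0: "M \<ge> 0" using M[of 0] by simp
  have sin0: "0 \<le> sin \<phi>" if "\<phi> \<in> ?J" for \<phi> using that by (intro sin_ge_zero) auto
  define G :: "real \<Rightarrow> real \<Rightarrow> complex" where
    "G t \<phi> = indicator {0<..} t *\<^sub>R indicator ?J \<phi> *\<^sub>R (of_real (t\<^sup>2 * (sin \<phi> * N (t * sin \<phi>))) / rt \<zeta> t ^ 3)" for t \<phi>
  have cNs: "continuous_on X (\<lambda>x. N (f x))" if "continuous_on X f" for X and f :: "'a::topological_space \<Rightarrow> real"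
    by (rule continuous_on_compose2[OF cN that]) auto
  have Gm: "(\<lambda>(t, \<phi>). G t \<phi>) \<in> borel_measurable (lborel \<Otimes>\<^sub>M lborel)"
  proof -
    have "continuous_on UNIV (\<lambda>p. of_real ((fst p)\<^sup>2 * (sin (snd p) * N (fst p * sin (snd p)))) / rt \<zeta> (fst p) ^ 3)"
      by (intro continuous_intros cNs \<zeta>) (auto simp: nz)
    from borel_measurable_continuous_onI[OF this]
    have [measurable]: "(\<lambda>p. of_real ((fst p)\<^sup>2 * (sin (snd p) * N (fst p * sin (snd p)))) / rt \<zeta> (fst p) ^ 3)
      \<in> borel_measurable (borel \<Otimes>\<^sub>M borel)"
      by (simp add: borel_prod)
    show ?thesis unfolding G_def split_beta' by measurable
  qed
  have inner_int: "integrable lborel (G t)" for t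
  proof -
    have "set_integrable lborel ?J (\<lambda>\<phi>. of_real (t\<^sup>2 * (sin \<phi> * N (t * sin \<phi>))) / rt \<zeta> t ^ 3)"
      by (intro borel_integrable_atLeastAtMost' continuous_intros cNs) (auto simp: nz)
    then show ?thesis unfolding G_def set_integrable_def by (rule integrable_scaleR_right)
  qed
  have set_int: "set_integrable lborel ?J f" "(\<integral>\<phi>. indicator ?J \<phi> *\<^sub>R f \<phi> \<partial>lborel) = integral ?J f"
    if "continuous_on ?J f" for f :: "real \<Rightarrow> 'a::euclidean_space"
    using set_borel_integral_eq_integral(2)[OF borel_integrable_atLeastAtMost'[OF that]] borel_integrable_atLeastAtMost'[OF that]
    by (simp_all add: set_lebesgue_integral_def)
  obtain d where d: "d > 0" "\<And>t. d * sqrt (1 + t\<^sup>2) \<le> cmod (rt \<zeta> t)"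
    using rt_lower[OF \<zeta>] by blast
  define K where "K = M * (1 + 4 * R\<^sup>2) / d ^ 3"
  have normG: "(\<integral>\<phi>. norm (G t \<phi>) \<partial>lborel) \<le> indicator {0<..} t * (K * (1 / (1 + t\<^sup>2)))" for t
  proof (cases "t > 0")
    case True
    have "(\<integral>\<phi>. norm (G t \<phi>) \<partial>lborel) = (\<integral>\<phi>. indicator ?J \<phi> *\<^sub>R (sin \<phi> * \<bar>N (t * sin \<phi>)\<bar>) * (t\<^sup>2 / cmod (rt \<zeta> t) ^ 3) \<partial>lborel)"
      using True by (intro Bochner_Integration.integral_cong)
        (auto simp: G_def norm_mult norm_divide norm_power abs_mult sin0 indicator_def)
    also have "\<dots> = integral ?J (\<lambda>\<phi>. sin \<phi> * \<bar>N (t * sin \<phi>)\<bar>) * (t\<^sup>2 / cmod (rt \<zeta> t) ^ 3)"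
      by (subst integral_mult_left_zero) (subst set_int; intro continuous_intros cNs refl)
    also have "\<dots> \<le> (M * (1 + 4 * R\<^sup>2) / (1 + t\<^sup>2)) * (t\<^sup>2 / cmod (rt \<zeta> t) ^ 3)"
    proof (intro mult_right_mono)
      have "\<bar>integral ?J (\<lambda>\<phi>. sin \<phi> * \<bar>N (t * sin \<phi>)\<bar>)\<bar> \<le> M * (1 + 4 * R\<^sup>2) / (1 + t\<^sup>2)"
        by (rule sin_cap_bound[OF _ _ _ R]) (use M z True in \<open>auto intro!: continuous_intros cNs\<close>)
      then show "integral ?J (\<lambda>\<phi>. sin \<phi> * \<bar>N (t * sin \<phi>)\<bar>) \<le> M * (1 + 4 * R\<^sup>2) / (1 + t\<^sup>2)" by linarith
    qed simp
    also have "\<dots> \<le> (M * (1 + 4 * R\<^sup>2) / (1 + t\<^sup>2)) * (1 / d ^ 3)"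
    proof (rule mult_left_mono)
      define s where "s = sqrt (1 + t\<^sup>2)"
      have s: "1 \<le> s" "s\<^sup>2 = 1 + t\<^sup>2" by (simp_all add: s_def)
      have "t\<^sup>2 \<le> s\<^sup>2 * 1" by (simp add: s)
      also have "\<dots> \<le> s\<^sup>2 * s" using s by (intro mult_left_mono) auto
      finally have "t\<^sup>2 \<le> s ^ 3" by (simp add: power2_eq_square power3_eq_cube)
      moreover have "(d * s) ^ 3 \<le> cmod (rt \<zeta> t) ^ 3"
        using d(2)[of t] d(1) s by (intro power_mono) (auto simp: s_def)
      moreover have "0 < (d * s) ^ 3" using d(1) s by simp
      ultimately have "t\<^sup>2 / cmod (rt \<zeta> t) ^ 3 \<le> s ^ 3 / (d * s) ^ 3"
        using s by (intro frac_le) auto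
      also have "\<dots> = 1 / d ^ 3" using s by (simp add: power_mult_distrib)
      finally show "t\<^sup>2 / cmod (rt \<zeta> t) ^ 3 \<le> 1 / d ^ 3" .
    qed (use M0 in simp)
    finally show ?thesis using True by (simp add: K_def mult_ac)
  qed (simp add: G_def)
  have domK: "integrable lborel (\<lambda>t. indicator {0<..} t * (K * (1 / (1 + t\<^sup>2))))"
  proof -
    have "set_integrable lborel {0<..} (\<lambda>t. K * (1 / (1 + t\<^sup>2)))"
      by (rule set_integrable_mult_right) (rule integrable_inverse_one_plus_sq)
    then show ?thesis unfolding set_integrable_def real_scaleR_def .
  qed
  have Gint: "integrable (lborel \<Otimes>\<^sub>M lborel) (\<lambda>(t, \<phi>). G t \<phi>)"
  proof (rule lborel_pair.Fubini_integrable[OF Gm])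
    show "integrable lborel (\<lambda>t. \<integral>\<phi>. norm ((\<lambda>(t, \<phi>). G t \<phi>) (t, \<phi>)) \<partial>lborel)"
    proof (rule Bochner_Integration.integrable_bound[OF domK])
      show "(\<lambda>t. \<integral>\<phi>. norm ((\<lambda>(t, \<phi>). G t \<phi>) (t, \<phi>)) \<partial>lborel) \<in> borel_measurable lborel"
        using Gm by measurable
      have "norm (\<integral>\<phi>. norm (G t \<phi>) \<partial>lborel) \<le> norm (indicator {0<..} t * (K * (1 / (1 + t\<^sup>2))))" for t
      proof -
        have 0: "0 \<le> (\<integral>\<phi>. norm (G t \<phi>) \<partial>lborel)" by (rule Bochner_Integration.integral_nonneg) simp
        show ?thesis
          unfolding real_norm_def abs_of_nonneg[OF 0] by (intro order_trans[OF normG abs_ge_self])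
      qed
      then show "AE t in lborel. norm (\<integral>\<phi>. norm ((\<lambda>(t, \<phi>). G t \<phi>) (t, \<phi>)) \<partial>lborel)
          \<le> norm (indicator {0<..} t * (K * (1 / (1 + t\<^sup>2))))" by simp
    qed
  qed (simp add: inner_int)
  define H :: "real \<Rightarrow> real \<Rightarrow> complex" where
    "H \<phi> r = indicator ?J \<phi> *\<^sub>R indicator {0<..} r *\<^sub>R (of_real (r\<^sup>2 * (sin \<phi> * N r)) / rt2 \<zeta> r (sin \<phi>) ^ 3)" for \<phi> r
  \<comment> \<open>For \<open>sin \<phi> = 0\<close> there is no substitution, but then both
    integrands vanish identically.\<close>
  have GH: "(\<integral>t. G t \<phi> \<partial>lborel) = (\<integral>r. H \<phi> r \<partial>lborel)" for \<phi>
  proof (cases "\<phi> \<in> ?J \<and> sin \<phi> \<noteq> 0")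
    case True
    then have s: "sin \<phi> > 0" using sin0[of \<phi>] by linarith
    define s where "s = sin \<phi>"
    have s: "s > 0" using s by (simp add: s_def)
    have "(\<integral>t. G t \<phi> \<partial>lborel) = \<bar>1 / s\<bar> *\<^sub>R (\<integral>r. G (0 + 1 / s * r) \<phi> \<partial>lborel)"
      using s by (intro lborel_integral_real_affine) simp
    also have "\<dots> = (\<integral>r. \<bar>1 / s\<bar> *\<^sub>R G (0 + 1 / s * r) \<phi> \<partial>lborel)"
      by simp
    also have "\<dots> = (\<integral>r. H \<phi> r \<partial>lborel)"
    proof (rule Bochner_Integration.integral_cong[OF refl])
      fix r
      show "\<bar>1 / s\<bar> *\<^sub>R G (0 + 1 / s * r) \<phi> = H \<phi> r"
      proof (cases "r > 0")
        case r: True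
        have "rt2 \<zeta> r s = csqrt (of_real (s\<^sup>2) * (of_real ((r / s)\<^sup>2) - \<zeta>))"
          using s by (simp add: rt2_def algebra_simps power_divide)
        also have "\<dots> = of_real s * rt \<zeta> (r / s)"
          unfolding rt_def by (rule csqrt_scale[OF s])
        finally have 1: "rt2 \<zeta> r s = of_real s * rt \<zeta> (r / s)" .
        have "\<bar>1 / s\<bar> *\<^sub>R G (0 + 1 / s * r) \<phi> = of_real (1 / s) * (of_real ((r / s)\<^sup>2 * (s * N r)) / rt \<zeta> (r / s) ^ 3)"
          using True r s by (simp add: G_def s_def[symmetric] scaleR_conv_of_real)
        also have "\<dots> = of_real (r\<^sup>2 * (s * N r)) / rt2 \<zeta> r s ^ 3"
          unfolding 1 using s nz[of "r / s"]
          by (simp add: field_simps power2_eq_square power3_eq_cube)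
        finally show ?thesis using True r by (simp add: H_def s_def)
      next
        case False
        then have "\<not> 0 < 1 / s * r" using s by (simp add: zero_less_divide_iff)
        with False show ?thesis by (simp add: G_def H_def)
      qed
    qed
    finally show ?thesis .
  next
    case False
    then show ?thesis by (auto simp: G_def[abs_def] H_def[abs_def])
  qed
  obtain e where e: "e > 0" "\<And>r s. e * sqrt (r\<^sup>2 + s\<^sup>2) \<le> cmod (rt2 \<zeta> r s)"
    using rt2_lower[OF \<zeta>] by blast
  have Hm: "(\<lambda>(\<phi>, r). H \<phi> r) \<in> borel_measurable (lborel \<Otimes>\<^sub>M lborel)"
  proof -
    let ?f = "\<lambda>p. of_real ((snd p)\<^sup>2 * (sin (fst p) * N (snd p))) / rt2 \<zeta> (snd p) (sin (fst p)) ^ 3"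
    have "continuous_on (UNIV \<times> {0<..}) ?f"
    proof -
      have "continuous_on (UNIV \<times> {0<..}) (\<lambda>p. rt2 \<zeta> (snd p) (sin (fst p)))"
        unfolding rt2_def
        by (rule continuous_on_compose2[of "- \<real>\<^sub>\<le>\<^sub>0" csqrt], rule continuous_on_csqrt)
          (use rt2_arg_notin[OF \<zeta>] in \<open>auto intro!: continuous_intros simp del: of_real_power\<close>)
      moreover have "rt2 \<zeta> (snd p) (sin (fst p)) \<noteq> 0" if "p \<in> UNIV \<times> {0<..}" for p :: "real \<times> real"
        using rt2_arg_notin[OF \<zeta>, of "snd p" "sin (fst p)"] that unfolding rt2_def by force
      ultimately show ?thesis by (intro continuous_intros cNs) auto
    qed
    then have "(\<lambda>p. indicator (UNIV \<times> {0<..}) p *\<^sub>R ?f p) \<in> borel_measurable borel"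
      by (intro borel_measurable_continuous_on_indicator) (auto intro!: open_Times borel_open)
    then have [measurable]: "(\<lambda>p. indicator (UNIV \<times> {0<..}) p *\<^sub>R ?f p) \<in> borel_measurable (borel \<Otimes>\<^sub>M borel)"
      by (simp add: borel_prod)
    have eq: "(\<lambda>(\<phi>, r). H \<phi> r) = (\<lambda>p. indicator ?J (fst p) *\<^sub>R (indicator (UNIV \<times> {0<..}) p *\<^sub>R ?f p))"
      by (auto simp: fun_eq_iff H_def indicator_def)
    show ?thesis unfolding eq by measurable
  qed
  have Hint: "integrable (lborel \<Otimes>\<^sub>M lborel) (\<lambda>(\<phi>, r). H \<phi> r)"
  proof (rule Bochner_Integration.integrable_bound[OF _ Hm])
    have "emeasure (lborel \<Otimes>\<^sub>M lborel) (?J \<times> {0..R}) < \<infinity>"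
      by (subst lborel.emeasure_pair_measure_Times) (use R in \<open>auto simp: ennreal_mult_less_top emeasure_lborel_Icc_eq\<close>)
    then show "integrable (lborel \<Otimes>\<^sub>M lborel) (\<lambda>p. indicator (?J \<times> {0..R}) p *\<^sub>R (M / e ^ 3))"
      by (intro integrable_scaleR_left integrable_real_indicator) auto
    \<comment> \<open>The numerator \<open>r^2 * s\<close> and the lower bound for the denominator
      are homogeneous of degree 3 in \<open>(r, s)\<close>, so the quotient stays bounded at the
      corner \<open>r = s = 0\<close>; the support of \<open>N\<close> confines \<open>r\<close> to
      \<open>{0..R}\<close>.\<close>
    have Hb: "norm (H \<phi> r) \<le> indicator (?J \<times> {0..R}) (\<phi>, r) *\<^sub>R (M / e ^ 3)" for \<phi> r
    proof (cases "\<phi> \<in> ?J \<and> 0 < r \<and> r \<le> R")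
      case True
      define s where "s = sin \<phi>"
      define w where "w = sqrt (r\<^sup>2 + s\<^sup>2)"
      have s: "s \<ge> 0" using sin0 True by (simp add: s_def)
      have w: "w > 0" "r \<le> w" "s \<le> w" using True s by (auto simp: w_def add_pos_nonneg intro: real_le_rsqrt)
      have "r\<^sup>2 * s \<le> w\<^sup>2 * w" using True s w by (intro mult_mono power_mono) auto
      then have rs: "r\<^sup>2 * s \<le> w ^ 3" by (simp add: power2_eq_square power3_eq_cube)
      have "norm (H \<phi> r) = r\<^sup>2 * s * \<bar>N r\<bar> / cmod (rt2 \<zeta> r s) ^ 3"
        using True s by (simp add: H_def norm_divide norm_mult norm_power abs_mult s_def[symmetric])
      also have "\<dots> \<le> w ^ 3 * M / (e * w) ^ 3"
        using e w s rs M[of r] M0 e(2)[of r s] True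
        by (intro frac_le mult_mono power_mono) (auto simp: w_def[symmetric])
      also have "\<dots> = M / e ^ 3" using w by (simp add: power_mult_distrib)
      finally show ?thesis using True by simp
    next
      case False
      then have "H \<phi> r = 0" using z[of r] by (auto simp: H_def indicator_def)
      then show ?thesis using M0 e by simp
    qed
    show "AE p in lborel \<Otimes>\<^sub>M lborel. norm (case p of (\<phi>, r) \<Rightarrow> H \<phi> r)
        \<le> norm (indicator (?J \<times> {0..R}) p *\<^sub>R (M / e ^ 3))"
    proof (rule AE_I2)
      fix p :: "real \<times> real"
      show "norm (case p of (\<phi>, r) \<Rightarrow> H \<phi> r) \<le> norm (indicator (?J \<times> {0..R}) p *\<^sub>R (M / e ^ 3))"
        using order_trans[OF Hb[of "fst p" "snd p"] abs_ge_self] by (simp only: split_beta real_norm_def prod.collapse)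
    qed
  qed
  have "(LINT t:{0<..}|lborel. of_real (t * (t * integral ?J (\<lambda>\<phi>. sin \<phi> * N (t * sin \<phi>)))) / rt \<zeta> t ^ 3)
     = (\<integral>t. (\<integral>\<phi>. G t \<phi> \<partial>lborel) \<partial>lborel)"
    unfolding set_lebesgue_integral_def
  proof (rule Bochner_Integration.integral_cong[OF refl])
    fix t
    have c: "continuous_on ?J (\<lambda>\<phi>. sin \<phi> * N (t * sin \<phi>))"
      by (intro continuous_intros cNs)
    have "(\<integral>\<phi>. G t \<phi> \<partial>lborel) = (\<integral>\<phi>. of_real (indicator ?J \<phi> *\<^sub>R (sin \<phi> * N (t * sin \<phi>))) *
        (indicator {0<..} t *\<^sub>R (of_real (t\<^sup>2) / rt \<zeta> t ^ 3)) \<partial>lborel)"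
      by (intro Bochner_Integration.integral_cong) (auto simp: G_def indicator_def)
    also have "\<dots> = of_real (integral ?J (\<lambda>\<phi>. sin \<phi> * N (t * sin \<phi>))) * (indicator {0<..} t *\<^sub>R (of_real (t\<^sup>2) / rt \<zeta> t ^ 3))"
      by (subst integral_mult_left_zero) (simp only: integral_complex_of_real set_int(2)[OF c])
    finally show "indicator {0<..} t *\<^sub>R (of_real (t * (t * integral ?J (\<lambda>\<phi>. sin \<phi> * N (t * sin \<phi>)))) / rt \<zeta> t ^ 3)
      = (\<integral>\<phi>. G t \<phi> \<partial>lborel)"
      by (simp add: power2_eq_square mult_ac)
  qed
  also have "\<dots> = (\<integral>\<phi>. (\<integral>t. G t \<phi> \<partial>lborel) \<partial>lborel)"
    by (rule lborel_pair.Fubini_integral[OF Gint, symmetric])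
  also have "\<dots> = (\<integral>\<phi>. (\<integral>r. H \<phi> r \<partial>lborel) \<partial>lborel)"
    by (simp only: GH)
  also have "\<dots> = (\<integral>r. (\<integral>\<phi>. H \<phi> r \<partial>lborel) \<partial>lborel)"
    by (rule lborel_pair.Fubini_integral[OF Hint, symmetric])
  also have "\<dots> = (LINT r:{0<..}|lborel. of_real (r * N r) / (of_real (r\<^sup>2) - \<zeta>))"
    unfolding set_lebesgue_integral_def
  proof (rule Bochner_Integration.integral_cong[OF refl])
    fix r
    show "(\<integral>\<phi>. H \<phi> r \<partial>lborel) = indicator {0<..} r *\<^sub>R (of_real (r * N r) / (of_real (r\<^sup>2) - \<zeta>))"
    proof (cases "r > 0")
      case True
      have c: "continuous_on ?J (\<lambda>\<phi>. of_real (sin \<phi>) / rt2 \<zeta> r (sin \<phi>) ^ 3)"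
      proof -
        have "continuous_on ?J (\<lambda>\<phi>. rt2 \<zeta> r (sin \<phi>))"
          unfolding rt2_def
          by (rule continuous_on_compose2[of "- \<real>\<^sub>\<le>\<^sub>0" csqrt], rule continuous_on_csqrt)
            (use rt2_arg_notin[OF \<zeta> True] in \<open>auto intro!: continuous_intros simp del: of_real_power\<close>)
        moreover have "rt2 \<zeta> r (sin \<phi>) \<noteq> 0" for \<phi>
          using rt2_arg_notin[OF \<zeta> True, of "sin \<phi>"] unfolding rt2_def by force
        ultimately show ?thesis by (intro continuous_intros) auto
      qed
      have "(\<integral>\<phi>. H \<phi> r \<partial>lborel) = (\<integral>\<phi>. (indicator ?J \<phi> *\<^sub>R (of_real (sin \<phi>) / rt2 \<zeta> r (sin \<phi>) ^ 3)) * of_real (r\<^sup>2 * N r) \<partial>lborel)"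
        using True by (intro Bochner_Integration.integral_cong) (auto simp: H_def indicator_def)
      also have "\<dots> = 1 / ((of_real (r\<^sup>2) - \<zeta>) * of_real r) * of_real (r\<^sup>2 * N r)"
        by (subst integral_mult_left_zero)
          (simp only: set_int(2)[OF c] integral_unique[OF integral_sin_over_rt2_cubed[OF \<zeta> True]])
      finally show ?thesis
        using True by (simp add: power2_eq_square)
    qed (simp add: H_def)
  qed
  finally show ?thesis .
qed

section \<open>Circular means and the passage to planar integrals\<close>

definition circ_mean :: "(real^2 \<Rightarrow> real) \<Rightarrow> real^2 \<Rightarrow> real \<Rightarrow> real" where
  "circ_mean g y r = integral {0..2*pi} (\<lambda>\<theta>. g (y + r *\<^sub>R dir \<theta>)) / (2 * pi)"

lemma circ_mean_continuous:
  assumes "continuous_on UNIV g"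
  shows "continuous_on UNIV (circ_mean g y)"
proof -
  have "continuous_on UNIV (\<lambda>r. integral (cbox 0 (2*pi)) (\<lambda>\<theta>. g (y + r *\<^sub>R dir \<theta>)))"
    by (rule integral_continuous_on_param, unfold split_beta')
      (intro continuous_intros continuous_on_comp_UNIV[OF assms])
  then show ?thesis
    unfolding circ_mean_def[abs_def] by (intro continuous_intros) auto
qed

lemma circ_mean_bound:
  assumes c: "continuous_on UNIV g" and M: "\<And>z. \<bar>g z\<bar> \<le> M"
  shows "\<bar>circ_mean g y r\<bar> \<le> M"
proof -
  have "M \<ge> 0" using M[of 0] by simp
  then have "norm (integral (cbox 0 (2*pi)) (\<lambda>\<theta>. g (y + r *\<^sub>R dir \<theta>))) \<le> M * measure lborel (cbox 0 (2*pi))"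
    by (intro integrable_bound) (auto intro!: integrable_continuous_interval continuous_intros continuous_on_comp_UNIV[OF c] M)
  then show ?thesis
    by (simp add: circ_mean_def abs_divide divide_le_eq)
qed

lemma circ_mean_zero:
  assumes z: "\<And>z. norm z > R0 \<Longrightarrow> g z = 0" and r: "r > R0 + norm y"
  shows "circ_mean g y r = 0"
proof -
  have "g (y + r *\<^sub>R dir \<theta>) = 0" for \<theta>
  proof (rule z)
    have "r \<le> norm (r *\<^sub>R dir \<theta>)" by simp
    also have "\<dots> \<le> norm (y + r *\<^sub>R dir \<theta>) + norm y"
      using norm_triangle_ineq4[of "y + r *\<^sub>R dir \<theta>" y] by simp
    finally show "R0 < norm (y + r *\<^sub>R dir \<theta>)" using r by linarith
  qed
  then show ?thesis by (simp add: circ_mean_def)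
qed

text \<open>Exhibits \<open>sph_mean\<close> as an Abel integral of circular means, the form in
  which \<open>abel_transform_integral\<close> applies.\<close>

lemma sph_mean_eq_circ_mean:
  assumes c: "continuous_on UNIV g"
  shows "sph_mean g y t = t * integral {0..pi/2} (\<lambda>\<phi>. sin \<phi> * circ_mean g y (t * sin \<phi>))"
proof -
  let ?f = "\<lambda>\<theta> \<phi>. sin \<phi> * (t * g (y + t *\<^sub>R sph \<theta> \<phi>))"
  have cf: "continuous_on sphbox (\<lambda>(\<theta>, \<phi>). ?f \<theta> \<phi>)"
    unfolding split_beta' by (intro continuous_intros continuous_on_comp_UNIV[OF c])
  have "integral sphbox (\<lambda>q. sin (snd q) * (t * g (y + t *\<^sub>R sph (fst q) (snd q))))
     = integral (cbox 0 (2 * pi)) (\<lambda>\<theta>. integral (cbox 0 (pi/2)) (?f \<theta>))"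
    using integral_prod_continuous[OF cf] by (simp add: split_beta')
  also have "\<dots> = integral (cbox 0 (pi/2)) (\<lambda>\<phi>. integral (cbox 0 (2*pi)) (\<lambda>\<theta>. ?f \<theta> \<phi>))"
    by (rule integral_swap_continuous[OF cf])
  also have "\<dots> = integral (cbox 0 (pi/2)) (\<lambda>\<phi>. (2 * pi * t) * (sin \<phi> * circ_mean g y (t * sin \<phi>)))"
    by (rule integral_cong) (simp add: circ_mean_def sph_def)
  also have "\<dots> = (2 * pi * t) * integral (cbox 0 (pi/2)) (\<lambda>\<phi>. sin \<phi> * circ_mean g y (t * sin \<phi>))"
    by (rule integral_mult_right)
  finally show ?thesis
    by (simp add: sph_mean_def)
qed

lemma integrable_compact_support:
  fixes h :: "real^2 \<Rightarrow> real"
  assumes c: "continuous_on UNIV h" and z: "\<And>z. norm z > R \<Longrightarrow> h z = 0"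
  shows "integrable lborel h"
proof -
  have "set_integrable lborel (cball 0 R) h"
    unfolding set_integrable_def
    by (rule borel_integrable_compact) (auto intro: continuous_on_subset[OF c])
  moreover have "(\<lambda>x. indicator (cball 0 R) x *\<^sub>R h x) = h"
    using z by (auto simp: fun_eq_iff indicator_def not_le)
  ultimately show ?thesis by (simp add: set_integrable_def)
qed

lemma circ_mean_polar:
  fixes g :: "real^2 \<Rightarrow> real" and w :: "real \<Rightarrow> real"
  assumes cg: "continuous_on UNIV g" and z: "\<And>z. norm z > R0 \<Longrightarrow> g z = 0" and cw: "continuous_on UNIV w"
  shows "(LINT r:{0<..}|lborel. r * circ_mean g y r * w r) = (\<integral>z. g z * w (norm (z - y)) \<partial>lborel) / (2 * pi)"
proof -
  define h where "h z = g z * w (norm (z - y))" for z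
  have ch: "continuous_on UNIV h"
    unfolding h_def by (intro continuous_intros cg continuous_on_compose2[OF cw]) auto
  have ih: "integrable lborel h"
    by (rule integrable_compact_support[OF ch, of R0]) (simp add: h_def z)
  have det: "det (mat 1 :: real^2^2) \<noteq> 0" by simp
  let ?P = "\<lambda>(r, \<theta>). indicator ({0<..} \<times> {0<..<2*pi}) (r, \<theta>) * (r * h (y + r *\<^sub>R (mat 1 *v dir \<theta>)))"
  have P: "integrable (lborel \<Otimes>\<^sub>M lborel) ?P" "integral\<^sup>L (lborel \<Otimes>\<^sub>M lborel) ?P = integral\<^sup>L lborel h"
    using polar_coordinates_lborel[OF ih det, of y] by simp_all
  have "integral\<^sup>L lborel h = (\<integral>r. (\<integral>\<theta>. ?P (r, \<theta>) \<partial>lborel) \<partial>lborel)"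
    unfolding P(2)[symmetric] by (rule lborel_pair.integral_fst'[OF P(1), symmetric])
  also have "\<dots> = (\<integral>r. indicator {0<..} r *\<^sub>R (2 * pi * (r * circ_mean g y r * w r)) \<partial>lborel)"
  proof (rule Bochner_Integration.integral_cong[OF refl])
    fix r
    have c: "continuous_on {0..2*pi} (\<lambda>\<theta>. g (y + r *\<^sub>R dir \<theta>))"
      by (intro continuous_intros continuous_on_comp_UNIV[OF cg])
    have "(\<integral>\<theta>. ?P (r, \<theta>) \<partial>lborel)
        = (\<integral>\<theta>. indicator {0..2*pi} \<theta> *\<^sub>R g (y + r *\<^sub>R dir \<theta>) * (indicator {0<..} r * (r * w r)) \<partial>lborel)"
    proof (rule integral_cong_AE)
      have "continuous_on UNIV (\<lambda>\<theta>. h (y + r *\<^sub>R dir \<theta>))" "continuous_on UNIV (\<lambda>\<theta>. g (y + r *\<^sub>R dir \<theta>))"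
        by (intro continuous_intros continuous_on_comp_UNIV[OF ch] continuous_on_comp_UNIV[OF cg])+
      from this[THEN borel_measurable_continuous_onI]
      have [measurable]: "(\<lambda>\<theta>. h (y + r *\<^sub>R dir \<theta>)) \<in> borel_measurable borel"
        "(\<lambda>\<theta>. g (y + r *\<^sub>R dir \<theta>)) \<in> borel_measurable borel" .
      show "(\<lambda>\<theta>. ?P (r, \<theta>)) \<in> borel_measurable lborel"
        by (simp add: indicator_times)
      show "(\<lambda>\<theta>. indicator {0..2*pi} \<theta> *\<^sub>R g (y + r *\<^sub>R dir \<theta>) * (indicator {0<..} r * (r * w r))) \<in> borel_measurable lborel"
        by simp
      have "AE \<theta> in lborel. \<theta> \<noteq> 0 \<and> \<theta> \<noteq> 2 * pi"
        by (intro AE_conjI AE_lborel_singleton)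
      then show "AE \<theta> in lborel. ?P (r, \<theta>) = indicator {0..2*pi} \<theta> *\<^sub>R g (y + r *\<^sub>R dir \<theta>) * (indicator {0<..} r * (r * w r))"
        by eventually_elim (auto simp: indicator_def h_def)
    qed
    also have "\<dots> = integral {0..2*pi} (\<lambda>\<theta>. g (y + r *\<^sub>R dir \<theta>)) * (indicator {0<..} r * (r * w r))"
      using set_borel_integral_eq_integral(2)[OF borel_integrable_atLeastAtMost'[OF c]]
      by (subst integral_mult_left_zero) (simp add: set_lebesgue_integral_def)
    also have "\<dots> = indicator {0<..} r *\<^sub>R (2 * pi * (r * circ_mean g y r * w r))"
      by (simp add: circ_mean_def)
    finally show "(\<integral>\<theta>. ?P (r, \<theta>) \<partial>lborel) = indicator {0<..} r *\<^sub>R (2 * pi * (r * circ_mean g y r * w r))" .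
  qed
  also have "\<dots> = 2 * pi * (LINT r:{0<..}|lborel. r * circ_mean g y r * w r)"
    unfolding set_lebesgue_integral_def by (subst Bochner_Integration.integral_mult_right_zero[symmetric]) (simp add: mult_ac)
  finally have "(\<integral>z. g z * w (norm (z - y)) \<partial>lborel) = 2 * pi * (LINT r:{0<..}|lborel. r * circ_mean g y r * w r)"
    by (simp only: h_def[abs_def])
  then show ?thesis by simp
qed

text \<open>The prefactor \<open>t\<close> is absorbed by the decay \<open>1 / (1 + t^2)\<close> of
  the cap estimate.\<close>

lemma sph_mean_bound:
  assumes c: "continuous_on UNIV g" and z: "\<And>z. norm z > R0 \<Longrightarrow> g z = 0"
  obtains C where "C \<ge> 0" "\<And>y t. norm y \<le> R1 \<Longrightarrow> t \<ge> 0 \<Longrightarrow> \<bar>sph_mean g y t\<bar> \<le> C"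
proof -
  obtain M where M: "M \<ge> 0" "\<And>z. \<bar>g z\<bar> \<le> M"
    using compact_support_bounded[OF c, of R0] z by metis
  define R where "R = max 1 (R0 + R1)"
  have R: "R > 0" "R0 + R1 \<le> R" by (auto simp: R_def)
  show ?thesis
  proof (rule that[of "M * (1 + 4 * R\<^sup>2)"])
    show "0 \<le> M * (1 + 4 * R\<^sup>2)" using M by (intro mult_nonneg_nonneg) auto
    fix y :: "real^2" and t :: real assume y: "norm y \<le> R1" and t: "t \<ge> 0"
    have "\<bar>integral {0..pi/2} (\<lambda>\<phi>. sin \<phi> * circ_mean g y (t * sin \<phi>))\<bar> \<le> M * (1 + 4 * R\<^sup>2) / (1 + t\<^sup>2)"
    proof (rule sin_cap_bound[OF _ _ _ R(1) t])
      show "continuous_on {0..pi/2} (\<lambda>\<phi>. circ_mean g y (t * sin \<phi>))"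
        by (rule continuous_on_compose2[OF circ_mean_continuous[OF c]]) (auto intro!: continuous_intros)
      show "\<bar>circ_mean g y (t * sin \<phi>)\<bar> \<le> M" for \<phi>
        by (rule circ_mean_bound[OF c M(2)])
      show "circ_mean g y (t * sin \<phi>) = 0" if "R < t * sin \<phi>" for \<phi>
        by (rule circ_mean_zero[OF z]) (use that R y in auto)
    qed
    then have "\<bar>sph_mean g y t\<bar> \<le> t * (M * (1 + 4 * R\<^sup>2) / (1 + t\<^sup>2))"
      unfolding sph_mean_eq_circ_mean[OF c] abs_mult abs_of_nonneg[OF t] using t by (rule mult_left_mono)
    also have "\<dots> = (M * (1 + 4 * R\<^sup>2)) * (t / (1 + t\<^sup>2))" by simp
    also have "\<dots> \<le> (M * (1 + 4 * R\<^sup>2)) * 1"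
    proof (rule mult_left_mono)
      have "0 \<le> (1 - t)\<^sup>2" by simp
      then have "t \<le> 1 + t\<^sup>2" using t by (simp add: power2_diff)
      then show "t / (1 + t\<^sup>2) \<le> 1" by (simp add: divide_le_eq add_pos_nonneg)
    qed (use M in simp)
    finally show "\<bar>sph_mean g y t\<bar> \<le> M * (1 + 4 * R\<^sup>2)" by simp
  qed
qed

text \<open>On the right the square root is gone. Once \<open>\<zeta>\<close> is tied to
  \<open>y\<close>, the kernel is the real part of a rational expression in \<open>y\<close>, which
  makes the later integral over the boundary computable.\<close>

theorem weighted_time_integral:
  fixes \<zeta> :: complex
  assumes \<zeta>: "Im \<zeta> \<noteq> 0" and g: "has_partials2 g g1 g2" and c: "continuous_on UNIV g1" "continuous_on UNIV g2"
    and z: "\<And>z. norm z > R0 \<Longrightarrow> g z = 0 \<and> g1 z = 0 \<and> g2 z = 0"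
  shows "set_integrable lborel {0<..} (\<lambda>t. of_real (sph_mean' g g1 g2 y t) / rt \<zeta> t)"
    and "Re (LINT t:{0<..}|lborel. of_real (sph_mean' g g1 g2 y t) / rt \<zeta> t)
       = (\<integral>z. g z * Re (1 / (of_real ((norm (z - y))\<^sup>2) - \<zeta>)) \<partial>lborel) / (2 * pi)"
proof -
  have cg: "continuous_on UNIV g" by (rule has_partials2_continuous[OF g])
  obtain C1 where C1: "C1 \<ge> 0" "\<And>t. t \<ge> 0 \<Longrightarrow> \<bar>sph_mean' g g1 g2 y t\<bar> \<le> C1 / (1 + t\<^sup>2)"
    using sph_mean'_decay[OF cg c, of R0 "norm y"] z by (metis order_refl)
  obtain C2 where C2: "C2 \<ge> 0" "\<And>t. t \<ge> 0 \<Longrightarrow> \<bar>sph_mean g y t\<bar> \<le> C2"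
    using sph_mean_bound[OF cg, of R0 "norm y"] z by (metis order_refl)
  define C where "C = max C1 C2"
  have b1: "\<bar>sph_mean' g g1 g2 y t\<bar> \<le> C / (1 + t\<^sup>2)" if "t \<ge> 0" for t
    using C1(2)[OF that] by (rule order_trans) (auto simp: C_def intro!: divide_right_mono add_nonneg_nonneg)
  have b2: "\<bar>sph_mean g y t\<bar> \<le> C" if "t \<ge> 0" for t
    using C2(2)[OF that] by (simp add: C_def)
  have ck: "continuous_on UNIV (sph_mean' g g1 g2 y)"
  proof -
    have "continuous_on UNIV (\<lambda>t. (y, t :: real))" by (intro continuous_intros)
    from continuous_on_comp_UNIV[OF sph_mean'_continuous[OF cg c] this] show ?thesis by simp
  qed
  have k0: "sph_mean g y 0 = 0" by (simp add: sph_mean_def)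
  note bp = integral_by_parts_rt[OF \<zeta> sph_mean_has_derivative[OF g c] k0 ck b1 b2]
  show "set_integrable lborel {0<..} (\<lambda>t. of_real (sph_mean' g g1 g2 y t) / rt \<zeta> t)"
    by (rule bp(1))
  obtain M where M: "M \<ge> 0" "\<And>z. \<bar>g z\<bar> \<le> M"
    using compact_support_bounded[OF cg, of R0] z by metis
  let ?N = "circ_mean g y"
  have cN: "continuous_on UNIV ?N" by (rule circ_mean_continuous[OF cg])
  have nz: "complex_of_real x \<noteq> \<zeta>" for x using \<zeta> by auto
  have 1: "(LINT t:{0<..}|lborel. of_real (sph_mean' g g1 g2 y t) / rt \<zeta> t)
      = (LINT t:{0<..}|lborel. of_real (t * sph_mean g y t) / rt \<zeta> t ^ 3)"
    by (rule bp(2))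
  have 2: "(LINT t:{0<..}|lborel. of_real (t * sph_mean g y t) / rt \<zeta> t ^ 3)
      = (LINT r:{0<..}|lborel. of_real (r * ?N r) / (of_real (r\<^sup>2) - \<zeta>))"
    unfolding sph_mean_eq_circ_mean[OF cg]
  proof (rule abel_transform_integral[OF \<zeta> cN])
    show "\<bar>?N r\<bar> \<le> M" for r by (rule circ_mean_bound[OF cg M(2)])
    show "?N r = 0" if "r > max 1 (R0 + norm y)" for r
      by (rule circ_mean_zero[of R0]) (use z that in auto)
  qed simp
  note 1
  also note 2
  also have "Re \<dots> = (LINT r:{0<..}|lborel. Re (of_real (r * ?N r) / (of_real (r\<^sup>2) - \<zeta>)))"
  proof -
    let ?f = "\<lambda>r. of_real (r * ?N r) / (of_real (r\<^sup>2) - \<zeta>) :: complex"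
    define R where "R = max 1 (R0 + norm y)"
    have "set_integrable lborel {0..R} ?f"
      by (intro borel_integrable_atLeastAtMost' continuous_intros continuous_on_subset[OF cN]) (auto simp: nz simp del: of_real_power)
    then have "set_integrable lborel {0<..R} ?f"
      by (rule set_integrable_subset) auto
    moreover have "(\<lambda>r. indicator {0<..R} r *\<^sub>R ?f r) = (\<lambda>r. indicator {0<..} r *\<^sub>R ?f r)"
      using circ_mean_zero[of R0 g y] z by (auto simp: fun_eq_iff indicator_def R_def)
    ultimately have "integrable lborel (\<lambda>r. indicator {0<..} r *\<^sub>R ?f r)"
      by (simp add: set_integrable_def)
    then show ?thesis
      unfolding set_lebesgue_integral_def by (subst integral_Re[symmetric]) auto
  qed
  also have "\<dots> = (LINT r:{0<..}|lborel. r * ?N r * Re (1 / (of_real (r\<^sup>2) - \<zeta>)))"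
    by (simp add: Re_divide divide_inverse algebra_simps)
  also have "\<dots> = (\<integral>z. g z * Re (1 / (of_real ((norm (z - y))\<^sup>2) - \<zeta>)) \<partial>lborel) / (2 * pi)"
  proof (rule circ_mean_polar[OF cg, where w = "\<lambda>r. Re (1 / (of_real (r\<^sup>2) - \<zeta>))"])
    show "continuous_on UNIV (\<lambda>r. Re (1 / (of_real (r\<^sup>2) - \<zeta>)))"
      by (intro continuous_intros) (auto simp: nz simp del: of_real_power)
  qed (use z in auto)
  finally show "Re (LINT t:{0<..}|lborel. of_real (sph_mean' g g1 g2 y t) / rt \<zeta> t)
       = (\<integral>z. g z * Re (1 / (of_real ((norm (z - y))\<^sup>2) - \<zeta>)) \<partial>lborel) / (2 * pi)" .
qed

section \<open>The boundary kernel\<close>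

text \<open>The denominator is \<open>(1 - q * cis t) * (1 - q * cis (- t))\<close>, so the integral
  is Cauchy's formula at the point \<open>q\<close> for the function \<open>1 / (1 - q * z)\<close>
  on the unit circle.\<close>

lemma poisson_kernel_integral:
  fixes q :: complex
  assumes q: "cmod q < 1"
  shows "((\<lambda>t. 1 / (1 + q\<^sup>2 - 2 * q * of_real (cos t))) has_integral 2 * of_real pi / (1 - q\<^sup>2)) {0..2*pi}"
proof -
  have nz: "q * z \<noteq> 1" if "cmod z \<le> 1" for z
  proof
    assume "q * z = 1"
    then have "cmod (q * z) = 1" by simp
    moreover have "cmod (q * z) \<le> cmod q * 1"
      unfolding norm_mult by (rule mult_left_mono[OF that]) simp
    ultimately show False using q by simp
  qed
  have "(\<lambda>z. 1 / (1 - q * z)) holomorphic_on cball 0 1"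
    by (intro holomorphic_intros) (auto simp: nz)
  from Cauchy_integral_circlepath_simple[OF this, of q] q
  have "((\<lambda>u. 1 / (1 - q * u) / (u - q)) has_contour_integral 2 * of_real pi * \<i> * (1 / (1 - q * q))) (circlepath 0 1)"
    by simp
  then have "((\<lambda>t. 1 / (1 - q * cis t) / (cis t - q) * \<i> * cis t) has_integral 2 * of_real pi * \<i> * (1 / (1 - q * q))) {0..2*pi}"
    unfolding circlepath_def by (subst (asm) has_contour_integral_part_circlepath_iff) auto
  then have "((\<lambda>t. (1 / (1 - q * cis t) / (cis t - q) * \<i> * cis t) * (- \<i>)) has_integral 2 * of_real pi * \<i> * (1 / (1 - q * q)) * (- \<i>)) {0..2*pi}"
    by (rule has_integral_mult_left)
  moreover have eq1: "(1 / (1 - q * cis t) / (cis t - q) * \<i> * cis t) * (- \<i>) = 1 / (1 + q\<^sup>2 - 2 * q * of_real (cos t))" for t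
  proof -
    have c: "cis t * cis (- t) = 1" by (simp add: cis_mult)
    have "cis t * (1 - q * cis (- t)) = cis t - q * (cis t * cis (- t))"
      by (simp only: algebra_simps mult_1_left)
    then have 1: "cis t - q = cis t * (1 - q * cis (- t))"
      unfolding c by simp
    have 2: "(1 - q * cis t) * (1 - q * cis (- t)) = 1 + q\<^sup>2 - 2 * q * of_real (cos t)"
    proof -
      have "cis t + cis (- t) = 2 * of_real (cos t)" by (simp add: complex_eq_iff)
      moreover have "(1 - q * cis t) * (1 - q * cis (- t)) = 1 + q\<^sup>2 * (cis t * cis (- t)) - q * (cis t + cis (- t))"
        by (simp add: algebra_simps power2_eq_square)
      ultimately show ?thesis using c by simp
    qed
    have "(1 / X / (w * Y) * \<i> * w) * (- \<i>) = 1 / (X * Y)" if "w \<noteq> 0" for X Y w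
      using that by (auto simp: divide_simps)
    from this[of "cis t"] show ?thesis
      unfolding 1 2[symmetric] by simp
  qed
  moreover have eq2: "2 * of_real pi * \<i> * (1 / (1 - q * q)) * (- \<i>) = 2 * of_real pi / (1 - q\<^sup>2)"
    by (simp add: mult_ac power2_eq_square)
  ultimately show ?thesis
    by (simp only: eq1 eq2)
qed

text \<open>A root \<open>q\<close> of \<open>B * (1 + q^2) = 2 * Z * q\<close> brings the
  denominator into the form of \<open>poisson_kernel_integral\<close>. The two roots have product 1,
  and neither lies on the unit circle, where \<open>Z\<close> would be \<open>B * Re q\<close> and
  hence real; so one of them lies inside.\<close>

lemma cos_resolvent_integral_sq:
  fixes Z :: complex and B :: real
  assumes Z: "Im Z \<noteq> 0" and B: "B > 0"
  shows "(integral {0..2*pi} (\<lambda>t. 1 / (Z - of_real (B * cos t))))\<^sup>2 = 4 * of_real (pi\<^sup>2) / (Z\<^sup>2 - of_real (B\<^sup>2))"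
proof -
  define b where "b = complex_of_real B"
  have b: "b \<noteq> 0" using B by (simp add: b_def)
  obtain q where q: "cmod q < 1" "q \<noteq> 0" "b * (1 + q\<^sup>2) = 2 * Z * q"
  proof -
    define s where "s = csqrt ((Z / b)\<^sup>2 - 1)"
    have s: "s\<^sup>2 = (Z / b)\<^sup>2 - 1" by (simp add: s_def)
    have prod: "(Z / b - s) * (Z / b + s) = 1" using s by (simp add: algebra_simps power2_eq_square)
    have quad: "b * (1 + p\<^sup>2) = 2 * Z * p" if "p = Z / b - s \<or> p = Z / b + s" for p
    proof -
      have "(p - Z / b)\<^sup>2 = s\<^sup>2" using that by auto
      then have "1 + p\<^sup>2 = 2 * (Z / b) * p" unfolding s by (simp add: power2_diff algebra_simps)
      then show ?thesis using b by simp
    qed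
    have ne1: "cmod p \<noteq> 1" if "p = Z / b - s \<or> p = Z / b + s" for p
    proof
      assume "cmod p = 1"
      then have pc: "p * cnj p = 1" using complex_norm_square[of p] by simp
      have "b * (1 + p\<^sup>2) * cnj p = 2 * Z * p * cnj p" using quad[OF that] by simp
      then have "b * (cnj p + p * (p * cnj p)) = 2 * Z * (p * cnj p)"
        by (simp add: algebra_simps power2_eq_square)
      then have "b * (cnj p + p) = 2 * Z" by (simp add: pc)
      then have "Im (b * (cnj p + p)) = Im (2 * Z)" by (rule arg_cong)
      then show False using Z by (simp add: b_def)
    qed
    have nz: "Z / b - s \<noteq> 0" "Z / b + s \<noteq> 0" using prod by auto
    have "cmod (Z / b - s) * cmod (Z / b + s) = 1" using prod by (metis norm_mult norm_one)
    then have "cmod (Z / b - s) < 1 \<or> cmod (Z / b + s) < 1"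
      using ne1 by (metis linorder_neqE_linordered_idom mult_less_le_imp_less less_imp_le zero_le_one
          less_1_mult less_irrefl)
    then show ?thesis using that quad nz by blast
  qed
  have eq: "1 / (Z - of_real (B * cos t)) = 2 * q / b * (1 / (1 + q\<^sup>2 - 2 * q * of_real (cos t)))" for t
  proof -
    have "b * (1 + q\<^sup>2 - 2 * q * of_real (cos t)) = 2 * q * (Z - of_real (B * cos t))"
      using q(3) by (simp add: b_def algebra_simps)
    moreover have "Z - of_real (B * cos t) \<noteq> 0" using Z by (auto simp: complex_eq_iff)
    ultimately have "1 + q\<^sup>2 - 2 * q * of_real (cos t) = 2 * q * (Z - of_real (B * cos t)) / b"
      using b by (metis nonzero_mult_div_cancel_left)
    then show ?thesis using b q(2) by simp
  qed
  have "integral {0..2*pi} (\<lambda>t. 1 / (Z - of_real (B * cos t))) = 2 * q / b * (2 * of_real pi / (1 - q\<^sup>2))"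
    unfolding eq by (rule integral_unique, rule has_integral_mult_right, rule poisson_kernel_integral[OF q(1)])
  moreover have "(2 * q / b * (2 * of_real pi / (1 - q\<^sup>2)))\<^sup>2 = 4 * of_real (pi\<^sup>2) / (Z\<^sup>2 - of_real (B\<^sup>2))"
  proof -
    have Zq: "Z = b * (1 + q\<^sup>2) / (2 * q)" using q by (simp add: field_simps)
    have "Z\<^sup>2 - of_real (B\<^sup>2) = b\<^sup>2 * (1 - q\<^sup>2)\<^sup>2 / (4 * q\<^sup>2)"
    proof -
      have "Z\<^sup>2 - of_real (B\<^sup>2) = b\<^sup>2 * ((1 + q\<^sup>2)\<^sup>2 - (2 * q)\<^sup>2) / (2 * q)\<^sup>2"
        unfolding Zq using q(2) by (simp add: b_def power_divide power_mult_distrib right_diff_distrib diff_divide_distrib)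
      also have "(1 + q\<^sup>2)\<^sup>2 - (2 * q)\<^sup>2 = (1 - q\<^sup>2)\<^sup>2" by (simp add: power2_eq_square algebra_simps)
      finally show ?thesis by (simp add: power_mult_distrib)
    qed
    then show ?thesis by (simp add: power_mult_distrib power_divide mult_ac)
  qed
  ultimately show ?thesis by simp
qed

text \<open>Real part of \<open>X = Z \<integral> 1/(Z - B cos)\<close>: it is controlled through \<open>X\<^sup>2\<close> only, so no branch of the
  square root has to be chosen.\<close>

lemma Re_sq_eq: "(Re X)\<^sup>2 = (cmod (X\<^sup>2) + Re (X\<^sup>2)) / 2"
  by (simp add: norm_power cmod_power2) (simp add: power2_eq_square)

text \<open>The integral around the ellipse takes this form, with \<open>B = 2 * r\<close>; the
  factor \<open>cos t\<close> is the share of the ray direction in the normal.\<close>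

definition cos_kernel :: "real \<Rightarrow> real \<Rightarrow> real \<Rightarrow> real" where
  "cos_kernel A B e = integral {0..2*pi} (\<lambda>t. cos t * Re (1 / (of_real (A - B * cos t) - \<i> * of_real e)))"

text \<open>Integrates \<open>B * cos t / (Z - B * cos t) = Z / (Z - B * cos t) - 1\<close>. The
  constant \<open>- 2 * pi\<close> is the part that survives the limit.\<close>

lemma cos_kernel_eq:
  fixes A B e :: real
  assumes B: "B > 0" and e: "e \<noteq> 0"
  defines "Z \<equiv> of_real A - \<i> * of_real e"
  shows "B * cos_kernel A B e = Re (Z * integral {0..2*pi} (\<lambda>t. 1 / (Z - of_real (B * cos t)))) - 2 * pi"
proof -
  have Z: "Im Z \<noteq> 0" using e by (simp add: Z_def)
  have nz: "Z \<noteq> of_real B * of_real (cos t)" for t using Z by (auto simp: complex_eq_iff)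
  have rm: "Re (of_real x * w) = x * Re w" for x w by simp
  have i: "(\<lambda>t. 1 / (Z - of_real (B * cos t))) integrable_on {0..2*pi}"
    by (intro integrable_continuous_interval continuous_intros) (auto simp: nz)
  let ?J = "integral {0..2*pi} (\<lambda>t. 1 / (Z - of_real (B * cos t)))"
  have "((\<lambda>t. Z * (1 / (Z - of_real (B * cos t))) - 1) has_integral Z * ?J - of_real (2 * pi)) {0..2*pi}"
    using has_integral_diff[OF has_integral_mult_right[OF integrable_integral[OF i]] has_integral_const_real[of "1::complex" 0 "2*pi"]]
    by (simp add: scaleR_conv_of_real)
  from has_integral_linear[OF this bounded_linear_Re]
  have "((\<lambda>t. Re (Z * (1 / (Z - of_real (B * cos t))) - 1)) has_integral Re (Z * ?J) - 2 * pi) {0..2*pi}"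
    by (simp add: o_def)
  moreover have "Re (Z * (1 / (Z - of_real (B * cos t))) - 1) = B * (cos t * Re (1 / (of_real (A - B * cos t) - \<i> * of_real e)))" for t
  proof -
    have "Z * (1 / (Z - of_real (B * cos t))) - 1 = of_real (B * cos t) * (1 / (Z - of_real (B * cos t)))"
      using nz[of t] by (simp add: field_simps)
    moreover have "Z - of_real (B * cos t) = of_real (A - B * cos t) - \<i> * of_real e"
      by (simp add: Z_def)
    ultimately have "Z * (1 / (Z - of_real (B * cos t))) - 1 = of_real (B * cos t) * (1 / (of_real (A - B * cos t) - \<i> * of_real e))"
      by simp
    then show ?thesis by (simp only: rm mult.assoc)
  qed
  ultimately have "((\<lambda>t. B * (cos t * Re (1 / (of_real (A - B * cos t) - \<i> * of_real e)))) has_integral Re (Z * ?J) - 2 * pi) {0..2*pi}"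
    by simp
  then show ?thesis
    unfolding cos_kernel_def by (subst integral_mult_right[symmetric]) (rule integral_unique)
qed

text \<open>Uniform in \<open>e\<close>: the real part \<open>A\<close> of \<open>Z\<close> keeps
  the distance \<open>(1 - \<kappa>) * B\<close> from \<open>B\<close> and from \<open>- B\<close>,
  so \<open>(cmod Z)^2\<close> is at most \<open>c^2 * cmod (Z^2 - B^2)\<close> with
  \<open>c = 1 + 1 / (1 - \<kappa>)\<close>. The stated constant is
  \<open>2 * pi * c + 2 * pi\<close>.\<close>

lemma cos_kernel_bound:
  assumes \<kappa>: "0 \<le> \<kappa>" "\<kappa> < 1" and B: "B > 0" and A: "\<bar>A\<bar> \<le> \<kappa> * B" and e: "e \<noteq> 0"
  shows "\<bar>B * cos_kernel A B e\<bar> \<le> 2 * pi * (2 + 1 / (1 - \<kappa>))"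
proof -
  define Z where "Z = of_real A - \<i> * of_real e"
  define J where "J = integral {0..2*pi} (\<lambda>t. 1 / (Z - of_real (B * cos t)))"
  have Z: "Im Z \<noteq> 0" using e by (simp add: Z_def)
  have low: "cmod Z \<le> (1 + 1 / (1 - \<kappa>)) * cmod (Z + of_real s)" if s: "\<bar>s\<bar> = B" for s
  proof -
    have "(1 - \<kappa>) * B \<le> \<bar>A + s\<bar>" using s A by (simp add: algebra_simps)
    also have "\<dots> \<le> cmod (Z + of_real s)"
      using abs_Re_le_cmod[of "Z + of_real s"] by (simp add: Z_def)
    finally have "B \<le> cmod (Z + of_real s) / (1 - \<kappa>)" using \<kappa> by (simp add: field_simps)
    moreover have "cmod Z \<le> cmod (Z + of_real s) + B"
      using norm_triangle_ineq4[of "Z + of_real s" "of_real s"] s by simp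
    ultimately show ?thesis by (simp add: algebra_simps)
  qed
  define c where "c = 1 + 1 / (1 - \<kappa>)"
  have c: "c > 0" using \<kappa> by (simp add: c_def add_pos_pos)
  have "cmod Z * cmod Z \<le> (c * cmod (Z + of_real B)) * (c * cmod (Z + of_real (- B)))"
    using low[of B] low[of "- B"] B c by (intro mult_mono) (auto simp: c_def)
  also have "\<dots> = c\<^sup>2 * cmod ((Z + of_real B) * (Z + of_real (- B)))"
    by (simp add: norm_mult power2_eq_square mult_ac)
  also have "(Z + of_real B) * (Z + of_real (- B)) = Z\<^sup>2 - of_real (B\<^sup>2)"
    by (simp add: algebra_simps power2_eq_square)
  finally have *: "(cmod Z)\<^sup>2 \<le> c\<^sup>2 * cmod (Z\<^sup>2 - of_real (B\<^sup>2))" by (simp add: power2_eq_square)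
  have "cmod Z > 0" using Z by auto
  then have pos: "cmod (Z\<^sup>2 - of_real (B\<^sup>2)) > 0"
    using * c by (metis mult_zero_right norm_ge_zero not_le order_le_less zero_less_power)
  have "(cmod (Z * J))\<^sup>2 = cmod (Z\<^sup>2 * J\<^sup>2)" by (simp add: norm_mult norm_power power_mult_distrib)
  also have "\<dots> = (cmod Z)\<^sup>2 * (4 * pi\<^sup>2 / cmod (Z\<^sup>2 - of_real (B\<^sup>2)))"
    unfolding J_def cos_resolvent_integral_sq[OF Z B] by (simp add: norm_mult norm_divide norm_power)
  also have "\<dots> \<le> (c\<^sup>2 * cmod (Z\<^sup>2 - of_real (B\<^sup>2))) * (4 * pi\<^sup>2 / cmod (Z\<^sup>2 - of_real (B\<^sup>2)))"
    by (rule mult_right_mono[OF *]) simp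
  also have "\<dots> = (2 * pi * c)\<^sup>2" using pos by (simp add: power_mult_distrib)
  finally have "cmod (Z * J) \<le> 2 * pi * c" using c by (simp add: power2_le_iff_abs_le)
  then have "\<bar>Re (Z * J)\<bar> \<le> 2 * pi * c" using abs_Re_le_cmod[of "Z * J"] by linarith
  moreover have "B * cos_kernel A B e = Re (Z * J) - 2 * pi"
    using cos_kernel_eq[OF B e, of A] by (simp add: Z_def J_def)
  ultimately have "\<bar>B * cos_kernel A B e\<bar> \<le> 2 * pi * c + 2 * pi" using pi_gt_zero by arith
  then show ?thesis by (simp add: c_def algebra_simps)
qed

text \<open>Since \<open>\<bar>A\<bar> < B\<close>, the square \<open>(Z * J)^2\<close> tends to the
  nonpositive number \<open>L\<close>. By \<open>Re_sq_eq\<close> the real part of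
  \<open>Z * J\<close> tends to 0, and only \<open>- 2 * pi\<close> is left, whatever
  \<open>A\<close> is.\<close>

lemma cos_kernel_tendsto:
  assumes B: "B > 0" and A: "\<bar>A\<bar> < B" and e: "(e \<longlongrightarrow> 0) F" and ne: "\<And>n. e n \<noteq> 0"
  shows "((\<lambda>n. B * cos_kernel A B (e n)) \<longlongrightarrow> - 2 * pi) F"
proof -
  define Z where "Z n = of_real A - \<i> * of_real (e n)" for n
  define J where "J n = integral {0..2*pi} (\<lambda>t. 1 / (Z n - of_real (B * cos t)))" for n
  define L where "L = 4 * pi\<^sup>2 * A\<^sup>2 / (A\<^sup>2 - B\<^sup>2)"
  have AB: "A\<^sup>2 < B\<^sup>2" using power_strict_mono[OF A, of 2] by simp
  have Zlim: "(Z \<longlongrightarrow> of_real A) F"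
    unfolding Z_def using tendsto_diff[OF tendsto_const tendsto_mult[OF tendsto_const tendsto_of_real[OF e]], of "of_real A" \<i>] by simp
  have X2: "(Z n * J n)\<^sup>2 = 4 * of_real (pi\<^sup>2) * (Z n)\<^sup>2 / ((Z n)\<^sup>2 - of_real (B\<^sup>2))" for n
    unfolding power_mult_distrib J_def
    by (subst cos_resolvent_integral_sq[OF _ B]) (use ne[of n] in \<open>auto simp: Z_def\<close>)
  have ne0: "(complex_of_real A)\<^sup>2 - of_real (B\<^sup>2) \<noteq> 0"
    using AB by (metis less_irrefl of_real_eq_iff of_real_power right_minus_eq)
  have "((\<lambda>n. (Z n * J n)\<^sup>2) \<longlongrightarrow> 4 * of_real (pi\<^sup>2) * (of_real A)\<^sup>2 / ((of_real A)\<^sup>2 - of_real (B\<^sup>2))) F"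
    unfolding X2 by (intro tendsto_intros Zlim ne0)
  also have "4 * of_real (pi\<^sup>2) * (of_real A)\<^sup>2 / ((of_real A)\<^sup>2 - of_real (B\<^sup>2)) = complex_of_real L"
    by (simp add: L_def)
  finally have lim: "((\<lambda>n. (Z n * J n)\<^sup>2) \<longlongrightarrow> of_real L) F" .
  have L: "L \<le> 0" unfolding L_def using AB by (intro divide_nonneg_neg) auto
  have "((\<lambda>n. (cmod ((Z n * J n)\<^sup>2) + Re ((Z n * J n)\<^sup>2)) / 2) \<longlongrightarrow> (cmod (of_real L) + Re (of_real L)) / 2) F"
    by (intro tendsto_intros lim) auto
  then have "((\<lambda>n. (Re (Z n * J n))\<^sup>2) \<longlongrightarrow> 0) F"
    unfolding Re_sq_eq[symmetric] using L by simp
  then have "((\<lambda>n. Re (Z n * J n)) \<longlongrightarrow> 0) F"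
    using tendsto_real_sqrt[of "\<lambda>n. (Re (Z n * J n))\<^sup>2" 0 F] by (simp add: tendsto_rabs_zero_iff)
  then have "((\<lambda>n. Re (Z n * J n) - 2 * pi) \<longlongrightarrow> 0 - 2 * pi) F"
    by (intro tendsto_intros)
  moreover have "B * cos_kernel A B (e n) = Re (Z n * J n) - 2 * pi" for n
    using cos_kernel_eq[OF B ne, of A n] by (simp add: Z_def J_def)
  ultimately show ?thesis by simp
qed

section \<open>Ellipses and their arc length\<close>

definition dir' :: "real \<Rightarrow> real^2" where
  "dir' \<theta> = vector [- sin \<theta>, cos \<theta>]"

lemma dir'_nth [simp]: "dir' \<theta> $ 1 = - sin \<theta>" "dir' \<theta> $ 2 = cos \<theta>"
  by (simp_all add: dir'_def)

text \<open>Tangent vectors are transported by \<open>A\<close>, normal vectors by its inverse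
  transpose, here written with cofactors.\<close>

definition inv_transpose2 :: "real^2^2 \<Rightarrow> real^2^2" where
  "inv_transpose2 A = (1 / det A) *\<^sub>R vector [vector [A$2$2, - (A$2$1)], vector [- (A$1$2), A$1$1]]"

lemma inv_transpose2_nth [simp]:
  "inv_transpose2 A $ 1 $ 1 = A$2$2 / det A" "inv_transpose2 A $ 1 $ 2 = - (A$2$1) / det A"
  "inv_transpose2 A $ 2 $ 1 = - (A$1$2) / det A" "inv_transpose2 A $ 2 $ 2 = A$1$1 / det A"
  by (simp_all only: inv_transpose2_def vector_scaleR_component vector_2 real_scaleR_def) simp_all

lemma inner_inv_transpose2:
  assumes "det A \<noteq> 0"
  shows "(A *v u) \<bullet> (inv_transpose2 A *v v) = u \<bullet> v"
proof -
  have *: "x * (a / d * v1 + - b / d * v2) + w * (- e / d * v1 + k / d * v2)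
      = (x * (a * v1 - b * v2) + w * (k * v2 - e * v1)) / d" for x w a b e k d v1 v2 :: real
    by (simp add: add_divide_distrib diff_divide_distrib right_diff_distrib distrib_left)
  have "(A$1$1 * u$1 + A$1$2 * u$2) * (A$2$2 * v$1 - A$2$1 * v$2)
      + (A$2$1 * u$1 + A$2$2 * u$2) * (A$1$1 * v$2 - A$1$2 * v$1) = det A * (u \<bullet> v)"
    by (simp add: det_2 inner_vec2 algebra_simps)
  then show ?thesis
    using assms unfolding inner_vec2[of "A *v u"] matvec2_nth inv_transpose2_nth * by simp
qed

lemma det_inv_transpose2:
  assumes "det A \<noteq> 0"
  shows "det (inv_transpose2 A) = 1 / det A"
proof -
  have "det (inv_transpose2 A) = (A$1$1 * A$2$2 - A$1$2 * A$2$1) / (det A * det A)"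
    unfolding det_2[of "inv_transpose2 A"] inv_transpose2_nth by (simp add: diff_divide_distrib mult_ac)
  then show ?thesis using assms unfolding det_2[of A, symmetric] by simp
qed

lemma orthogonal_vec2_eq:
  fixes n v T :: "real^2"
  assumes "n \<bullet> T = 0" "v \<bullet> T = 0" "T \<noteq> 0" "norm n = 1" "norm v = 1"
  shows "n = v \<or> n = - v"
proof -
  define k where "k = n$1 * v$2 - n$2 * v$1"
  have e: "n$1 * T$1 + n$2 * T$2 = 0" "v$1 * T$1 + v$2 * T$2 = 0"
    using assms(1,2) by (simp_all add: inner_vec2)
  have "k * T$1 = 0" "k * T$2 = 0" unfolding k_def using e by algebra+
  then have k: "k = 0" using assms(3) by (auto simp: vec2_eq_iff)
  have u: "(n$1)\<^sup>2 + (n$2)\<^sup>2 = 1" "(v$1)\<^sup>2 + (v$2)\<^sup>2 = 1"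
    using norm_vec2_sq[of n] norm_vec2_sq[of v] assms(4,5) by simp_all
  have "(n \<bullet> v)\<^sup>2 = 1"
    using u k unfolding k_def inner_vec2 by algebra
  then have "n \<bullet> v = 1 \<or> n \<bullet> v = - 1" by (simp add: power2_eq_1_iff)
  moreover have "n = v" if "n \<bullet> v = 1"
  proof -
    have "(n - v) \<bullet> (n - v) = 0"
      using that assms(4,5) by (simp add: inner_diff_left inner_diff_right inner_commute norm_eq_1)
    then show ?thesis by simp
  qed
  moreover have "n = - v" if "n \<bullet> v = - 1"
  proof -
    have "(n + v) \<bullet> (n + v) = 0"
      using that assms(4,5) by (simp add: inner_add_left inner_add_right inner_commute norm_eq_1)
    then show ?thesis by (simp add: add_eq_0_iff2)
  qed
  ultimately show ?thesis by blast
qed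

text \<open>\<open>det A\<close> times the inverse transpose is the cofactor matrix, in the plane
  \<open>A\<close> conjugated by a quarter turn, and \<open>dir'\<close> is \<open>dir\<close> after
  a quarter turn. As a consequence the arc length factor cancels the normalization of the
  normal.\<close>

lemma norm_tangent:
  assumes "det A \<noteq> 0"
  shows "norm (A *v dir' \<theta>) = \<bar>det A\<bar> * norm (inv_transpose2 A *v dir \<theta>)"
proof -
  have "(norm (A *v dir' \<theta>))\<^sup>2 = (\<bar>det A\<bar> * norm (inv_transpose2 A *v dir \<theta>))\<^sup>2"
    unfolding power_mult_distrib norm_vec2_sq matvec2_nth inv_transpose2_nth dir'_nth dir_nth
    using assms by (simp add: field_simps power2_eq_square)
  then show ?thesis by (rule power2_eq_imp_eq) auto
qed

lemma norm_matvec_pos: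
  fixes A :: "real^2^2"
  assumes "det A \<noteq> 0" "v \<noteq> 0"
  shows "norm (A *v v) > 0"
  using inner_inv_transpose2[OF assms(1), of v v] assms(2) by auto

text \<open>Discs and ellipses are treated alike, as affine images of the unit disc.\<close>

locale ellipse_param =
  fixes c :: "real^2" and A :: "real^2^2"
  assumes det: "det A \<noteq> 0"
begin

abbreviation "S \<equiv> inv_transpose2 A"
definition "B = transpose S"
definition "y \<theta> = c + A *v dir \<theta>"
definition "E = (\<lambda>\<xi>. c + A *v \<xi>) ` ball 0 1"

lemma B_A: "B *v (A *v v) = v"
proof (rule vector_eq_ldot[THEN iffD1], rule allI)
  fix u
  have "u \<bullet> (B *v (A *v v)) = (S *v u) \<bullet> (A *v v)"
    unfolding B_def dot_lmul_matrix[symmetric] vector_transpose_matrix ..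
  also have "\<dots> = u \<bullet> v" using inner_inv_transpose2[OF det, of v u] by (simp add: inner_commute)
  finally show "u \<bullet> (B *v (A *v v)) = u \<bullet> v" .
qed

lemma A_B: "A *v (B *v v) = v"
proof -
  have "B ** A = mat 1" using B_A by (simp add: matrix_eq matrix_vector_mul_assoc)
  then have "A ** B = mat 1" using matrix_left_right_inverse by blast
  then show ?thesis by (simp add: matrix_vector_mul_assoc)
qed

lemma image_ball_iff: "z \<in> (\<lambda>\<xi>. c + A *v \<xi>) ` X \<longleftrightarrow> B *v (z - c) \<in> X"
proof
  assume "B *v (z - c) \<in> X"
  then show "z \<in> (\<lambda>\<xi>. c + A *v \<xi>) ` X"
    by (intro image_eqI[of _ _ "B *v (z - c)"]) (simp_all add: A_B)
qed (auto simp: B_A)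

lemma bij_A: "bij ((*v) A)"
  by (rule bijI') (metis B_A, metis A_B)

lemma image_closure: "(\<lambda>\<xi>. c + A *v \<xi>) ` closure X = closure ((\<lambda>\<xi>. c + A *v \<xi>) ` X)"
proof -
  have "closure ((*v) A ` X) = (*v) A ` closure X"
    using closure_injective_linear_image[OF matrix_vector_mul_linear bij_is_inj[OF bij_A]] by simp
  then show ?thesis
    using closure_translation[of c "(*v) A ` X"] by (simp add: image_image)
qed

lemma E_open: "open E"
proof -
  have "open ((*v) A ` ball 0 1)"
    by (rule open_bijective_linear_image_eq[THEN iffD2, OF matrix_vector_mul_linear bij_A]) simp
  from open_translation[OF this, of c] show ?thesis by (simp add: E_def image_image)
qed

lemma closure_E: "closure E = (\<lambda>\<xi>. c + A *v \<xi>) ` cball 0 1"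
  unfolding E_def image_closure[symmetric] by simp

lemma frontier_E_iff: "z \<in> frontier E \<longleftrightarrow> norm (B *v (z - c)) = 1"
  unfolding frontier_def closure_E interior_open[OF E_open] unfolding E_def
  by (auto simp: image_ball_iff)

lemma unit_vector_dir:
  fixes v :: "real^2"
  assumes "norm v = 1"
  obtains \<theta> where "0 \<le> \<theta>" "\<theta> < 2 * pi" "v = dir \<theta>"
proof -
  have "(v$1)\<^sup>2 + (v$2)\<^sup>2 = 1" using assms norm_vec2_sq[of v] by simp
  then obtain t where "0 \<le> t" "t < 2 * pi" "v$1 = cos t" "v$2 = sin t"
    using sincos_total_2pi by blast
  then show ?thesis by (intro that[of t]) (auto simp: vec2_eq_iff)
qed

lemma frontier_E: "frontier E = y ` {0..2*pi}"
proof -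
  have "z \<in> y ` {0..2*pi}" if "z \<in> frontier E" for z
  proof -
    from that have "norm (B *v (z - c)) = 1" by (simp only: frontier_E_iff)
    then obtain \<theta> where \<theta>: "0 \<le> \<theta>" "\<theta> < 2 * pi" "B *v (z - c) = dir \<theta>"
      by (rule unit_vector_dir)
    have "z = c + A *v (B *v (z - c))" unfolding A_B by simp
    then have "z = y \<theta>" unfolding y_def \<theta>(3) .
    with \<theta>(1,2) show ?thesis by (intro image_eqI[of _ _ \<theta>]) auto
  qed
  moreover have "y \<theta> \<in> frontier E" for \<theta>
    by (simp add: frontier_E_iff y_def B_A)
  ultimately show ?thesis by auto
qed

lemma y_in_frontier: "y \<theta> \<in> frontier E"
  by (simp add: frontier_E_iff y_def B_A)

lemma y_has_vector_derivative: "(y has_vector_derivative A *v dir' \<theta>) (at \<theta> within X)"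
proof -
  have "(y has_derivative (\<lambda>h. 0 + A *v (h *\<^sub>R dir' \<theta>))) (at \<theta> within X)"
    unfolding y_def[abs_def] dir'_def
    by (intro has_derivative_add has_derivative_const bounded_linear.has_derivative[OF matrix_vector_mul_bounded_linear]
        has_derivative_dir has_derivative_ident)
  then show ?thesis by (simp add: has_vector_derivative_def matrix_vector_mult_scaleR)
qed

lemma y_continuous: "continuous_on X y"
  by (rule continuous_on_vector_derivative) (rule y_has_vector_derivative)

text \<open>For unit vectors \<open>u\<close> and \<open>d\<close> one has
  \<open>(u - d) \<bullet> d = - (norm (u - d))^2 / 2\<close>. The normal component of a chord is
  thus quadratic in its length, which gives the tangency condition for the normal.\<close>

lemma inner_normal_frontier:
  assumes "z \<in> frontier E"
  shows "(S *v dir \<theta>) \<bullet> (z - y \<theta>) = - (norm (B *v (z - y \<theta>)))\<^sup>2 / 2"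
proof -
  define u where "u = B *v (z - c)"
  have u: "norm u = 1" "z = c + A *v u" using assms by (simp_all add: u_def frontier_E_iff A_B)
  have zy: "z - y \<theta> = A *v (u - dir \<theta>)"
    by (simp add: u(2) y_def matrix_vector_mult_diff_distrib)
  have "(S *v dir \<theta>) \<bullet> (z - y \<theta>) = (u - dir \<theta>) \<bullet> dir \<theta>"
    unfolding zy using inner_inv_transpose2[OF det, of "u - dir \<theta>" "dir \<theta>"] by (simp add: inner_commute)
  moreover have "(norm (u - dir \<theta>))\<^sup>2 = 2 - 2 * (u \<bullet> dir \<theta>)"
    using u(1) norm_dir[of \<theta>] unfolding power2_norm_eq_inner norm_eq_1
    by (simp add: inner_diff_left inner_diff_right inner_commute)
  moreover have "dir \<theta> \<bullet> dir \<theta> = 1" using norm_dir[of \<theta>] unfolding norm_eq_1 .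
  ultimately show ?thesis
    unfolding zy B_A by (simp add: inner_diff_left)
qed

lemma normal_tangent: "(S *v dir \<theta>) \<bullet> (A *v dir' \<theta>) = 0"
  using inner_inv_transpose2[OF det, of "dir' \<theta>" "dir \<theta>"] by (simp add: inner_commute inner_vec2)

definition "\<nu> \<theta> = S *v dir \<theta> /\<^sub>R norm (S *v dir \<theta>)"

lemma norm_S_pos: "norm (S *v dir \<theta>) > 0"
proof (rule norm_matvec_pos)
  show "det S \<noteq> 0" using det by (simp add: det_inv_transpose2)
  show "dir \<theta> \<noteq> 0" using norm_dir[of \<theta>] by (metis norm_zero zero_neq_one)
qed

lemma tangent_pos: "norm (A *v dir' \<theta>) > 0"
  unfolding norm_tangent[OF det] using det norm_S_pos by simp

lemma is_outward_unit_normal_\<nu>: "is_outward_unit_normal E (y \<theta>) (\<nu> \<theta>)"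
  unfolding is_outward_unit_normal_def
proof (intro conjI)
  let ?n = "norm (S *v dir \<theta>)"
  have S0: "S *v dir \<theta> \<noteq> 0" using norm_S_pos[of \<theta>] by (metis norm_zero less_irrefl)
  show "norm (\<nu> \<theta>) = 1" by (simp add: \<nu>_def S0)
  obtain K where K: "\<And>v. norm (B *v v) \<le> norm v * K"
    using bounded_linear.bounded[OF matrix_vector_mul_bounded_linear[of B]] by blast
  show "((\<lambda>z. \<nu> \<theta> \<bullet> (z - y \<theta>) / norm (z - y \<theta>)) \<longlongrightarrow> 0) (at (y \<theta>) within frontier E)"
  proof (rule Lim_null_comparison)
    show "\<forall>\<^sub>F z in at (y \<theta>) within frontier E. norm (\<nu> \<theta> \<bullet> (z - y \<theta>) / norm (z - y \<theta>)) \<le> K\<^sup>2 / (2 * ?n) * norm (z - y \<theta>)"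
      unfolding eventually_at_filter
    proof (intro always_eventually allI impI)
      fix z assume z: "z \<noteq> y \<theta>" "z \<in> frontier E"
      define m where "m = norm (z - y \<theta>)"
      have m: "m > 0" using z by (simp add: m_def)
      have "(norm (B *v (z - y \<theta>)))\<^sup>2 \<le> (m * K)\<^sup>2"
        using K[of "z - y \<theta>"] by (intro power_mono) (auto simp: m_def)
      then have "(norm (B *v (z - y \<theta>)))\<^sup>2 / 2 / ?n / m \<le> (m * K)\<^sup>2 / 2 / ?n / m"
        using m norm_S_pos[of \<theta>] by (intro divide_right_mono) auto
      moreover have "norm (\<nu> \<theta> \<bullet> (z - y \<theta>) / norm (z - y \<theta>)) = (norm (B *v (z - y \<theta>)))\<^sup>2 / 2 / ?n / m"
      proof -
        have gen: "\<bar>inverse k * (- p / 2) / l\<bar> = p / 2 / k / l" if "p \<ge> 0" "k > 0" "l > 0" for p k l :: real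
        proof -
          have "inverse k * (- p / 2) / l = - (p / 2 / k / l)" using that by (simp add: field_simps)
          moreover have "0 \<le> p / 2 / k / l" using that by simp
          ultimately show ?thesis by (simp only: abs_minus_cancel abs_of_nonneg)
        qed
        show ?thesis
          unfolding m_def[symmetric] real_norm_def \<nu>_def inner_scaleR_left inner_normal_frontier[OF z(2)]
          by (rule gen[OF zero_le_power2 norm_S_pos m])
      qed
      moreover have "(m * K)\<^sup>2 / 2 / ?n / m = K\<^sup>2 / (2 * ?n) * m"
        using m by (simp add: power2_eq_square S0)
      ultimately show "norm (\<nu> \<theta> \<bullet> (z - y \<theta>) / norm (z - y \<theta>)) \<le> K\<^sup>2 / (2 * ?n) * norm (z - y \<theta>)"
        unfolding m_def[symmetric] by linarith
    qed
    show "((\<lambda>z. K\<^sup>2 / (2 * ?n) * norm (z - y \<theta>)) \<longlongrightarrow> 0) (at (y \<theta>) within frontier E)"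
      by (rule tendsto_mult_right_zero, rule tendsto_norm_zero, rule LIM_zero, rule tendsto_ident_at)
  qed
  \<comment> \<open>\<open>v\<close> is the normal pulled back to the unit disc. Its positive inner
    product with \<open>dir \<theta>\<close> makes the norm grow outwards and shrink inwards for
    small \<open>s\<close>.\<close>
  define v where "v = B *v \<nu> \<theta>"
  have Av: "A *v v = \<nu> \<theta>" by (simp add: v_def A_B)
  have v: "dir \<theta> \<bullet> v > 0"
  proof -
    have "v \<bullet> dir \<theta> = \<nu> \<theta> \<bullet> (S *v dir \<theta>)"
      using inner_inv_transpose2[OF det, of v "dir \<theta>"] by (simp add: Av)
    also have "\<dots> = ?n" by (simp add: \<nu>_def dot_square_norm power2_eq_square S0)
    finally show ?thesis using norm_S_pos[of \<theta>] by (simp add: inner_commute)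
  qed
  have nsq: "(norm (dir \<theta> + s *\<^sub>R v))\<^sup>2 = 1 + s * (2 * (dir \<theta> \<bullet> v) + s * (v \<bullet> v))" for s
    using norm_dir[of \<theta>] unfolding power2_norm_eq_inner norm_eq_1
    by (simp add: inner_add_left inner_add_right inner_commute algebra_simps)
  have "((\<lambda>s. 2 * (dir \<theta> \<bullet> v) - s * (v \<bullet> v)) \<longlongrightarrow> 2 * (dir \<theta> \<bullet> v) - 0 * (v \<bullet> v)) (at_right 0)"
    by (intro tendsto_intros)
  then have "\<forall>\<^sub>F s in at_right 0. 0 < 2 * (dir \<theta> \<bullet> v) - s * (v \<bullet> v)"
    by (rule order_tendstoD(1)) (use v in simp)
  then show "\<forall>\<^sub>F s in at_right 0. y \<theta> - s *\<^sub>R \<nu> \<theta> \<in> E \<and> y \<theta> + s *\<^sub>R \<nu> \<theta> \<notin> closure E"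
    using eventually_at_right_less[of 0]
  proof eventually_elim
    case (elim s)
    have eq: "B *v (y \<theta> + s *\<^sub>R \<nu> \<theta> - c) = dir \<theta> + s *\<^sub>R v" for s
      by (simp add: y_def matrix_vector_right_distrib matrix_vector_mult_scaleR B_A v_def)
    have "(norm (dir \<theta> + (- s) *\<^sub>R v))\<^sup>2 < 1" unfolding nsq using elim by (simp add: zero_less_mult_iff algebra_simps)
    then have 1: "norm (dir \<theta> + (- s) *\<^sub>R v) < 1" by (simp add: power_less_one_iff)
    have "0 \<le> s * (v \<bullet> v)" using elim by simp
    then have "1 < (norm (dir \<theta> + s *\<^sub>R v))\<^sup>2" unfolding nsq using elim v by (simp add: add_pos_nonneg)
    then have 2: "1 < norm (dir \<theta> + s *\<^sub>R v)" by (intro power_less_imp_less_base[where n = 2 and a = 1]) simp_all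
    have "y \<theta> + (- s) *\<^sub>R \<nu> \<theta> \<in> E"
      unfolding E_def image_ball_iff eq using 1 by simp
    moreover have "y \<theta> + s *\<^sub>R \<nu> \<theta> \<notin> closure E"
      unfolding closure_E image_ball_iff eq using 2 by simp
    ultimately show ?case by simp
  qed
qed

text \<open>Approaching \<open>y \<theta>\<close> along the curve makes any candidate
  \<open>n\<close> orthogonal to the tangent, which leaves \<open>\<nu> \<theta>\<close> and its
  negative; the latter has inside and outside exchanged.\<close>

lemma outward_unit_normal_E: "outward_unit_normal E (y \<theta>) = \<nu> \<theta>"
  unfolding outward_unit_normal_def
proof (rule the_equality)
  show "is_outward_unit_normal E (y \<theta>) (\<nu> \<theta>)" by (rule is_outward_unit_normal_\<nu>)
  fix n assume n: "is_outward_unit_normal E (y \<theta>) n"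
  let ?T = "A *v dir' \<theta>"
  have lim: "((\<lambda>z. n \<bullet> (z - y \<theta>) / norm (z - y \<theta>)) \<longlongrightarrow> 0) (at (y \<theta>) within frontier E)"
    using n by (simp add: is_outward_unit_normal_def)
  have yd: "((\<lambda>h. (y (\<theta> + h) - y \<theta>) /\<^sub>R h) \<longlongrightarrow> ?T) (at_right 0)"
  proof -
    have "((\<lambda>h. (y (\<theta> + h) - y \<theta>) /\<^sub>R h) \<longlongrightarrow> ?T) (at 0)"
    proof (rule vec_tendstoI)
      fix i
      have "((\<lambda>\<theta>. y \<theta> $ i) has_real_derivative ?T $ i) (at \<theta>)"
        using bounded_linear.has_vector_derivative[OF bounded_linear_vec_nth y_has_vector_derivative]
        unfolding has_real_derivative_iff_has_vector_derivative .
      then show "((\<lambda>h. ((y (\<theta> + h) - y \<theta>) /\<^sub>R h) $ i) \<longlongrightarrow> ?T $ i) (at 0)"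
        unfolding DERIV_def vector_scaleR_component vector_minus_component divide_inverse_commute real_scaleR_def .
    qed
    then show ?thesis by (rule tendsto_mono[OF at_le, rotated]) simp
  qed
  have ev0: "\<forall>\<^sub>F h in at_right 0. (y (\<theta> + h) - y \<theta>) /\<^sub>R h \<noteq> 0"
    using tendsto_imp_eventually_ne[OF yd, of 0] tangent_pos[of \<theta>] by auto
  have "filterlim (\<lambda>h. y (\<theta> + h)) (at (y \<theta>) within frontier E) (at_right 0)"
  proof (rule filterlim_at_withinI)
    have "isCont y \<theta>" using y_continuous[of UNIV] by (simp add: continuous_on_eq_continuous_at)
    then have "((\<lambda>h. y (\<theta> + h)) \<longlongrightarrow> y \<theta>) (at 0)" by (simp add: isCont_iff)
    then show "((\<lambda>h. y (\<theta> + h)) \<longlongrightarrow> y \<theta>) (at_right 0)" by (rule tendsto_mono[OF at_le, rotated]) simp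
    show "\<forall>\<^sub>F h in at_right 0. y (\<theta> + h) \<in> frontier E - {y \<theta>}"
      using ev0 by eventually_elim (auto simp: y_in_frontier)
  qed
  from filterlim_compose[OF lim this]
  have l1: "((\<lambda>h. n \<bullet> (y (\<theta> + h) - y \<theta>) / norm (y (\<theta> + h) - y \<theta>)) \<longlongrightarrow> 0) (at_right 0)" .
  have l2: "((\<lambda>h. n \<bullet> ((y (\<theta> + h) - y \<theta>) /\<^sub>R h) / norm ((y (\<theta> + h) - y \<theta>) /\<^sub>R h)) \<longlongrightarrow> n \<bullet> ?T / norm ?T) (at_right 0)"
    by (intro tendsto_intros yd) (use tangent_pos[of \<theta>] in auto)
  have "\<forall>\<^sub>F h in at_right (0::real). n \<bullet> ((y (\<theta> + h) - y \<theta>) /\<^sub>R h) / norm ((y (\<theta> + h) - y \<theta>) /\<^sub>R h)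
      = n \<bullet> (y (\<theta> + h) - y \<theta>) / norm (y (\<theta> + h) - y \<theta>)"
    using eventually_at_right_less[of 0] by eventually_elim (simp add: divide_simps)
  with l2 have "((\<lambda>h. n \<bullet> (y (\<theta> + h) - y \<theta>) / norm (y (\<theta> + h) - y \<theta>)) \<longlongrightarrow> n \<bullet> ?T / norm ?T) (at_right 0)"
    by (rule Lim_transform_eventually)
  from tendsto_unique[OF _ this l1] have nT: "n \<bullet> ?T = 0"
    using tangent_pos[of \<theta>] by simp
  have \<nu>T: "\<nu> \<theta> \<bullet> ?T = 0" using normal_tangent by (simp add: \<nu>_def)
  have nn: "norm n = 1" "norm (\<nu> \<theta>) = 1"
    using n is_outward_unit_normal_\<nu>[of \<theta>] by (simp_all add: is_outward_unit_normal_def)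
  have "n = \<nu> \<theta> \<or> n = - \<nu> \<theta>"
    by (rule orthogonal_vec2_eq[OF nT \<nu>T _ nn]) (use tangent_pos[of \<theta>] in auto)
  moreover have "n \<noteq> - \<nu> \<theta>"
  proof
    assume "n = - \<nu> \<theta>"
    then have "\<forall>\<^sub>F s in at_right 0. y \<theta> + s *\<^sub>R \<nu> \<theta> \<in> E"
      using n by (simp add: is_outward_unit_normal_def) (auto elim: eventually_mono)
    moreover have "\<forall>\<^sub>F s in at_right 0. y \<theta> + s *\<^sub>R \<nu> \<theta> \<notin> closure E"
      using is_outward_unit_normal_\<nu>[of \<theta>] unfolding is_outward_unit_normal_def by (auto elim: eventually_mono)
    ultimately have "\<forall>\<^sub>F s in at_right (0::real). False"
      by eventually_elim (use closure_subset in blast)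
    then show False by simp
  qed
  ultimately show "n = \<nu> \<theta>" by simp
qed

end

section \<open>Integrals of periodic functions\<close>

lemma has_bochner_integral_shift:
  fixes f :: "real \<Rightarrow> real"
  assumes "has_bochner_integral lborel (\<lambda>x. indicator {a..<b} x * f x) I" and f: "\<And>x. f (t + x) = f x"
  shows "has_bochner_integral lborel (\<lambda>x. indicator {a - t..<b - t} x * f x) I"
proof -
  have "has_bochner_integral lborel (\<lambda>x. indicator {a..<b} (t + 1 * x) * f (t + 1 * x)) (I /\<^sub>R \<bar>1\<bar>)"
    using assms(1) by (subst lborel_has_bochner_integral_real_affine_iff[symmetric]) auto
  moreover have "indicator {a..<b} (t + 1 * x) * f (t + 1 * x) = indicator {a - t..<b - t} x * f x" for x
    by (auto simp: indicator_def f)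
  ultimately show ?thesis by simp
qed

lemma periodic_int_multiple:
  fixes f :: "real \<Rightarrow> 'a" and k :: int
  assumes "\<And>x. f (x + T) = f x"
  shows "f (x + of_int k * T) = f x"
proof (induction k rule: int_induct[where k = 0])
  case (step1 i)
  then show ?case using assms[of "x + of_int i * T"] by (simp add: algebra_simps)
next
  case (step2 i)
  then show ?case using assms[of "x + of_int (i - 1) * T"] by (simp add: algebra_simps)
qed simp

text \<open>Half-open intervals let a period be cut and reassembled without overlap. Integrability
  over one period is the right hypothesis here, as the integrand on the boundary is only known to be
  Borel and integrable.\<close>

lemma has_bochner_integral_periodic:
  fixes f :: "real \<Rightarrow> real"
  assumes I: "has_bochner_integral lborel (\<lambda>x. indicator {0..<T} x * f x) I"
    and per: "\<And>x. f (x + T) = f x" and T: "T > 0"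
  shows "has_bochner_integral lborel (\<lambda>x. indicator {a..<a + T} x * f x) I"
proof -
  \<comment> \<open>\<open>a\<close> is reduced modulo \<open>T\<close> to a point \<open>b\<close>
    of \<open>{0..<T}\<close>; the piece before \<open>b\<close> is then shifted by one
    period.\<close>
  define k where "k = \<lfloor>a / T\<rfloor>"
  define b where "b = a - of_int k * T"
  have "of_int k \<le> a / T" "a / T < of_int k + 1" by (auto simp: k_def)
  then have b: "0 \<le> b" "b < T" using T by (auto simp: b_def field_simps)
  have int: "integrable lborel (\<lambda>x. indicator {0..<T} x * f x)"
    using I by (simp add: has_bochner_integral_iff)
  have sub: "integrable lborel (\<lambda>x. indicator X x * f x)" if "X \<subseteq> {0..<T}" "X \<in> sets borel" for X
    using set_integrable_subset[of lborel "{0..<T}" f X] int that by (simp add: set_integrable_def)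
  have i1: "integrable lborel (\<lambda>x. indicator {b..<T} x * f x)" and i2: "integrable lborel (\<lambda>x. indicator {0..<b} x * f x)"
    by (rule sub; use b in auto)+
  have "has_bochner_integral lborel (\<lambda>x. indicator {0..<b} x * f x) (\<integral>x. indicator {0..<b} x * f x \<partial>lborel)"
    using i2 by (rule has_bochner_integral_integrable)
  from has_bochner_integral_shift[OF this, of "- T"]
  have 2: "has_bochner_integral lborel (\<lambda>x. indicator {T..<b + T} x * f x) (\<integral>x. indicator {0..<b} x * f x \<partial>lborel)"
    using per[of "x - T" for x] by simp
  have "has_bochner_integral lborel (\<lambda>x. indicator {b..<T} x * f x + indicator {T..<b + T} x * f x)
     ((\<integral>x. indicator {b..<T} x * f x \<partial>lborel) + (\<integral>x. indicator {0..<b} x * f x \<partial>lborel))"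
    by (rule has_bochner_integral_add[OF has_bochner_integral_integrable[OF i1] 2])
  moreover have "indicator {b..<T} x * f x + indicator {T..<b + T} x * f x = indicator {b..<b + T} x * f x" for x
    using b by (auto simp: indicator_def)
  moreover have "(\<integral>x. indicator {b..<T} x * f x \<partial>lborel) + (\<integral>x. indicator {0..<b} x * f x \<partial>lborel) = I"
  proof -
    have "(\<integral>x. indicator {b..<T} x * f x \<partial>lborel) + (\<integral>x. indicator {0..<b} x * f x \<partial>lborel)
      = (\<integral>x. indicator {b..<T} x * f x + indicator {0..<b} x * f x \<partial>lborel)"
      using i1 i2 by simp
    also have "\<dots> = (\<integral>x. indicator {0..<T} x * f x \<partial>lborel)"
      using b by (intro Bochner_Integration.integral_cong) (auto simp: indicator_def)
    finally show ?thesis using I by (simp add: has_bochner_integral_iff)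
  qed
  ultimately have "has_bochner_integral lborel (\<lambda>x. indicator {b..<b + T} x * f x) I" by simp
  from has_bochner_integral_shift[OF this, of "- (of_int k * T)"]
  have "has_bochner_integral lborel (\<lambda>x. indicator {b + of_int k * T..<b + T + of_int k * T} x * f x) I"
    using periodic_int_multiple[of f T, OF per, of _ "- k"] by (simp add: algebra_simps)
  then show ?thesis by (simp add: b_def algebra_simps)
qed

lemma has_bochner_integral_Icc_Ico:
  fixes f :: "real \<Rightarrow> real"
  assumes "f \<in> borel_measurable borel"
  shows "has_bochner_integral lborel (\<lambda>x. indicator {a..b} x * f x) I \<longleftrightarrow>
     has_bochner_integral lborel (\<lambda>x. indicator {a..<b} x * f x) I"
proof (rule has_bochner_integral_cong_AE)
  have "AE x in lborel. x \<noteq> b" by (rule AE_lborel_singleton)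
  then show "AE x in lborel. indicator {a..b} x * f x = indicator {a..<b} x * f x"
    by eventually_elim (auto simp: indicator_def)
qed (use assms in measurable)

lemma has_bochner_integral_reflect:
  fixes f :: "real \<Rightarrow> real"
  assumes "has_bochner_integral lborel (\<lambda>x. indicator {a..b} x * f x) I"
  shows "has_bochner_integral lborel (\<lambda>x. indicator {- b..- a} x * f (- x)) I"
proof -
  have "has_bochner_integral lborel (\<lambda>x. indicator {a..b} (0 + (- 1) * x) * f (0 + (- 1) * x)) (I /\<^sub>R \<bar>- 1\<bar>)"
    using assms by (subst lborel_has_bochner_integral_real_affine_iff[symmetric]) auto
  moreover have "indicator {a..b} (0 + (- 1) * x) = (indicator {- b..- a} x :: real)" for x
    by (auto simp: indicator_def)
  ultimately show ?thesis by simp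
qed

lemma continuous_nonzero_sign:
  fixes f :: "real \<Rightarrow> real"
  assumes c: "continuous_on {a..b} f" and nz: "\<And>x. x \<in> {a..b} \<Longrightarrow> f x \<noteq> 0"
  shows "(\<forall>x\<in>{a..b}. f x > 0) \<or> (\<forall>x\<in>{a..b}. f x < 0)"
proof (rule ccontr)
  assume "\<not> ?thesis"
  then obtain x x' where x: "x \<in> {a..b}" "f x < 0" "x' \<in> {a..b}" "f x' > 0"
    using nz by (metis linorder_neqE_linordered_idom)
  have "connected (f ` {a..b})" by (intro connected_continuous_image c) simp
  then have "0 \<in> f ` {a..b}"
    using x by (meson connected_contains_Icc image_eqI atLeastAtMost_iff less_imp_le subsetD)
  then show False using nz by auto
qed

section \<open>Arc length on the ellipse for an arbitrary parametrization\<close>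

context ellipse_param
begin

lemma y_periodic: "y (\<theta> + 2 * pi) = y \<theta>"
  by (simp add: y_def dir_def)

lemma dir_eq_imp:
  assumes "dir a = dir b"
  obtains k :: int where "a = b + of_int k * (2 * pi)"
proof -
  have "cos a = cos b" "sin a = sin b" using assms by (auto simp: vec2_eq_iff)
  then have "cos (a - b) = 1" by (simp add: cos_diff flip: power2_eq_square)
  then obtain n :: int where "a - b = of_int n * 2 * pi" using cos_one_2pi_int by blast
  then show ?thesis by (intro that[of n]) (simp add: algebra_simps)
qed

lemma y_eq_imp:
  assumes "y a = y b"
  obtains k :: int where "a = b + of_int k * (2 * pi)"
proof -
  have "B *v (A *v dir a) = B *v (A *v dir b)" using assms by (simp add: y_def)
  then show ?thesis using dir_eq_imp that unfolding B_A by blast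
qed

text \<open>Guarantees that the choice in \<open>arc_length_measure\<close> yields a regular
  parametrization; which one remains unknown.\<close>

lemma regular_parametrization_exists: "regular_parametrization (\<lambda>t. y (2 * pi * t)) (frontier E)"
proof -
  have d: "((\<lambda>t. y (2 * pi * t)) has_vector_derivative (2 * pi) *\<^sub>R (A *v dir' (2 * pi * t))) (at t)" for t
  proof -
    have "((\<lambda>t. 2 * pi * t) has_vector_derivative 2 * pi) (at t)"
      by (auto intro!: derivative_eq_intros simp flip: has_real_derivative_iff_has_vector_derivative)
    from vector_diff_chain_at[OF this y_has_vector_derivative] show ?thesis by (simp add: o_def)
  qed
  have c: "continuous_on X (\<lambda>t. y (2 * pi * t))" for X
    by (rule continuous_on_compose2[OF y_continuous[of UNIV]]) (auto intro!: continuous_intros)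
  have im: "(\<lambda>t. y (2 * pi * t)) ` {0..1} = y ` {0..2 * pi}"
  proof -
    have "(\<lambda>t. 2 * pi * t) ` {0..1} = {0..2 * pi}"
      using image_mult_atLeastAtMost[of "2 * pi" 0 1] by simp
    then show ?thesis by (metis image_image)
  qed
  have lf: "s = t \<or> s = 0 \<and> t = 1 \<or> s = 1 \<and> t = 0"
    if st: "s \<in> {0..1}" "t \<in> {0..1}" "y (2 * pi * s) = y (2 * pi * t)" for s t
  proof -
    obtain k :: int where "2 * pi * s = 2 * pi * t + of_int k * (2 * pi)"
      using y_eq_imp[OF st(3)] by blast
    then have "2 * pi * s = 2 * pi * (t + of_int k)" by (simp add: algebra_simps)
    then have k: "s = t + of_int k" by simp
    then have "- 1 \<le> k" "k \<le> 1" using st(1,2) by auto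
    then have "k = - 1 \<or> k = 0 \<or> k = 1" by auto
    then show ?thesis using k st(1,2) by auto
  qed
  show ?thesis
    unfolding regular_parametrization_def
  proof (intro conjI ballI)
    show "simple_path (\<lambda>t. y (2 * pi * t))"
      unfolding simple_path_def path_def loop_free_def using c lf by blast
    show "pathfinish (\<lambda>t. y (2 * pi * t)) = pathstart (\<lambda>t. y (2 * pi * t))"
      using y_periodic[of 0] by (simp add: pathfinish_def pathstart_def)
    show "path_image (\<lambda>t. y (2 * pi * t)) = frontier E"
      unfolding path_image_def im frontier_E ..
    have "continuous_on {0..1} (\<lambda>t. (2 * pi) *\<^sub>R (A *v dir' (2 * pi * t)))"
      unfolding dir'_def by (intro continuous_intros linear_continuous_on_compose[OF _ matrix_vector_mul_linear])
    then show "(\<lambda>t. y (2 * pi * t)) C1_differentiable_on {0..1}"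
      unfolding C1_differentiable_on_def
      by (intro exI[of _ "\<lambda>t. (2 * pi) *\<^sub>R (A *v dir' (2 * pi * t))"]) (use d in auto)
    show "vector_derivative (\<lambda>t. y (2 * pi * t)) (at t) \<noteq> 0" for t
    proof -
      have "A *v dir' (2 * pi * t) \<noteq> 0" using tangent_pos[of "2 * pi * t"] by (metis less_irrefl norm_zero)
      then show ?thesis unfolding vector_derivative_at[OF d] by simp
    qed
  qed
qed

text \<open>An arbitrary parametrization is compared with \<open>y\<close> through an angle
  function. Pulled back to the unit circle it becomes \<open>g\<close>, with angular velocity
  \<open>\<psi> = g $ 1 * g' $ 2 - g $ 2 * g' $ 1\<close>; the integral of \<open>\<psi>\<close> is
  the angle up to a constant \<open>\<alpha>\<close>.\<close>

lemma angular_lift: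
  assumes "regular_parametrization \<gamma> (frontier E)"
  obtains \<Phi> \<psi> where
    "\<And>t. t \<in> {0..1} \<Longrightarrow> (\<Phi> has_real_derivative \<psi> t) (at t)" "\<And>t. t \<in> {0..1} \<Longrightarrow> \<psi> t \<noteq> 0"
    "continuous_on {0..1} \<psi>" "\<And>t. t \<in> {0..1} \<Longrightarrow> \<gamma> t = y (\<Phi> t)"
    "\<And>t. t \<in> {0..1} \<Longrightarrow> vector_derivative \<gamma> (at t) = \<psi> t *\<^sub>R (A *v dir' (\<Phi> t))"
proof -
  obtain D where D: "\<And>t. t \<in> {0..1} \<Longrightarrow> (\<gamma> has_vector_derivative D t) (at t)" "continuous_on {0..1} D"
    using assms unfolding regular_parametrization_def C1_differentiable_on_def by blast
  have vD: "vector_derivative \<gamma> (at t) = D t" if "t \<in> {0..1}" for t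
    by (rule vector_derivative_at[OF D(1)[OF that]])
  have Dnz: "D t \<noteq> 0" if "t \<in> {0..1}" for t
    using assms vD[OF that] that unfolding regular_parametrization_def by metis
  have c\<gamma>: "continuous_on {0..1} \<gamma>"
    using D(1) by (meson continuous_on_vector_derivative has_vector_derivative_at_within)
  define g where "g t = B *v (\<gamma> t - c)" for t
  define g' where "g' t = B *v D t" for t
  have g1: "(g t $ 1)\<^sup>2 + (g t $ 2)\<^sup>2 = 1" if "t \<in> {0..1}" for t
  proof -
    have "\<gamma> t \<in> frontier E"
      using assms that unfolding regular_parametrization_def path_image_def by blast
    then have "norm (g t) = 1" by (simp only: frontier_E_iff g_def)
    then show ?thesis using norm_vec2_sq[of "g t"] by simp
  qed
  have dg: "((\<lambda>t. g t $ i) has_real_derivative g' t $ i) (at t)" if "t \<in> {0..1}" for t i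
  proof -
    have "((\<lambda>t. \<gamma> t - c) has_vector_derivative D t) (at t)"
      using has_vector_derivative_diff[OF D(1)[OF that] has_vector_derivative_const[of c]] by simp
    from bounded_linear.has_vector_derivative[OF bounded_linear_vec_nth
        bounded_linear.has_vector_derivative[OF matrix_vector_mul_bounded_linear this]]
    show ?thesis unfolding g_def g'_def has_real_derivative_iff_has_vector_derivative .
  qed
  have cg: "continuous_on {0..1} (\<lambda>t. g t $ i)" and cg': "continuous_on {0..1} (\<lambda>t. g' t $ i)" for i
    unfolding g_def g'_def
    by (intro continuous_intros linear_continuous_on_compose[OF _ matrix_vector_mul_linear] c\<gamma> D(2))+
  have orth: "g t $ 1 * g' t $ 1 + g t $ 2 * g' t $ 2 = 0" if t: "t \<in> {0..1}" for t
  proof -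
    have "((\<lambda>t. g t $ 1 * g t $ 1 + g t $ 2 * g t $ 2) has_real_derivative
        (g' t $ 1 * g t $ 1 + g' t $ 1 * g t $ 1 + (g' t $ 2 * g t $ 2 + g' t $ 2 * g t $ 2))) (at t)"
      by (rule DERIV_add DERIV_mult dg t)+
    then have 1: "((\<lambda>t. g t $ 1 * g t $ 1 + g t $ 2 * g t $ 2) has_vector_derivative
        (g' t $ 1 * g t $ 1 + g' t $ 1 * g t $ 1 + (g' t $ 2 * g t $ 2 + g' t $ 2 * g t $ 2))) (at t within {0..1})"
      by (simp only: has_real_derivative_iff_has_vector_derivative has_vector_derivative_at_within)
    have "((\<lambda>t. 1 :: real) has_vector_derivative 0) (at t within {0..1})" by (rule has_vector_derivative_const)
    then have 2: "((\<lambda>t. g t $ 1 * g t $ 1 + g t $ 2 * g t $ 2) has_vector_derivative 0) (at t within {0..1})"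
      by (rule has_vector_derivative_transform[OF t, rotated]) (use g1 in \<open>simp add: power2_eq_square\<close>)
    have "g' t $ 1 * g t $ 1 + g' t $ 1 * g t $ 1 + (g' t $ 2 * g t $ 2 + g' t $ 2 * g t $ 2) = 0"
      by (rule vector_derivative_unique_within_closed_interval[of 0 1 t]) (use t 1 2 in auto)
    then show ?thesis by (simp add: mult.commute)
  qed
  define \<psi> where "\<psi> t = g t $ 1 * g' t $ 2 - g t $ 2 * g' t $ 1" for t
  have c\<psi>: "continuous_on {0..1} \<psi>" unfolding \<psi>_def by (intro continuous_intros cg cg')
  have g'1: "g' t $ 1 = - g t $ 2 * \<psi> t" and g'2: "g' t $ 2 = g t $ 1 * \<psi> t" if t: "t \<in> {0..1}" for t
    using g1[OF t] orth[OF t] unfolding \<psi>_def by algebra+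
  have \<psi>nz: "\<psi> t \<noteq> 0" if t: "t \<in> {0..1}" for t
  proof
    assume "\<psi> t = 0"
    then have "g' t = 0" using g'1[OF t] g'2[OF t] by (simp add: vec2_eq_iff)
    then have "A *v g' t = 0" by simp
    then show False using Dnz[OF t] unfolding g'_def A_B by simp
  qed
  \<comment> \<open>Clamping \<open>t\<close> extends \<open>\<psi>\<close> beyond the unit
    interval, so that its integral has a two-sided derivative at 0 and 1 as well.\<close>
  define \<psi>e where "\<psi>e t = \<psi> (max 0 (min 1 t))" for t
  have c\<psi>e: "continuous_on {- 1..2} \<psi>e"
    unfolding \<psi>e_def by (rule continuous_on_compose2[OF c\<psi>]) (auto intro!: continuous_intros)
  define \<Theta> where "\<Theta> t = integral {- 1..t} \<psi>e" for t
  have d\<Theta>: "(\<Theta> has_real_derivative \<psi> t) (at t)" if t: "t \<in> {0..1}" for t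
  proof -
    have "(\<Theta> has_real_derivative \<psi>e t) (at t within {- 1..2})"
      unfolding \<Theta>_def[abs_def] by (rule integral_has_real_derivative[OF c\<psi>e]) (use t in auto)
    moreover have "at t within {- 1..2} = at t" using t by (intro at_within_interior) auto
    moreover have "\<psi>e t = \<psi> t" using t by (simp add: \<psi>e_def)
    ultimately show ?thesis by simp
  qed
  \<comment> \<open>\<open>p\<close> and \<open>q\<close> are the coordinates of \<open>g\<close>
    rotated back by \<open>\<Theta>\<close>. They are constant, and this constant unit vector
    supplies \<open>\<alpha>\<close>.\<close>
  define p where "p t = g t $ 1 * cos (\<Theta> t) + g t $ 2 * sin (\<Theta> t)" for t
  define q where "q t = g t $ 2 * cos (\<Theta> t) - g t $ 1 * sin (\<Theta> t)" for t
  have dp: "(p has_real_derivative 0) (at t within {0..1})" if t: "t \<in> {0..1}" for t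
  proof -
    have "(p has_real_derivative (g' t $ 1 * cos (\<Theta> t) + (- sin (\<Theta> t) * \<psi> t) * g t $ 1
        + (g' t $ 2 * sin (\<Theta> t) + (cos (\<Theta> t) * \<psi> t) * g t $ 2))) (at t)"
      unfolding p_def[abs_def] by (rule DERIV_add DERIV_mult dg t DERIV_fun_cos DERIV_fun_sin d\<Theta>)+
    moreover have "g' t $ 1 * cos (\<Theta> t) + (- sin (\<Theta> t) * \<psi> t) * g t $ 1
        + (g' t $ 2 * sin (\<Theta> t) + (cos (\<Theta> t) * \<psi> t) * g t $ 2) = 0"
      unfolding g'1[OF t] g'2[OF t] by (simp add: algebra_simps)
    ultimately show ?thesis by (simp add: has_field_derivative_at_within)
  qed
  have dq: "(q has_real_derivative 0) (at t within {0..1})" if t: "t \<in> {0..1}" for t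
  proof -
    have "(q has_real_derivative (g' t $ 2 * cos (\<Theta> t) + (- sin (\<Theta> t) * \<psi> t) * g t $ 2
        - (g' t $ 1 * sin (\<Theta> t) + (cos (\<Theta> t) * \<psi> t) * g t $ 1))) (at t)"
      unfolding q_def[abs_def] by (rule DERIV_diff DERIV_mult dg t DERIV_fun_cos DERIV_fun_sin d\<Theta>)+
    moreover have "g' t $ 2 * cos (\<Theta> t) + (- sin (\<Theta> t) * \<psi> t) * g t $ 2
        - (g' t $ 1 * sin (\<Theta> t) + (cos (\<Theta> t) * \<psi> t) * g t $ 1) = 0"
      unfolding g'1[OF t] g'2[OF t] by (simp add: algebra_simps)
    ultimately show ?thesis by (simp add: has_field_derivative_at_within)
  qed
  have pc: "p t = p 0" if "t \<in> {0..1}" for t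
    using has_field_derivative_zero_constant[OF convex_real_interval(5)[of 0 1] dp] that
    by (metis atLeastAtMost_iff order_refl zero_le_one)
  have qc: "q t = q 0" if "t \<in> {0..1}" for t
    using has_field_derivative_zero_constant[OF convex_real_interval(5)[of 0 1] dq] that
    by (metis atLeastAtMost_iff order_refl zero_le_one)
  have zero01: "(0 :: real) \<in> {0..1}" by simp
  have "(p 0)\<^sup>2 + (q 0)\<^sup>2 = 1"
    using g1[OF zero01] sin_cos_squared_add[of "\<Theta> 0"] unfolding p_def q_def by algebra
  then obtain \<alpha> where \<alpha>: "p 0 = cos \<alpha>" "q 0 = sin \<alpha>" using sincos_total_2pi by metis
  have gdir: "g t = dir (\<Theta> t + \<alpha>)" if t: "t \<in> {0..1}" for t
  proof -
    have 1: "g t $ 1 * cos (\<Theta> t) + g t $ 2 * sin (\<Theta> t) = cos \<alpha>" "g t $ 2 * cos (\<Theta> t) - g t $ 1 * sin (\<Theta> t) = sin \<alpha>"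
      using pc[OF t] qc[OF t] \<alpha> by (simp_all add: p_def q_def)
    have "g t $ 1 = cos (\<Theta> t) * cos \<alpha> - sin (\<Theta> t) * sin \<alpha>" "g t $ 2 = sin (\<Theta> t) * cos \<alpha> + cos (\<Theta> t) * sin \<alpha>"
      unfolding 1[symmetric] using sin_cos_squared_add[of "\<Theta> t"] by algebra+
    then show ?thesis by (simp add: vec2_eq_iff cos_add sin_add)
  qed
  show ?thesis
  proof (rule that[of "\<lambda>t. \<Theta> t + \<alpha>" \<psi>])
    fix t :: real assume t: "t \<in> {0..1}"
    show "((\<lambda>t. \<Theta> t + \<alpha>) has_real_derivative \<psi> t) (at t)"
      using DERIV_add[OF d\<Theta>[OF t] DERIV_const[of \<alpha>]] by simp
    have "\<gamma> t = c + A *v g t" unfolding g_def A_B by simp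
    then show "\<gamma> t = y (\<Theta> t + \<alpha>)" by (simp add: y_def gdir[OF t])
    have "g' t = \<psi> t *\<^sub>R dir' (\<Theta> t + \<alpha>)"
      using g'1[OF t] g'2[OF t] unfolding gdir[OF t] by (simp add: vec2_eq_iff)
    then have "A *v g' t = \<psi> t *\<^sub>R (A *v dir' (\<Theta> t + \<alpha>))" by (simp add: matrix_vector_mult_scaleR)
    then show "vector_derivative \<gamma> (at t) = \<psi> t *\<^sub>R (A *v dir' (\<Theta> t + \<alpha>))"
      unfolding vD[OF t] g'_def A_B .
  qed (use c\<psi> \<psi>nz in auto)
qed

end

context ellipse_param
begin

text \<open>With the orientation \<open>s\<close> the angle \<open>s * \<Phi>\<close> increases
  strictly, and closedness makes its total change a positive multiple of \<open>2 * pi\<close>. Two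
  full turns or more would bring the path back to its starting point at an interior time, against
  \<open>loop_free\<close>.\<close>

lemma lift_total_angle:
  assumes rp: "regular_parametrization \<gamma> (frontier E)" and s: "s = 1 \<or> s = - 1"
    and \<Phi>: "\<And>t. t \<in> {0..1} \<Longrightarrow> (\<Phi> has_real_derivative \<psi> t) (at t)"
    and pos: "\<And>t. t \<in> {0..1} \<Longrightarrow> s * \<psi> t > 0" and \<gamma>: "\<And>t. t \<in> {0..1} \<Longrightarrow> \<gamma> t = y (\<Phi> t)"
  shows "s * \<Phi> 1 = s * \<Phi> 0 + 2 * pi"
proof -
  define \<Xi> where "\<Xi> t = s * \<Phi> t" for t
  have d\<Xi>: "(\<Xi> has_real_derivative s * \<psi> t) (at t)" if "t \<in> {0..1}" for t
    unfolding \<Xi>_def[abs_def] by (rule DERIV_cmult[OF \<Phi>[OF that]])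
  have ss: "s * s = 1" using s by auto
  have \<Phi>\<Xi>: "\<Phi> t = s * \<Xi> t" for t unfolding \<Xi>_def mult.assoc[symmetric] ss by simp
  have inc: "\<Xi> a < \<Xi> b" if "0 \<le> a" "a < b" "b \<le> 1" for a b
  proof (rule DERIV_pos_imp_increasing[OF that(2)])
    fix x assume "a \<le> x" "x \<le> b"
    then have "x \<in> {0..1}" using that by auto
    then show "\<exists>y. (\<Xi> has_real_derivative y) (at x) \<and> 0 < y" using d\<Xi> pos by blast
  qed
  have c\<Xi>: "continuous_on {0..1} \<Xi>"
    by (rule DERIV_continuous_on) (rule has_field_derivative_at_within[OF d\<Xi>])
  have "\<gamma> 0 = \<gamma> 1"
    using rp unfolding regular_parametrization_def pathfinish_def pathstart_def by simp
  then have "y (\<Phi> 1) = y (\<Phi> 0)" using \<gamma>[of 0] \<gamma>[of 1] by simp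
  then obtain k :: int where "\<Phi> 1 = \<Phi> 0 + of_int k * (2 * pi)" by (rule y_eq_imp)
  then have "\<Xi> 1 = \<Xi> 0 + s * (of_int k * (2 * pi))" by (simp add: \<Xi>_def algebra_simps)
  then obtain m :: int where m: "\<Xi> 1 = \<Xi> 0 + of_int m * (2 * pi)"
    using s that[of k] that[of "- k"] by (elim disjE) simp_all
  have "0 < of_int m * (2 * pi)" using inc[of 0 1] m by simp
  then have "0 < m" by (simp add: zero_less_mult_iff)
  moreover have "\<not> 2 \<le> m"
  proof
    assume "2 \<le> m"
    then have "(2 :: real) \<le> of_int m" by linarith
    then have "2 * (2 * pi) \<le> of_int m * (2 * pi)" by (rule mult_right_mono) simp
    then have le: "\<Xi> 0 + 2 * pi \<le> \<Xi> 1 - 2 * pi" using m by linarith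
    have "\<Xi> 0 \<le> \<Xi> 0 + 2 * pi" "\<Xi> 0 + 2 * pi \<le> \<Xi> 1" using le pi_gt_zero by linarith+
    from IVT'[OF this zero_le_one c\<Xi>] have "\<exists>t\<ge>0. t \<le> 1 \<and> \<Xi> t = \<Xi> 0 + 2 * pi" by blast
    then obtain t where t: "0 \<le> t" "t \<le> 1" "\<Xi> t = \<Xi> 0 + 2 * pi" by blast
    have "\<Xi> t \<noteq> \<Xi> 0" "\<Xi> t \<noteq> \<Xi> 1" using t(3) le pi_gt_zero by linarith+
    then have t01: "t \<noteq> 0" "t \<noteq> 1" by auto
    have "\<Phi> t = \<Phi> 0 + of_int (if s = 1 then 1 else - 1) * (2 * pi)"
      unfolding \<Phi>\<Xi> t(3) using s by (auto simp: algebra_simps)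
    then have "y (\<Phi> t) = y (\<Phi> 0)" by (simp only: periodic_int_multiple[of y "2 * pi", OF y_periodic])
    then have "\<gamma> t = \<gamma> 0" using \<gamma>[of t] \<gamma>[of 0] t by simp
    moreover have "loop_free \<gamma>" using rp unfolding regular_parametrization_def simple_path_def by blast
    ultimately show False
      using t t01 unfolding loop_free_def by force
  qed
  ultimately have "m = 1" by simp
  then show ?thesis using m by (simp add: \<Xi>_def)
qed

text \<open>Substitution along the angle function carries the unknown parametrization to the
  standard one, and periodicity allows an arbitrary starting angle.\<close>

lemma arc_length_has_integral:
  fixes h :: "real^2 \<Rightarrow> real"
  assumes hm: "h \<in> borel_measurable borel"
    and I: "has_bochner_integral lborel (\<lambda>\<theta>. indicator {0..2*pi} \<theta> * (h (y \<theta>) * norm (A *v dir' \<theta>))) I"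
  shows "has_bochner_integral (arc_length_measure (frontier E)) (\<lambda>z. indicator (frontier E) z * h z) I"
proof -
  define \<gamma> where "\<gamma> = (SOME \<gamma>. regular_parametrization \<gamma> (frontier E))"
  have rp: "regular_parametrization \<gamma> (frontier E)"
    unfolding \<gamma>_def by (rule someI[of "\<lambda>\<gamma>. regular_parametrization \<gamma> (frontier E)"]) (rule regular_parametrization_exists)
  obtain \<Phi> \<psi> where \<Phi>: "\<And>t. t \<in> {0..1} \<Longrightarrow> (\<Phi> has_real_derivative \<psi> t) (at t)"
    and nz: "\<And>t. t \<in> {0..1} \<Longrightarrow> \<psi> t \<noteq> 0" and c\<psi>: "continuous_on {0..1} \<psi>"
    and \<gamma>: "\<And>t. t \<in> {0..1} \<Longrightarrow> \<gamma> t = y (\<Phi> t)"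
    and vd: "\<And>t. t \<in> {0..1} \<Longrightarrow> vector_derivative \<gamma> (at t) = \<psi> t *\<^sub>R (A *v dir' (\<Phi> t))"
    using angular_lift[OF rp] by blast
  have c\<Phi>: "continuous_on {0..1} \<Phi>"
    by (rule DERIV_continuous_on) (rule has_field_derivative_at_within[OF \<Phi>])
  define f where "f \<theta> = h (y \<theta>) * norm (A *v dir' \<theta>)" for \<theta>
  have ym [measurable]: "y \<in> borel_measurable borel"
    by (rule borel_measurable_continuous_onI[OF y_continuous])
  have cT: "continuous_on X (\<lambda>\<theta>. A *v dir' \<theta>)" for X
    unfolding dir'_def by (intro continuous_intros linear_continuous_on_compose[OF _ matrix_vector_mul_linear])
  have [measurable]: "(\<lambda>\<theta>. A *v dir' \<theta>) \<in> borel_measurable borel"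
    by (rule borel_measurable_continuous_onI[OF cT])
  note hm [measurable]
  have fm [measurable]: "f \<in> borel_measurable borel" unfolding f_def by measurable
  have fper: "f (\<theta> + 2 * pi) = f \<theta>" for \<theta> by (simp add: f_def y_periodic dir'_def)
  obtain s :: real where s: "s = 1 \<or> s = - 1" and pos: "\<And>t. t \<in> {0..1} \<Longrightarrow> s * \<psi> t > 0"
  proof -
    consider "\<forall>t\<in>{0..1}. \<psi> t > 0" | "\<forall>t\<in>{0..1}. \<psi> t < 0"
      using continuous_nonzero_sign[OF c\<psi> nz] by blast
    then show thesis by cases (use that[of 1] that[of "- 1"] in auto)
  qed
  \<comment> \<open>\<open>fs\<close> takes the increasing angle \<open>s * \<Phi>\<close> as its
    argument; in the clockwise case it is the reflection of \<open>f\<close>.\<close>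
  define fs where "fs \<theta> = f (s * \<theta>)" for \<theta>
  have fsm: "fs \<in> borel_measurable borel" unfolding fs_def by measurable
  have fsper: "fs (\<theta> + 2 * pi) = fs \<theta>" for \<theta>
    using s fper[of \<theta>] fper[of "- \<theta> - 2 * pi"] by (auto simp: fs_def)
  have "has_bochner_integral lborel (\<lambda>x. indicator {0..<2 * pi} x * fs x) I"
    using s
  proof
    assume "s = 1"
    then show ?thesis using I has_bochner_integral_Icc_Ico[OF fm] by (simp add: fs_def f_def)
  next
    assume sm: "s = - 1"
    have "has_bochner_integral lborel (\<lambda>x. indicator {- (2 * pi)..- 0} x * f (- x)) I"
      by (rule has_bochner_integral_reflect) (use I in \<open>simp add: f_def\<close>)
    then have "has_bochner_integral lborel (\<lambda>x. indicator {- (2 * pi)..0} x * fs x) I"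
      by (simp add: fs_def sm)
    then have "has_bochner_integral lborel (\<lambda>x. indicator {- (2 * pi)..<0} x * fs x) I"
      by (simp add: has_bochner_integral_Icc_Ico[OF fsm])
    from has_bochner_integral_shift[OF this, of "- (2 * pi)"]
    show ?thesis using fsper[of "x - 2 * pi" for x] by simp
  qed
  from has_bochner_integral_periodic[OF this fsper, of "s * \<Phi> 0"]
  have "has_bochner_integral lborel (\<lambda>x. indicator {s * \<Phi> 0..<s * \<Phi> 1} x * fs x) I"
    using lift_total_angle[OF rp s \<Phi> pos \<gamma>] by simp
  then have J: "has_bochner_integral lborel (\<lambda>x. indicator {s * \<Phi> 0..s * \<Phi> 1} x * fs x) I"
    by (simp add: has_bochner_integral_Icc_Ico[OF fsm])
  have sub: "set_integrable lborel {0..1} (\<lambda>x. fs (s * \<Phi> x) * (s * \<psi> x))"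
    "(LBINT x. fs x * indicator {s * \<Phi> 0..s * \<Phi> 1} x) = (LBINT x. fs (s * \<Phi> x) * (s * \<psi> x) * indicator {0..1} x)"
  proof -
    have "set_integrable lborel {s * \<Phi> 0..s * \<Phi> 1} fs"
      using J by (simp add: set_integrable_def has_bochner_integral_iff)
    note * = integral_substitution[of "\<lambda>t. s * \<Phi> t" 0 1 fs "\<lambda>t. s * \<psi> t", OF this DERIV_cmult[OF \<Phi>]
        continuous_on_mult_left[OF c\<psi>] less_imp_le[OF pos] zero_le_one]
    show "set_integrable lborel {0..1} (\<lambda>x. fs (s * \<Phi> x) * (s * \<psi> x))" by (rule *(1))
    show "(LBINT x. fs x * indicator {s * \<Phi> 0..s * \<Phi> 1} x) = (LBINT x. fs (s * \<Phi> x) * (s * \<psi> x) * indicator {0..1} x)"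
      by (rule *(2))
  qed
  have K: "has_bochner_integral lborel (\<lambda>t. indicator {0..1} t * (f (\<Phi> t) * (s * \<psi> t))) I"
  proof -
    have ss: "fs (s * \<theta>) = f \<theta>" for \<theta> using s by (auto simp: fs_def)
    have i: "integrable lborel (\<lambda>t. indicator {0..1} t * (f (\<Phi> t) * (s * \<psi> t)))"
      using sub(1) unfolding ss set_integrable_def real_scaleR_def .
    have "(\<integral>t. indicator {0..1} t * (f (\<Phi> t) * (s * \<psi> t)) \<partial>lborel) = (\<integral>t. f (\<Phi> t) * (s * \<psi> t) * indicator {0..1} t \<partial>lborel)"
      by (simp only: mult.commute)
    also have "\<dots> = (\<integral>x. fs x * indicator {s * \<Phi> 0..s * \<Phi> 1} x \<partial>lborel)"
      using sub(2) unfolding ss by (rule sym)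
    also have "\<dots> = (\<integral>x. indicator {s * \<Phi> 0..s * \<Phi> 1} x * fs x \<partial>lborel)"
      by (simp only: mult.commute)
    also have "\<dots> = I" using J unfolding has_bochner_integral_iff by blast
    finally show ?thesis using i unfolding has_bochner_integral_iff by blast
  qed
  define R where "R = restrict_space lborel {0..1::real}"
  have R: "borel_measurable R = borel_measurable (restrict_space borel {0..1})"
    unfolding R_def by (intro measurable_cong_sets sets_restrict_space_cong) auto
  have spR: "space R = {0..1}" by (simp add: R_def)
  have c\<gamma>: "continuous_on {0..1} \<gamma>"
    using rp unfolding regular_parametrization_def simple_path_def path_def by blast
  have \<gamma>m: "\<gamma> \<in> borel_measurable R"
    unfolding R by (rule borel_measurable_continuous_on_restrict[OF c\<gamma>])
  have wm: "(\<lambda>t. norm (vector_derivative \<gamma> (at t))) \<in> borel_measurable R"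
  proof -
    have "continuous_on {0..1} (\<lambda>t. norm (\<psi> t *\<^sub>R (A *v dir' (\<Phi> t))))"
      by (intro continuous_intros c\<psi> continuous_on_compose2[OF cT[of UNIV] c\<Phi>]) auto
    then have "(\<lambda>t. norm (\<psi> t *\<^sub>R (A *v dir' (\<Phi> t)))) \<in> borel_measurable R"
      unfolding R by (rule borel_measurable_continuous_on_restrict)
    then show ?thesis
      by (rule measurable_cong[THEN iffD2, rotated]) (simp add: spR vd)
  qed
  let ?M = "density R (\<lambda>t. ennreal (norm (vector_derivative \<gamma> (at t))))"
  have arc: "arc_length_measure (frontier E) = distr ?M borel \<gamma>"
    unfolding arc_length_measure_def Let_def \<gamma>_def R_def ..
  let ?H = "\<lambda>z. indicator (frontier E) z * h z"
  have Fm: "frontier E \<in> sets borel" by simp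
  have Hm: "?H \<in> borel_measurable borel" using Fm by measurable
  have HR: "(\<lambda>t. ?H (\<gamma> t)) \<in> borel_measurable R"
    using measurable_compose[OF \<gamma>m Hm] .
  have eq: "indicator {0..1} t *\<^sub>R (norm (vector_derivative \<gamma> (at t)) *\<^sub>R ?H (\<gamma> t)) = indicator {0..1} t * (f (\<Phi> t) * (s * \<psi> t))" for t
  proof (cases "t \<in> {0..1}")
    case True
    have "\<bar>\<psi> t\<bar> = s * \<psi> t" using s pos[OF True] by auto
    then show ?thesis using True y_in_frontier[of "\<Phi> t"] by (simp add: vd \<gamma> f_def)
  qed simp
  have R1: "has_bochner_integral R (\<lambda>t. norm (vector_derivative \<gamma> (at t)) *\<^sub>R ?H (\<gamma> t)) I"
  proof -
    have S01: "{0..1::real} \<inter> space lborel \<in> sets lborel" by simp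
    show ?thesis
      using K unfolding has_bochner_integral_iff R_def integrable_restrict_space[OF S01] integral_restrict_space[OF S01] eq .
  qed
  have nn: "AE t in R. 0 \<le> norm (vector_derivative \<gamma> (at t))" by simp
  have M1: "has_bochner_integral ?M (\<lambda>t. ?H (\<gamma> t)) I"
    using R1 unfolding has_bochner_integral_iff integrable_density[OF HR wm nn] integral_density[OF HR wm nn] .
  have \<gamma>M: "\<gamma> \<in> measurable ?M borel" using \<gamma>m by simp
  show ?thesis
    using M1 unfolding arc has_bochner_integral_iff integrable_distr_eq[OF \<gamma>M Hm] integral_distr[OF \<gamma>M Hm] .
qed

end

section \<open>Dominating function and limit of the singular weight\<close>

lemma integrable_inverse_sqrt_abs:
  "integrable lborel (\<lambda>s::real. indicator {- 1<..<1} s * (1 / sqrt \<bar>s\<bar>))"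
proof -
  have "set_integrable lborel (einterval 0 1) (\<lambda>s::real. 1 / sqrt s)"
  proof (rule interval_integral_FTC_nonneg[where F = "\<lambda>s. 2 * sqrt s" and A = 0 and B = 2])
    fix s :: real assume s: "0 < ereal s" "ereal s < 1"
    then have s0: "s > 0" by simp
    show "((\<lambda>s. 2 * sqrt s) has_real_derivative 1 / sqrt s) (at s)"
      using s0 by (auto intro!: derivative_eq_intros simp: inverse_eq_divide)
    show "isCont (\<lambda>s. 1 / sqrt s) s" using s0 by (intro continuous_intros) auto
  next
    have "isCont (\<lambda>s::real. 2 * sqrt s) x" for x by (intro continuous_intros)
    then have lim: "((\<lambda>s::real. 2 * sqrt s) \<longlongrightarrow> 2 * sqrt x) (at x)" for x by (simp add: isCont_def)
    show "(((\<lambda>s. 2 * sqrt s) \<circ> real_of_ereal) \<longlongrightarrow> 0) (at_right 0)"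
      unfolding zero_ereal_def ereal_tendsto_simps
      using tendsto_mono[OF at_le lim[of 0]] by simp
    show "(((\<lambda>s. 2 * sqrt s) \<circ> real_of_ereal) \<longlongrightarrow> 2) (at_left 1)"
      unfolding one_ereal_def ereal_tendsto_simps
      using tendsto_mono[OF at_le lim[of 1]] by simp
  qed auto
  moreover have "einterval 0 1 = {0<..<1}" by (auto simp: einterval_def)
  ultimately have 1: "integrable lborel (\<lambda>s::real. indicator {0<..<1} s * (1 / sqrt s))"
    by (simp add: set_integrable_def)
  have 2: "integrable lborel (\<lambda>s::real. indicator {0<..<1} (0 + (- 1) * s) * (1 / sqrt (0 + (- 1) * s)))"
    by (rule lborel_integrable_real_affine[OF 1]) simp
  have "integrable lborel (\<lambda>s::real. indicator {0<..<1} s * (1 / sqrt s)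
      + indicator {0<..<1} (0 + (- 1) * s) * (1 / sqrt (0 + (- 1) * s)))"
    by (rule Bochner_Integration.integrable_add[OF 1 2])
  moreover have "indicator {0<..<1} s * (1 / sqrt s) + indicator {0<..<1} (0 + (- 1) * s) * (1 / sqrt (0 + (- 1) * s))
      = indicator {- 1<..<1} s * (1 / sqrt \<bar>s\<bar>)" for s :: real
    by (cases s "0 :: real" rule: linorder_cases) (auto simp: indicator_def)
  ultimately show ?thesis by simp
qed

text \<open>A majorant of \<open>1 / (1 + t^2) * (1 / sqrt \<bar>t^2 - a^2\<bar>)\<close> for
  \<open>t > 0\<close> and all \<open>a \<ge> a0\<close>. It comes from
  \<open>\<bar>t^2 - a^2\<bar> \<ge> a0 * \<bar>t - a\<bar>\<close>, where the singular factor is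
  kept for \<open>\<bar>t - a\<bar> < 1\<close> and replaced by 1 farther out. Its integral is the
  same for every \<open>a\<close>, so one bound holds along the whole boundary.\<close>

definition dom_kernel :: "real \<Rightarrow> real \<Rightarrow> real \<Rightarrow> real" where
  "dom_kernel a0 a t = 1 / sqrt a0 * (indicator {- 1<..<1} (t - a) * (1 / sqrt \<bar>t - a\<bar>) + indicator {0<..} t * (1 / (1 + t\<^sup>2)))"

definition dom_const :: "real \<Rightarrow> real" where
  "dom_const a0 = 1 / sqrt a0 * ((\<integral>s. indicator {- 1<..<1} s * (1 / sqrt \<bar>s\<bar>) \<partial>lborel)
     + (\<integral>t. indicator {0<..} t * (1 / (1 + t\<^sup>2)) \<partial>lborel))"

lemma dom_kernel_integral:
  shows "integrable lborel (dom_kernel a0 a)" and "integral\<^sup>L lborel (dom_kernel a0 a) = dom_const a0"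
proof -
  let ?q = "\<lambda>s::real. indicator {- 1<..<1} s * (1 / sqrt \<bar>s\<bar>)"
  have 0: "?q (- a + 1 * t) = indicator {- 1<..<1} (t - a) * (1 / sqrt \<bar>t - a\<bar>)" for t by simp
  have i: "integrable lborel (\<lambda>t. indicator {- 1<..<1} (t - a) * (1 / sqrt \<bar>t - a\<bar>))"
    using lborel_integrable_real_affine[OF integrable_inverse_sqrt_abs, of 1 "- a"] unfolding 0 by simp
  have e: "(\<integral>t. indicator {- 1<..<1} (t - a) * (1 / sqrt \<bar>t - a\<bar>) \<partial>lborel) = (\<integral>s. ?q s \<partial>lborel)"
    using lborel_integral_real_affine[of 1 ?q "- a"] unfolding 0 by simp
  have j: "integrable lborel (\<lambda>t. indicator {0<..} t * (1 / (1 + t\<^sup>2)) :: real)"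
    using integrable_inverse_one_plus_sq unfolding set_integrable_def real_scaleR_def .
  show "integrable lborel (dom_kernel a0 a)"
    unfolding dom_kernel_def[abs_def] by (intro Bochner_Integration.integrable_mult_right Bochner_Integration.integrable_add i j)
  show "integral\<^sup>L lborel (dom_kernel a0 a) = dom_const a0"
    unfolding dom_kernel_def[abs_def] dom_const_def e[symmetric]
    by (subst integral_mult_right_zero, subst Bochner_Integration.integral_add[OF i j]) (rule refl)
qed

lemma dom_kernel_bound:
  assumes a: "0 < a0" "a0 \<le> a" and t: "0 < t" "t \<noteq> a"
  shows "1 / (1 + t\<^sup>2) * (1 / sqrt \<bar>t\<^sup>2 - a\<^sup>2\<bar>) \<le> dom_kernel a0 a t"
proof -
  have "\<bar>t\<^sup>2 - a\<^sup>2\<bar> = \<bar>t - a\<bar> * (t + a)"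
    using a t by (simp add: power2_eq_square square_diff_square_factored abs_mult)
  moreover have "a0 * \<bar>t - a\<bar> \<le> \<bar>t - a\<bar> * (t + a)"
    using a t mult_left_mono[of a0 "t + a" "\<bar>t - a\<bar>"] by (simp add: mult.commute)
  ultimately have le: "sqrt a0 * sqrt \<bar>t - a\<bar> \<le> sqrt \<bar>t\<^sup>2 - a\<^sup>2\<bar>"
    by (simp add: real_sqrt_mult[symmetric])
  have pos: "sqrt a0 > 0" "sqrt \<bar>t - a\<bar> > 0" using a t by auto
  have "1 / sqrt \<bar>t\<^sup>2 - a\<^sup>2\<bar> \<le> 1 / (sqrt a0 * sqrt \<bar>t - a\<bar>)"
    using le pos by (intro frac_le) auto
  then have 1: "1 / (1 + t\<^sup>2) * (1 / sqrt \<bar>t\<^sup>2 - a\<^sup>2\<bar>) \<le> 1 / (1 + t\<^sup>2) * (1 / (sqrt a0 * sqrt \<bar>t - a\<bar>))"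
    by (intro mult_left_mono) auto
  have T: "0 < 1 / (1 + t\<^sup>2)" "1 / (1 + t\<^sup>2) \<le> 1" by (auto simp: add_pos_nonneg)
  have 2: "1 / (1 + t\<^sup>2) * (1 / sqrt \<bar>t - a\<bar>) \<le> indicator {- 1<..<1} (t - a) * (1 / sqrt \<bar>t - a\<bar>) + 1 / (1 + t\<^sup>2)"
  proof (cases "t - a \<in> {- 1<..<1}")
    case True
    have "1 / (1 + t\<^sup>2) * (1 / sqrt \<bar>t - a\<bar>) \<le> 1 * (1 / sqrt \<bar>t - a\<bar>)"
      using T(2) by (rule mult_right_mono) simp
    moreover have 1: "indicator {- 1<..<1} (t - a) = (1 :: real)" using True by simp
    ultimately show ?thesis unfolding 1 using T(1) by linarith
  next
    case False
    then have "1 \<le> \<bar>t - a\<bar>" by auto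
    then have "1 / sqrt \<bar>t - a\<bar> \<le> 1" by simp
    then have "1 / (1 + t\<^sup>2) * (1 / sqrt \<bar>t - a\<bar>) \<le> 1 / (1 + t\<^sup>2) * 1"
      using T(1) by (intro mult_left_mono) auto
    with False show ?thesis by simp
  qed
  have "1 / (1 + t\<^sup>2) * (1 / (sqrt a0 * sqrt \<bar>t - a\<bar>)) = 1 / sqrt a0 * (1 / (1 + t\<^sup>2) * (1 / sqrt \<bar>t - a\<bar>))"
    by simp
  also have "\<dots> \<le> 1 / sqrt a0 * (indicator {- 1<..<1} (t - a) * (1 / sqrt \<bar>t - a\<bar>) + 1 / (1 + t\<^sup>2))"
    using 2 pos by (intro mult_left_mono) auto
  also have "\<dots> = dom_kernel a0 a t" using t by (simp add: dom_kernel_def)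
  finally show ?thesis using 1 by linarith
qed

text \<open>The shifts form a sequence, since dominated convergence is applied to sequences.\<close>

definition eps :: "nat \<Rightarrow> real" where "eps n = 1 / real (Suc n)"

lemma eps_pos: "eps n > 0" by (simp add: eps_def)

lemma eps_tendsto: "eps \<longlonglongrightarrow> 0"
  unfolding eps_def[abs_def] by (rule LIMSEQ_Suc[OF lim_1_over_n])

definition zet :: "real \<Rightarrow> nat \<Rightarrow> complex" where
  "zet a n = of_real (a\<^sup>2) + \<i> * of_real (eps n)"

lemma Im_zet: "Im (zet a n) \<noteq> 0"
  using eps_pos[of n] by (simp add: zet_def)

lemma rt_zet_bound:
  assumes "t\<^sup>2 \<noteq> a\<^sup>2"
  shows "\<bar>Re (1 / rt (zet a n) t)\<bar> \<le> 1 / sqrt \<bar>t\<^sup>2 - a\<^sup>2\<bar>"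
proof -
  have "\<bar>t\<^sup>2 - a\<^sup>2\<bar> \<le> cmod (of_real (t\<^sup>2) - zet a n)"
    using abs_Re_le_cmod[of "of_real (t\<^sup>2) - zet a n"] by (simp add: zet_def)
  then have "sqrt \<bar>t\<^sup>2 - a\<^sup>2\<bar> \<le> cmod (rt (zet a n) t)" unfolding norm_rt by simp
  then have "1 / cmod (rt (zet a n) t) \<le> 1 / sqrt \<bar>t\<^sup>2 - a\<^sup>2\<bar>"
    using assms rt_nonzero[OF Im_zet, of a n t] by (intro divide_left_mono) auto
  then show ?thesis
    using abs_Re_le_cmod[of "1 / rt (zet a n) t"] by (simp only: norm_divide norm_one)
qed

text \<open>For \<open>t < a\<close> the square of \<open>1 / rt (zet a n) t\<close> tends to a
  negative real number, so its real part tends to 0 by \<open>Re_sq_eq\<close>. The smoothed weight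
  on \<open>t > 0\<close> thus turns into the singular weight on \<open>t > a\<close>.\<close>

lemma rt_zet_tendsto:
  assumes a: "a > 0" and t: "t > 0" "t \<noteq> a"
  shows "(\<lambda>n. Re (1 / rt (zet a n) t)) \<longlonglongrightarrow> (if t > a then 1 / sqrt (t\<^sup>2 - a\<^sup>2) else 0)"
proof -
  have "zet a \<longlonglongrightarrow> of_real (a\<^sup>2) + \<i> * of_real 0"
    unfolding zet_def[abs_def] by (intro tendsto_intros eps_tendsto)
  then have w: "(\<lambda>n. of_real (t\<^sup>2) - zet a n) \<longlonglongrightarrow> of_real (t\<^sup>2 - a\<^sup>2)"
    using tendsto_diff[OF tendsto_const, of "zet a" _ sequentially "of_real (t\<^sup>2)"] by simp
  show ?thesis
  proof (cases "t > a")
    case True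
    then have p: "t\<^sup>2 - a\<^sup>2 > 0" using a by (simp add: power_strict_mono)
    then have "isCont csqrt (of_real (t\<^sup>2 - a\<^sup>2))"
      by (intro continuous_at_csqrt) (auto simp: complex_nonpos_Reals_iff simp del: of_real_diff)
    from isCont_tendsto_compose[OF this w]
    have "(\<lambda>n. rt (zet a n) t) \<longlonglongrightarrow> csqrt (of_real (t\<^sup>2 - a\<^sup>2))" unfolding rt_def .
    also have "csqrt (of_real (t\<^sup>2 - a\<^sup>2)) = of_real (sqrt (t\<^sup>2 - a\<^sup>2))"
      by (rule csqrt_of_real) (use p in simp)
    finally have "(\<lambda>n. Re (1 / rt (zet a n) t)) \<longlonglongrightarrow> Re (1 / of_real (sqrt (t\<^sup>2 - a\<^sup>2)))"
      by (intro tendsto_Re tendsto_divide tendsto_const) (use p in auto)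
    also have "Re (1 / of_real (sqrt (t\<^sup>2 - a\<^sup>2))) = 1 / sqrt (t\<^sup>2 - a\<^sup>2)" by (simp add: Re_divide_of_real)
    finally show ?thesis using True by simp
  next
    case False
    then have "t < a" using t by simp
    then have p: "t\<^sup>2 - a\<^sup>2 < 0" using t by (simp add: power_strict_mono)
    have X: "(1 / rt (zet a n) t)\<^sup>2 = 1 / (of_real (t\<^sup>2) - zet a n)" for n
      by (simp add: power_divide rt_sq)
    have lim: "(\<lambda>n. 1 / (of_real (t\<^sup>2) - zet a n)) \<longlonglongrightarrow> 1 / of_real (t\<^sup>2 - a\<^sup>2)"
      by (intro tendsto_divide tendsto_const w) (use p in \<open>simp del: of_real_diff\<close>)
    have "(\<lambda>n. (cmod (1 / (of_real (t\<^sup>2) - zet a n)) + Re (1 / (of_real (t\<^sup>2) - zet a n))) / 2)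
        \<longlonglongrightarrow> (cmod (1 / of_real (t\<^sup>2 - a\<^sup>2)) + Re (1 / of_real (t\<^sup>2 - a\<^sup>2))) / 2"
      by (intro tendsto_intros lim) auto
    moreover have "(cmod (1 / of_real (t\<^sup>2 - a\<^sup>2)) + Re (1 / of_real (t\<^sup>2 - a\<^sup>2))) / 2 = 0"
    proof -
      have "1 / complex_of_real (t\<^sup>2 - a\<^sup>2) = of_real (1 / (t\<^sup>2 - a\<^sup>2))" by simp
      moreover have "1 / (t\<^sup>2 - a\<^sup>2) < 0" using p by simp
      ultimately show ?thesis by (simp only: norm_of_real Re_complex_of_real abs_of_neg) simp
    qed
    ultimately have "(\<lambda>n. (Re (1 / rt (zet a n) t))\<^sup>2) \<longlonglongrightarrow> 0"
      unfolding Re_sq_eq X by simp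
    then have "(\<lambda>n. \<bar>Re (1 / rt (zet a n) t)\<bar>) \<longlonglongrightarrow> 0"
      using tendsto_real_sqrt[of "\<lambda>n. (Re (1 / rt (zet a n) t))\<^sup>2" 0] by (simp only: real_sqrt_abs real_sqrt_zero)
    then show ?thesis using False by (simp only: tendsto_rabs_zero_iff if_False)
  qed
qed

text \<open>The bound in the third claim depends on \<open>a\<close> through \<open>a0\<close>
  alone; it provides the dominating constant for the integral over the boundary angle.\<close>

lemma singular_weight_limit:
  fixes k :: "real \<Rightarrow> real"
  assumes c: "continuous_on UNIV k" and b: "\<And>t. t \<ge> 0 \<Longrightarrow> \<bar>k t\<bar> \<le> C / (1 + t\<^sup>2)" and a: "0 < a0" "a0 \<le> a"
  shows "set_integrable lborel {a<..} (\<lambda>t. k t / sqrt (t\<^sup>2 - a\<^sup>2))"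
    and "(\<lambda>n. LINT t:{0<..}|lborel. k t * Re (1 / rt (zet a n) t)) \<longlonglongrightarrow> (LINT t:{a<..}|lborel. k t / sqrt (t\<^sup>2 - a\<^sup>2))"
    and "\<bar>LINT t:{0<..}|lborel. k t * Re (1 / rt (zet a n) t)\<bar> \<le> C * dom_const a0"
proof -
  have C: "C \<ge> 0" using b[of 0] by simp
  have ap: "a > 0" using a by simp
  let ?s = "\<lambda>n t. indicator {0<..} t *\<^sub>R (k t * Re (1 / rt (zet a n) t))"
  let ?l = "\<lambda>t. indicator {a<..} t *\<^sub>R (k t / sqrt (t\<^sup>2 - a\<^sup>2))"
  let ?w = "\<lambda>t. C * dom_kernel a0 a t"
  have km [measurable]: "k \<in> borel_measurable borel" by (rule borel_measurable_continuous_onI[OF c])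
  have rtm: "(\<lambda>t. Re (1 / rt (zet a n) t)) \<in> borel_measurable borel" for n
    by (intro borel_measurable_continuous_onI continuous_intros Im_zet) (auto simp: rt_nonzero[OF Im_zet])
  note rtm [measurable]
  have sm: "?s n \<in> borel_measurable lborel" for n by measurable
  have lm: "?l \<in> borel_measurable lborel" by measurable
  have w: "integrable lborel ?w" by (intro Bochner_Integration.integrable_mult_right dom_kernel_integral)
  have ae: "AE t in lborel. t \<noteq> a" by (rule AE_lborel_singleton)
  have lim: "AE t in lborel. (\<lambda>n. ?s n t) \<longlonglongrightarrow> ?l t"
    using ae
  proof eventually_elim
    case (elim t)
    show ?case
    proof (cases "t > 0")
      case True
      have "(\<lambda>n. k t * Re (1 / rt (zet a n) t)) \<longlonglongrightarrow> k t * (if t > a then 1 / sqrt (t\<^sup>2 - a\<^sup>2) else 0)"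
        by (intro tendsto_mult tendsto_const rt_zet_tendsto ap True elim)
      moreover have "?l t = k t * (if t > a then 1 / sqrt (t\<^sup>2 - a\<^sup>2) else 0)" by simp
      ultimately show ?thesis using True by simp
    next
      case False
      then show ?thesis using ap by simp
    qed
  qed
  have bound: "AE t in lborel. norm (?s n t) \<le> ?w t" for n
    using ae
  proof eventually_elim
    case (elim t)
    show ?case
    proof (cases "t > 0")
      case True
      have ne: "t\<^sup>2 \<noteq> a\<^sup>2" using True ap elim by (simp add: power2_eq_iff)
      have "norm (?s n t) = \<bar>k t\<bar> * \<bar>Re (1 / rt (zet a n) t)\<bar>" using True by (simp add: abs_mult)
      also have "\<dots> \<le> C / (1 + t\<^sup>2) * (1 / sqrt \<bar>t\<^sup>2 - a\<^sup>2\<bar>)"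
        using True C by (intro mult_mono b rt_zet_bound ne) (auto intro!: divide_nonneg_nonneg)
      also have "\<dots> = C * (1 / (1 + t\<^sup>2) * (1 / sqrt \<bar>t\<^sup>2 - a\<^sup>2\<bar>))" by simp
      also have "\<dots> \<le> ?w t"
        by (intro mult_left_mono C dom_kernel_bound a True elim)
      finally show ?thesis .
    next
      case False
      then show ?thesis using C a by (simp add: dom_kernel_def)
    qed
  qed
  note dc = integral_dominated_convergence[OF lm sm w lim bound]
  have "integrable lborel ?l" by (rule integrable_dominated_convergence[OF lm sm w lim bound])
  then show "set_integrable lborel {a<..} (\<lambda>t. k t / sqrt (t\<^sup>2 - a\<^sup>2))" by (simp add: set_integrable_def)
  show "(\<lambda>n. LINT t:{0<..}|lborel. k t * Re (1 / rt (zet a n) t)) \<longlonglongrightarrow> (LINT t:{a<..}|lborel. k t / sqrt (t\<^sup>2 - a\<^sup>2))"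
    unfolding set_lebesgue_integral_def by (rule dc)
  have "norm (integral\<^sup>L lborel (?s n)) \<le> integral\<^sup>L lborel ?w"
  proof -
    have si: "integrable lborel (?s n)"
      by (rule Bochner_Integration.integrable_bound[OF w sm]) (use bound[of n] in \<open>eventually_elim, simp\<close>)
    have "norm (integral\<^sup>L lborel (?s n)) \<le> (\<integral>t. norm (?s n t) \<partial>lborel)" by (rule integral_norm_bound)
    also have "\<dots> \<le> integral\<^sup>L lborel ?w"
      by (rule integral_mono_AE[OF integrable_norm[OF si] w bound])
    finally show ?thesis .
  qed
  then show "\<bar>LINT t:{0<..}|lborel. k t * Re (1 / rt (zet a n) t)\<bar> \<le> C * dom_const a0"
    unfolding set_lebesgue_integral_def by (simp add: dom_kernel_integral)
qed

section \<open>The boundary integral\<close>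

locale ellipse_data = ellipse_param c A for c A +
  fixes f f1 f2 f11 f12 f21 f22 :: "real^2 \<Rightarrow> real" and x :: "real^2"
  assumes f: "has_partials2 f f1 f2" and f1: "has_partials2 f1 f11 f12" and f2: "has_partials2 f2 f21 f22"
    and cont: "continuous_on UNIV f11" "continuous_on UNIV f12" "continuous_on UNIV f21" "continuous_on UNIV f22"
    and supp: "\<And>z. z \<notin> E \<Longrightarrow> f z = 0 \<and> f1 z = 0 \<and> f2 z = 0 \<and> f11 z = 0 \<and> f12 z = 0 \<and> f21 z = 0 \<and> f22 z = 0"
    and x: "x \<in> E"
begin

lemma cf: "continuous_on UNIV f" "continuous_on UNIV f1" "continuous_on UNIV f2"
  using f f1 f2 has_partials2_continuous by blast+

lemma E_bounded: obtains R0 where "R0 > 0" "\<And>z. z \<in> E \<Longrightarrow> norm z \<le> R0"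
proof -
  have "bounded ((\<lambda>\<xi>. c + A *v \<xi>) ` cball 0 1)"
    by (intro compact_imp_bounded compact_continuous_image continuous_intros
        linear_continuous_on matrix_vector_mul_bounded_linear) auto
  then have "bounded E" by (rule bounded_subset) (auto simp: E_def)
  then obtain R where "\<forall>z\<in>E. norm z \<le> R" by (auto simp: bounded_iff)
  then show ?thesis by (intro that[of "max 1 R"]) auto
qed

lemma matvec_bound: obtains K where "K > 0" "\<And>v. norm (A *v v) \<le> K * norm v"
  using bounded_linear.pos_bounded[OF matrix_vector_mul_bounded_linear[of A]] by (auto simp: mult.commute)

lemma y_bounded: obtains R1 where "\<And>\<theta>. norm (y \<theta>) \<le> R1"
proof -
  obtain K where K: "K > 0" "\<And>v. norm (A *v v) \<le> K * norm v" using matvec_bound by blast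
  have "norm (y \<theta>) \<le> norm c + K" for \<theta>
    using norm_triangle_ineq[of c "A *v dir \<theta>"] K(2)[of "dir \<theta>"] by (simp add: y_def)
  then show ?thesis by (rule that)
qed

text \<open>This positive distance is the \<open>a0\<close> of \<open>dom_kernel\<close>.\<close>

lemma dist_frontier: obtains a0 where "a0 > 0" "\<And>\<theta>. a0 \<le> norm (x - y \<theta>)"
proof -
  obtain e where e: "e > 0" "ball x e \<subseteq> E" using E_open x by (auto simp: open_contains_ball)
  have "y \<theta> \<notin> E" for \<theta>
    using y_in_frontier[of \<theta>] E_open by (simp add: frontier_def interior_open)
  then have "e \<le> norm (x - y \<theta>)" for \<theta>
    using e(2) by (metis dist_norm mem_ball not_less subsetD)
  with e(1) show ?thesis by (rule that)
qed

text \<open>\<open>kd1\<close> and \<open>kd2\<close> are the spatial partials of the wave.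
  \<open>n \<theta>\<close> is the outward unit normal times the speed of \<open>y\<close>, so
  \<open>J\<close> is the integrand of the boundary integral in the angle. \<open>W\<close> and
  \<open>Q\<close> are the smoothed counterparts of \<open>T\<close> and \<open>J\<close>.\<close>

definition "kd1 z t = sph_mean' f1 f11 f12 z t"
definition "kd2 z t = sph_mean' f2 f21 f22 z t"
definition "n \<theta> = \<bar>det A\<bar> *\<^sub>R (S *v dir \<theta>)"
definition "T k z = (LINT t:{norm (x - z)<..}|lborel. k z t / sqrt (t\<^sup>2 - (norm (x - z))\<^sup>2))"
definition "J \<theta> = n \<theta> $ 1 * T kd1 (y \<theta>) + n \<theta> $ 2 * T kd2 (y \<theta>)"
definition "W k m z = (LINT t:{0<..}|lborel. k z t * Re (1 / rt (zet (norm (x - z)) m) t))"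
definition "Q m \<theta> = n \<theta> $ 1 * W kd1 m (y \<theta>) + n \<theta> $ 2 * W kd2 m (y \<theta>)"
definition "ker m \<theta> z = Re (1 / (of_real ((norm (z - y \<theta>))\<^sup>2 - (norm (x - y \<theta>))\<^sup>2) - \<i> * of_real (eps m)))"
definition "gr \<theta> z = n \<theta> $ 1 * f1 z + n \<theta> $ 2 * f2 z"

lemma n_continuous: "continuous_on X n"
  unfolding n_def[abs_def] by (intro continuous_intros linear_continuous_on_compose[OF _ matrix_vector_mul_linear])

lemma kd_continuous: "continuous_on UNIV (\<lambda>(z, t). kd1 z t)" "continuous_on UNIV (\<lambda>(z, t). kd2 z t)"
  unfolding kd1_def kd2_def by (rule sph_mean'_continuous cf cont)+

lemma kd_continuous_t: "continuous_on UNIV (kd1 z)" "continuous_on UNIV (kd2 z)"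
proof -
  have p: "continuous_on UNIV (\<lambda>t. (z, t :: real))" by (intro continuous_intros)
  show "continuous_on UNIV (kd1 z)" using continuous_on_comp_UNIV[OF kd_continuous(1) p] by simp
  show "continuous_on UNIV (kd2 z)" using continuous_on_comp_UNIV[OF kd_continuous(2) p] by simp
qed

lemma kd_decay:
  obtains C where "\<And>\<theta> t. t \<ge> 0 \<Longrightarrow> \<bar>kd1 (y \<theta>) t\<bar> \<le> C / (1 + t\<^sup>2)" "\<And>\<theta> t. t \<ge> 0 \<Longrightarrow> \<bar>kd2 (y \<theta>) t\<bar> \<le> C / (1 + t\<^sup>2)"
proof -
  obtain R0 where R0: "\<And>z. z \<in> E \<Longrightarrow> norm z \<le> R0" using E_bounded by blast
  obtain R1 where R1: "\<And>\<theta>. norm (y \<theta>) \<le> R1" using y_bounded by blast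
  have out: "z \<notin> E" if "norm z > R0" for z using R0[of z] that by auto
  obtain C1 where C1: "\<And>y t. norm y \<le> R1 \<Longrightarrow> t \<ge> 0 \<Longrightarrow> \<bar>sph_mean' f1 f11 f12 y t\<bar> \<le> C1 / (1 + t\<^sup>2)"
    by (rule sph_mean'_decay[OF cf(2) cont(1,2), of R0 R1]) (use supp out in blast)+
  obtain C2 where C2: "\<And>y t. norm y \<le> R1 \<Longrightarrow> t \<ge> 0 \<Longrightarrow> \<bar>sph_mean' f2 f21 f22 y t\<bar> \<le> C2 / (1 + t\<^sup>2)"
    by (rule sph_mean'_decay[OF cf(3) cont(3,4), of R0 R1]) (use supp out in blast)+
  have le: "K / (1 + t\<^sup>2) \<le> max C1 C2 / (1 + t\<^sup>2)" if "K = C1 \<or> K = C2" for K t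
    using that by (intro divide_right_mono) (auto simp: add_nonneg_nonneg)
  show ?thesis
  proof (rule that[of "max C1 C2"])
    fix \<theta> and t :: real assume t: "t \<ge> 0"
    show "\<bar>kd1 (y \<theta>) t\<bar> \<le> max C1 C2 / (1 + t\<^sup>2)"
      unfolding kd1_def using C1[OF R1 t, of \<theta>] le[of C1 t] by linarith
    show "\<bar>kd2 (y \<theta>) t\<bar> \<le> max C1 C2 / (1 + t\<^sup>2)"
      unfolding kd2_def using C2[OF R1 t, of \<theta>] le[of C2 t] by linarith
  qed
qed

lemma T_integrable:
  "set_integrable lborel {norm (x - y \<theta>)<..} (\<lambda>t. kd1 (y \<theta>) t / sqrt (t\<^sup>2 - (norm (x - y \<theta>))\<^sup>2))"
  "set_integrable lborel {norm (x - y \<theta>)<..} (\<lambda>t. kd2 (y \<theta>) t / sqrt (t\<^sup>2 - (norm (x - y \<theta>))\<^sup>2))"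
proof -
  obtain C where C: "\<And>\<theta> t. t \<ge> 0 \<Longrightarrow> \<bar>kd1 (y \<theta>) t\<bar> \<le> C / (1 + t\<^sup>2)" "\<And>\<theta> t. t \<ge> 0 \<Longrightarrow> \<bar>kd2 (y \<theta>) t\<bar> \<le> C / (1 + t\<^sup>2)"
    using kd_decay by blast
  obtain a0 where a0: "a0 > 0" "\<And>\<theta>. a0 \<le> norm (x - y \<theta>)" using dist_frontier by blast
  show "set_integrable lborel {norm (x - y \<theta>)<..} (\<lambda>t. kd1 (y \<theta>) t / sqrt (t\<^sup>2 - (norm (x - y \<theta>))\<^sup>2))"
    by (rule singular_weight_limit(1)[OF kd_continuous_t(1) C(1) a0])
  show "set_integrable lborel {norm (x - y \<theta>)<..} (\<lambda>t. kd2 (y \<theta>) t / sqrt (t\<^sup>2 - (norm (x - y \<theta>))\<^sup>2))"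
    by (rule singular_weight_limit(1)[OF kd_continuous_t(2) C(2) a0])
qed

lemma Q_limit: "(\<lambda>m. Q m \<theta>) \<longlonglongrightarrow> J \<theta>"
  and Q_bound: "\<exists>K. \<forall>m \<theta>. \<bar>Q m \<theta>\<bar> \<le> K"
proof -
  obtain C where C: "\<And>\<theta> t. t \<ge> 0 \<Longrightarrow> \<bar>kd1 (y \<theta>) t\<bar> \<le> C / (1 + t\<^sup>2)" "\<And>\<theta> t. t \<ge> 0 \<Longrightarrow> \<bar>kd2 (y \<theta>) t\<bar> \<le> C / (1 + t\<^sup>2)"
    using kd_decay by blast
  obtain a0 where a0: "a0 > 0" "\<And>\<theta>. a0 \<le> norm (x - y \<theta>)" using dist_frontier by blast
  note s1 = singular_weight_limit[OF kd_continuous_t(1) C(1) a0]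
  note s2 = singular_weight_limit[OF kd_continuous_t(2) C(2) a0]
  show "(\<lambda>m. Q m \<theta>) \<longlonglongrightarrow> J \<theta>"
    unfolding Q_def J_def W_def T_def by (intro tendsto_intros s1(2) s2(2))
  define D where "D = C * dom_const a0"
  have W1: "\<bar>W kd1 m (y \<theta>)\<bar> \<le> D" for m \<theta>
    unfolding W_def D_def by (rule s1(3))
  have W2: "\<bar>W kd2 m (y \<theta>)\<bar> \<le> D" for m \<theta>
    unfolding W_def D_def by (rule s2(3))
  note WD = W1 W2
  have "bounded (n ` {0..2*pi})"
    by (intro compact_imp_bounded compact_continuous_image n_continuous) auto
  obtain K where K: "\<And>v. norm (S *v v) \<le> norm v * K"
    using bounded_linear.bounded[OF matrix_vector_mul_bounded_linear[of S]] by blast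
  have nb: "\<bar>n \<theta> $ i\<bar> \<le> \<bar>det A\<bar> * K" for \<theta> i
  proof -
    have "\<bar>n \<theta> $ i\<bar> \<le> norm (n \<theta>)" by (rule component_le_norm_cart)
    also have "\<dots> = \<bar>det A\<bar> * norm (S *v dir \<theta>)" by (simp add: n_def)
    also have "\<dots> \<le> \<bar>det A\<bar> * K" using K[of "dir \<theta>"] by (intro mult_left_mono) auto
    finally show ?thesis .
  qed
  have "\<bar>Q m \<theta>\<bar> \<le> \<bar>det A\<bar> * K * D + \<bar>det A\<bar> * K * D" for m \<theta>
  proof -
    have "\<bar>n \<theta> $ 1 * W kd1 m (y \<theta>)\<bar> \<le> \<bar>det A\<bar> * K * D"
      unfolding abs_mult[of "n \<theta> $ 1"] by (intro mult_mono nb WD order_trans[OF abs_ge_zero nb] abs_ge_zero)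
    moreover have "\<bar>n \<theta> $ 2 * W kd2 m (y \<theta>)\<bar> \<le> \<bar>det A\<bar> * K * D"
      unfolding abs_mult[of "n \<theta> $ 2"] by (intro mult_mono nb WD order_trans[OF abs_ge_zero nb] abs_ge_zero)
    ultimately show ?thesis unfolding Q_def by linarith
  qed
  then show "\<exists>K. \<forall>m \<theta>. \<bar>Q m \<theta>\<bar> \<le> K" by blast
qed

lemma ker_denominator: "of_real r - \<i> * of_real (eps m) \<noteq> (0 :: complex)"
  using eps_pos[of m] by (auto simp: complex_eq_iff)

lemma ker_continuous: "continuous_on X (\<lambda>p. ker m (fst p) (snd p))"
  unfolding ker_def by (intro continuous_intros continuous_on_compose2[OF y_continuous[of UNIV]])
    (use ker_denominator in auto)

lemma ker_continuous_z: "continuous_on X (ker m \<theta>)"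
  unfolding ker_def by (intro continuous_intros) (use ker_denominator in auto)

lemma gr_continuous: "continuous_on X (\<lambda>p. gr (fst p) (snd p))"
  unfolding gr_def by (intro continuous_intros continuous_on_compose2[OF n_continuous[of UNIV]]
      continuous_on_comp_UNIV[OF cf(2)] continuous_on_comp_UNIV[OF cf(3)]) auto

lemma Q_eq: "2 * pi * Q m \<theta> = (\<integral>z. gr \<theta> z * ker m \<theta> z \<partial>lborel)"
proof -
  obtain R0 where R0: "\<And>z. z \<in> E \<Longrightarrow> norm z \<le> R0" using E_bounded by blast
  have out: "z \<notin> E" if "norm z > R0" for z using R0[of z] that by auto
  let ?a = "norm (x - y \<theta>)"
  have keq: "Re (1 / (of_real ((norm (z - y \<theta>))\<^sup>2) - zet ?a m)) = ker m \<theta> z" for z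
    by (simp add: ker_def zet_def diff_diff_eq)
  have W: "W (sph_mean' g g1 g2) m (y \<theta>) = (\<integral>z. g z * ker m \<theta> z \<partial>lborel) / (2 * pi)"
    if g: "has_partials2 g g1 g2" "continuous_on UNIV g1" "continuous_on UNIV g2"
      and z: "\<And>z. norm z > R0 \<Longrightarrow> g z = 0 \<and> g1 z = 0 \<and> g2 z = 0" for g g1 g2
  proof -
    note wt = weighted_time_integral[OF Im_zet[of ?a m] g z, where y = "y \<theta>"]
    have "W (sph_mean' g g1 g2) m (y \<theta>)
        = (LINT t:{0<..}|lborel. Re (of_real (sph_mean' g g1 g2 (y \<theta>) t) / rt (zet ?a m) t))"
    proof -
      have "Re (of_real p / q) = p * Re (1 / q)" for p and q :: complex
      proof -
        have "of_real p / q = of_real p * (1 / q)" by simp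
        then show ?thesis by (simp only: Re_complex_of_real Im_complex_of_real times_complex.sel diff_zero mult_zero_left)
      qed
      then show ?thesis by (simp only: W_def)
    qed
    also have "\<dots> = Re (LINT t:{0<..}|lborel. of_real (sph_mean' g g1 g2 (y \<theta>) t) / rt (zet ?a m) t)"
      using wt(1) unfolding set_lebesgue_integral_def set_integrable_def by (subst integral_Re[symmetric]) auto
    also have "\<dots> = (\<integral>z. g z * ker m \<theta> z \<partial>lborel) / (2 * pi)"
      using wt(2) unfolding keq .
    finally show ?thesis .
  qed
  have W1: "W kd1 m (y \<theta>) = (\<integral>z. f1 z * ker m \<theta> z \<partial>lborel) / (2 * pi)"
    using W[OF f1 cont(1,2)] supp out unfolding kd1_def[abs_def] by blast
  have W2: "W kd2 m (y \<theta>) = (\<integral>z. f2 z * ker m \<theta> z \<partial>lborel) / (2 * pi)"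
    using W[OF f2 cont(3,4)] supp out unfolding kd2_def[abs_def] by blast
  have i: "integrable lborel (\<lambda>z. f1 z * ker m \<theta> z)" "integrable lborel (\<lambda>z. f2 z * ker m \<theta> z)"
    using supp out by (auto intro!: integrable_compact_support[of _ R0] continuous_intros cf ker_continuous_z)
  have "(\<integral>z. gr \<theta> z * ker m \<theta> z \<partial>lborel) = (\<integral>z. n \<theta> $ 1 * (f1 z * ker m \<theta> z) + n \<theta> $ 2 * (f2 z * ker m \<theta> z) \<partial>lborel)"
    by (simp add: gr_def algebra_simps)
  also have "\<dots> = n \<theta> $ 1 * (\<integral>z. f1 z * ker m \<theta> z \<partial>lborel) + n \<theta> $ 2 * (\<integral>z. f2 z * ker m \<theta> z \<partial>lborel)"
    using i by simp
  also have "\<dots> = 2 * pi * Q m \<theta>" unfolding Q_def W1 W2 by (simp add: field_simps)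
  finally show ?thesis ..
qed

definition "\<Phi> m \<theta> z = indicator {0..2*pi} \<theta> * (gr \<theta> z * ker m \<theta> z)"

lemma \<Phi>_integrable: "integrable (lborel \<Otimes>\<^sub>M lborel) (\<lambda>(\<theta>, z). \<Phi> m \<theta> z)"
proof -
  obtain R0 where R0: "\<And>z. z \<in> E \<Longrightarrow> norm z \<le> R0" using E_bounded by blast
  let ?F = "\<lambda>p. gr (fst p) (snd p) * ker m (fst p) (snd p)"
  have "integrable lborel (\<lambda>p. indicator ({0..2*pi} \<times> cball 0 R0) p *\<^sub>R ?F p)"
    by (rule borel_integrable_compact) (auto intro!: compact_Times continuous_intros gr_continuous ker_continuous)
  moreover have "(\<lambda>p. indicator ({0..2*pi} \<times> cball 0 R0) p *\<^sub>R ?F p) = (\<lambda>(\<theta>, z). \<Phi> m \<theta> z)"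
  proof
    fix p :: "real \<times> (real^2)"
    obtain \<theta> z where p: "p = (\<theta>, z)" by (cases p)
    have "gr \<theta> z = 0" if "z \<notin> cball 0 R0"
    proof -
      have "z \<notin> E" using R0[of z] that by auto
      from supp[OF this] show ?thesis by (simp add: gr_def)
    qed
    then show "indicator ({0..2*pi} \<times> cball 0 R0) p *\<^sub>R ?F p = (case p of (\<theta>, z) \<Rightarrow> \<Phi> m \<theta> z)"
      unfolding p \<Phi>_def by (cases "z \<in> cball 0 R0") (auto simp: indicator_def)
  qed
  ultimately show ?thesis by (simp add: lborel_prod)
qed

definition "H m z = (\<integral>\<theta>. \<Phi> m \<theta> z \<partial>lborel)"

lemma H_integrable: "integrable lborel (H m)"
  unfolding H_def[abs_def] by (rule lborel_pair.integrable_snd[OF \<Phi>_integrable])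

lemma Q_integral:
  "integrable lborel (\<lambda>\<theta>. indicator {0..2*pi} \<theta> * Q m \<theta>)"
  "2 * pi * (\<integral>\<theta>. indicator {0..2*pi} \<theta> * Q m \<theta> \<partial>lborel) = integral\<^sup>L lborel (H m)"
proof -
  have inner: "(\<integral>z. \<Phi> m \<theta> z \<partial>lborel) = 2 * pi * (indicator {0..2*pi} \<theta> * Q m \<theta>)" for \<theta>
    unfolding \<Phi>_def using Q_eq[of m \<theta>] by simp
  have "integrable lborel (\<lambda>\<theta>. 2 * pi * (indicator {0..2*pi} \<theta> * Q m \<theta>))"
    using lborel_pair.integrable_fst[OF \<Phi>_integrable[of m]] unfolding inner .
  then show "integrable lborel (\<lambda>\<theta>. indicator {0..2*pi} \<theta> * Q m \<theta>)" by simp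
  have "integral\<^sup>L lborel (H m) = (\<integral>\<theta>. (\<integral>z. \<Phi> m \<theta> z \<partial>lborel) \<partial>lborel)"
    unfolding H_def by (rule lborel_pair.Fubini_integral[OF \<Phi>_integrable])
  then show "2 * pi * (\<integral>\<theta>. indicator {0..2*pi} \<theta> * Q m \<theta> \<partial>lborel) = integral\<^sup>L lborel (H m)"
    unfolding inner by simp
qed

end

section \<open>The boundary integral along the rays from \<open>x\<close>\<close>

lemma integral_periodic_shift:
  fixes g :: "real \<Rightarrow> real"
  assumes c: "continuous_on UNIV g" and per: "\<And>x. g (x + T) = g x" and T: "T > 0"
  shows "(\<integral>\<theta>. indicator {0..T} \<theta> * g \<theta> \<partial>lborel) = (\<integral>\<theta>. indicator {0..T} \<theta> * g (a + \<theta>) \<partial>lborel)"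
proof -
  define I where "I = (\<integral>\<theta>. indicator {0..T} \<theta> * g \<theta> \<partial>lborel)"
  have m: "g \<in> borel_measurable borel" by (rule borel_measurable_continuous_onI[OF c])
  have ca: "continuous_on UNIV (\<lambda>\<theta>. g (a + \<theta>))"
    by (rule continuous_on_compose2[OF c]) (auto intro!: continuous_intros)
  have ma: "(\<lambda>\<theta>. g (a + \<theta>)) \<in> borel_measurable borel" by (rule borel_measurable_continuous_onI[OF ca])
  have "integrable lborel (\<lambda>\<theta>. indicator {0..T} \<theta> * g \<theta>)"
    using borel_integrable_atLeastAtMost'[OF continuous_on_subset[OF c], of 0 T] by (simp add: set_integrable_def)
  then have "has_bochner_integral lborel (\<lambda>\<theta>. indicator {0..T} \<theta> * g \<theta>) I"
    unfolding I_def by (rule has_bochner_integral_integrable)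
  then have "has_bochner_integral lborel (\<lambda>\<theta>. indicator {0..<T} \<theta> * g \<theta>) I"
    unfolding has_bochner_integral_Icc_Ico[OF m] .
  from has_bochner_integral_periodic[OF this per T, of a]
  have "has_bochner_integral lborel (\<lambda>x. indicator {a..<a + T} (a + 1 * x) * g (a + 1 * x)) (I /\<^sub>R \<bar>1\<bar>)"
    by (subst lborel_has_bochner_integral_real_affine_iff[symmetric]) auto
  then have sh: "has_bochner_integral lborel (\<lambda>x. indicator {a..<a + T} (a + 1 * x) * g (a + 1 * x)) I" by simp
  have ind: "indicator {a..<a + T} (a + 1 * x) * g (a + 1 * x) = indicator {0..<T} x * g (a + x)" for x
    by (auto simp: indicator_def)
  have "has_bochner_integral lborel (\<lambda>\<theta>. indicator {0..<T} \<theta> * g (a + \<theta>)) I"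
    using sh unfolding ind by simp
  then have "has_bochner_integral lborel (\<lambda>\<theta>. indicator {0..T} \<theta> * g (a + \<theta>)) I"
    unfolding has_bochner_integral_Icc_Ico[OF ma] .
  then show ?thesis unfolding I_def by (simp add: has_bochner_integral_iff)
qed

text \<open>The integrand is odd under the reflection of \<open>\<theta>\<close> to
  \<open>2 * pi - \<theta>\<close>. This removes the derivative of \<open>f\<close> transverse to
  the ray.\<close>

lemma integral_sin_mult_cos_comp:
  "(\<integral>\<theta>. indicator {0..2*pi} \<theta> * (sin \<theta> * k (cos \<theta>)) \<partial>lborel) = (0 :: real)"
proof -
  let ?f = "\<lambda>\<theta>. indicator {0..2*pi} \<theta> * (sin \<theta> * k (cos \<theta>))"
  have eq: "?f (2 * pi + (- 1) * \<theta>) = - ?f \<theta>" for \<theta>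
    by (auto simp: indicator_def sin_diff cos_diff)
  have "(\<integral>\<theta>. ?f \<theta> \<partial>lborel) = (\<integral>\<theta>. ?f (2 * pi + (- 1) * \<theta>) \<partial>lborel)"
    using lborel_integral_real_affine[of "- 1" ?f "2 * pi"] by simp
  then show ?thesis unfolding eq by simp
qed

context ellipse_data
begin

definition "pt \<phi> r = x + r *\<^sub>R (S *v dir \<phi>)"
definition "D \<phi> r = (S *v dir \<phi>) $ 1 * f1 (pt \<phi> r) + (S *v dir \<phi>) $ 2 * f2 (pt \<phi> r)"
definition "\<alpha> \<phi> r = (norm (pt \<phi> r - c))\<^sup>2 - (norm (x - c))\<^sup>2"

text \<open>The quadratic terms in \<open>y \<theta>\<close> cancel, and the adjointness of
  \<open>A\<close> and \<open>S\<close> turns the linear term into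
  \<open>cos (\<theta> - \<phi>)\<close>; this dictates the direction \<open>S *v dir \<phi>\<close>
  of the rays.\<close>

lemma pt_dist:
  "(norm (pt \<phi> r - y \<theta>))\<^sup>2 - (norm (x - y \<theta>))\<^sup>2 = \<alpha> \<phi> r - 2 * r * cos (\<theta> - \<phi>)"
proof -
  have sq: "(norm (p - q))\<^sup>2 = (norm p)\<^sup>2 - 2 * (p \<bullet> q) + (norm q)\<^sup>2" for p q :: "real^2"
    by (simp add: power2_norm_eq_inner inner_diff_left inner_diff_right inner_commute)
  have e: "z - y \<theta> = (z - c) - A *v dir \<theta>" for z by (simp add: y_def)
  have "(pt \<phi> r - c) \<bullet> (A *v dir \<theta>) - (x - c) \<bullet> (A *v dir \<theta>) = r * ((A *v dir \<theta>) \<bullet> (S *v dir \<phi>))"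
    unfolding inner_diff_left[symmetric] by (simp add: pt_def inner_commute)
  also have "\<dots> = r * cos (\<theta> - \<phi>)"
    unfolding inner_inv_transpose2[OF det] by (simp add: inner_vec2 cos_diff)
  finally show ?thesis unfolding e sq \<alpha>_def by (simp add: algebra_simps)
qed

text \<open>In disc coordinates \<open>\<alpha>\<close> is
  \<open>r * (w \<bullet> dir \<phi>)\<close>, where \<open>w\<close> is the sum of the coordinates
  of the point and of \<open>x\<close>. The first summand has norm below 1 and the second is a fixed
  interior point, so \<open>\<alpha>\<close> stays below the amplitude
  \<open>2 * \<bar>r\<bar>\<close> by a fixed ratio.\<close>

lemma pt_bound: "pt \<phi> r \<in> E \<Longrightarrow> \<bar>\<alpha> \<phi> r\<bar> \<le> (1 + norm (B *v (x - c))) / 2 * (2 * \<bar>r\<bar>)"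
proof -
  assume "pt \<phi> r \<in> E"
  then have b: "norm (B *v (pt \<phi> r - c)) < 1" by (simp only: E_def image_ball_iff) simp
  define w where "w = B *v (pt \<phi> r - c) + B *v (x - c)"
  have "\<alpha> \<phi> r = ((pt \<phi> r - c) + (x - c)) \<bullet> (pt \<phi> r - x)"
    by (simp add: \<alpha>_def power2_norm_eq_inner inner_vec2 algebra_simps)
  also have "(pt \<phi> r - c) + (x - c) = A *v w"
    unfolding w_def matrix_vector_right_distrib A_B ..
  also have "pt \<phi> r - x = r *\<^sub>R (S *v dir \<phi>)" by (simp add: pt_def)
  finally have "\<alpha> \<phi> r = r * (w \<bullet> dir \<phi>)" using inner_inv_transpose2[OF det] by simp
  also have "\<bar>\<dots>\<bar> \<le> \<bar>r\<bar> * norm w"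
    using Cauchy_Schwarz_ineq2[of w "dir \<phi>"] by (simp add: abs_mult mult_left_mono)
  also have "\<dots> \<le> \<bar>r\<bar> * (1 + norm (B *v (x - c)))"
    using b norm_triangle_ineq[of "B *v (pt \<phi> r - c)" "B *v (x - c)"] by (intro mult_left_mono) (auto simp: w_def)
  finally show ?thesis by (simp add: mult.commute)
qed

lemma D_zero: "pt \<phi> r \<notin> E \<Longrightarrow> D \<phi> r = 0"
  using supp[of "pt \<phi> r"] by (simp add: D_def)

text \<open>Rotating the angle by \<open>\<phi>\<close> splits the normal into the ray direction,
  weighted by \<open>cos \<theta>\<close>, and a transverse one, weighted by
  \<open>sin \<theta>\<close>, against a kernel that depends on \<open>cos \<theta>\<close> alone.
  The transverse part integrates to 0.\<close>

lemma H_eq: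
  "H m (pt \<phi> r) = \<bar>det A\<bar> * (D \<phi> r * cos_kernel (\<alpha> \<phi> r) (2 * r) (eps m))"
proof -
  let ?z = "pt \<phi> r"
  define k where "k s = Re (1 / (of_real (\<alpha> \<phi> r - 2 * r * s) - \<i> * of_real (eps m)))" for s
  define b where "b = (S *v dir' \<phi>) $ 1 * f1 ?z + (S *v dir' \<phi>) $ 2 * f2 ?z"
  define g where "g \<theta> = gr \<theta> ?z * ker m \<theta> ?z" for \<theta>
  have ker: "ker m \<theta> ?z = k (cos (\<theta> - \<phi>))" for \<theta>
    unfolding ker_def k_def pt_dist ..
  have gr: "gr (\<phi> + \<theta>) ?z = \<bar>det A\<bar> * (cos \<theta> * D \<phi> r + sin \<theta> * b)" for \<theta>
  proof -
    have "dir (\<phi> + \<theta>) = cos \<theta> *\<^sub>R dir \<phi> + sin \<theta> *\<^sub>R dir' \<phi>"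
      by (simp add: vec2_eq_iff cos_add sin_add algebra_simps)
    then have "S *v dir (\<phi> + \<theta>) = cos \<theta> *\<^sub>R (S *v dir \<phi>) + sin \<theta> *\<^sub>R (S *v dir' \<phi>)"
      by (simp only: matrix_vector_right_distrib matrix_vector_mult_scaleR)
    then show ?thesis
      by (simp add: gr_def n_def D_def b_def algebra_simps del: matvec2_nth)
  qed
  have cg: "continuous_on UNIV g"
  proof -
    have p: "continuous_on UNIV (\<lambda>\<theta>::real. (\<theta>, ?z))" by (intro continuous_intros)
    show ?thesis unfolding g_def
      using continuous_on_compose2[OF gr_continuous[of UNIV] p] continuous_on_compose2[OF ker_continuous[of UNIV m] p]
      by (auto intro!: continuous_intros)
  qed
  have pg: "g (\<theta> + 2 * pi) = g \<theta>" for \<theta>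
    unfolding g_def gr_def ker_def y_periodic by (simp add: n_def dir_def)
  have ck: "continuous_on UNIV (\<lambda>\<theta>. k (cos \<theta>))"
    unfolding k_def by (intro continuous_intros) (use ker_denominator in auto)
  have i: "integrable lborel (\<lambda>\<theta>. indicator {0..2*pi} \<theta> * (h \<theta> * k (cos \<theta>)))"
    if "continuous_on UNIV h" for h :: "real \<Rightarrow> real"
    using borel_integrable_atLeastAtMost'[OF continuous_on_subset[OF continuous_on_mult[OF that ck]], of 0 "2 * pi"]
    by (simp add: set_integrable_def)
  have ic: "integrable lborel (\<lambda>\<theta>. indicator {0..2*pi} \<theta> * (cos \<theta> * k (cos \<theta>)))"
    and isn: "integrable lborel (\<lambda>\<theta>. indicator {0..2*pi} \<theta> * (sin \<theta> * k (cos \<theta>)))"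
    by (intro i continuous_intros)+
  have "H m ?z = (\<integral>\<theta>. indicator {0..2*pi} \<theta> * g \<theta> \<partial>lborel)"
    by (simp add: H_def \<Phi>_def g_def)
  also have "\<dots> = (\<integral>\<theta>. indicator {0..2*pi} \<theta> * g (\<phi> + \<theta>) \<partial>lborel)"
    by (rule integral_periodic_shift[OF cg pg]) simp
  also have "\<dots> = (\<integral>\<theta>. \<bar>det A\<bar> * (D \<phi> r * (indicator {0..2*pi} \<theta> * (cos \<theta> * k (cos \<theta>)))
      + b * (indicator {0..2*pi} \<theta> * (sin \<theta> * k (cos \<theta>)))) \<partial>lborel)"
    unfolding g_def gr ker by (intro Bochner_Integration.integral_cong) (simp_all add: algebra_simps)
  also have "\<dots> = \<bar>det A\<bar> * (D \<phi> r * (\<integral>\<theta>. indicator {0..2*pi} \<theta> * (cos \<theta> * k (cos \<theta>)) \<partial>lborel)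
      + b * (\<integral>\<theta>. indicator {0..2*pi} \<theta> * (sin \<theta> * k (cos \<theta>)) \<partial>lborel))"
    using ic isn by simp
  also have "(\<integral>\<theta>. indicator {0..2*pi} \<theta> * (cos \<theta> * k (cos \<theta>)) \<partial>lborel) = cos_kernel (\<alpha> \<phi> r) (2 * r) (eps m)"
    using set_borel_integral_eq_integral(2)[of "{0..2*pi}" "\<lambda>\<theta>. cos \<theta> * k (cos \<theta>)"] ic
    unfolding cos_kernel_def k_def by (simp add: set_integrable_def set_lebesgue_integral_def)
  finally show ?thesis unfolding integral_sin_mult_cos_comp by simp
qed

lemma pt_derivative: "((\<lambda>r. f (pt \<phi> r)) has_real_derivative D \<phi> r) (at r)"
proof -
  have "((\<lambda>r. x + r *\<^sub>R (S *v dir \<phi>)) has_vector_derivative S *v dir \<phi>) (at r)"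
    by (auto intro!: derivative_eq_intros)
  from has_partials2_comp[OF f this] show ?thesis unfolding pt_def D_def .
qed

lemma D_continuous: "continuous_on X (\<lambda>p. D (snd p) (fst p))"
proof -
  have s: "continuous_on X (\<lambda>p. S *v dir (snd p))" for X :: "(real \<times> real) set"
    unfolding dir_def by (intro continuous_intros linear_continuous_on_compose[OF _ matrix_vector_mul_linear])
  have p: "continuous_on X (\<lambda>p. pt (snd p) (fst p))"
    unfolding pt_def by (intro continuous_intros s)
  show ?thesis
    unfolding D_def by (intro continuous_intros s continuous_on_comp_UNIV[OF cf(2) p] continuous_on_comp_UNIV[OF cf(3) p])
qed

lemma pt_radius: obtains R2 where "R2 > 0" "\<And>\<phi> r. r > R2 \<Longrightarrow> pt \<phi> r \<notin> E"
proof -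
  obtain R0 where R0: "R0 > 0" "\<And>z. z \<in> E \<Longrightarrow> norm z \<le> R0" using E_bounded by blast
  obtain K where K: "K > 0" "\<And>v. norm (A *v v) \<le> K * norm v" using matvec_bound by blast
  have "r \<le> K * (2 * R0)" if "pt \<phi> r \<in> E" for \<phi> r
  proof -
    have "r = r * (dir \<phi> \<bullet> dir \<phi>)" using norm_dir[of \<phi>] unfolding norm_eq_1 by simp
    also have "\<dots> = (A *v dir \<phi>) \<bullet> (pt \<phi> r - x)"
      using inner_inv_transpose2[OF det, of "dir \<phi>" "dir \<phi>"] by (simp add: pt_def)
    also have "\<dots> \<le> norm (A *v dir \<phi>) * norm (pt \<phi> r - x)" by (rule norm_cauchy_schwarz)
    also have "\<dots> \<le> K * (2 * R0)"
    proof (rule mult_mono)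
      show "norm (A *v dir \<phi>) \<le> K" using K(2)[of "dir \<phi>"] by simp
      show "norm (pt \<phi> r - x) \<le> 2 * R0"
        using norm_triangle_ineq4[of "pt \<phi> r" x] R0(2)[OF that] R0(2)[OF x] by simp
    qed (use K in auto)
    finally show ?thesis .
  qed
  then have "pt \<phi> r \<notin> E" if "r > K * (2 * R0)" for \<phi> r using that by (metis linorder_not_less)
  then show ?thesis using that[of "K * (2 * R0)"] K R0 by simp
qed

text \<open>The derivative along the rays in polar coordinates, without the Jacobian: that factor is
  used up by the \<open>1 / r\<close> of the kernel.\<close>

definition "D0 = (\<lambda>(r, \<phi>). indicator ({0<..} \<times> {0<..<2*pi}) (r, \<phi>) * D \<phi> r)"

lemma D0_integrable: "integrable (lborel \<Otimes>\<^sub>M lborel) D0"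
  and D0_integral: "integral\<^sup>L (lborel \<Otimes>\<^sub>M lborel) D0 = - (2 * pi * f x)"
proof -
  obtain R2 where R2: "R2 > 0" "\<And>\<phi> r. r > R2 \<Longrightarrow> pt \<phi> r \<notin> E" using pt_radius by blast
  let ?F = "\<lambda>p. D (snd p) (fst p)"
  let ?Z = "{0<..} \<times> {0<..<2*pi} :: (real \<times> real) set"
  have "integrable lborel (\<lambda>p. indicator ({0..R2} \<times> {0..2*pi}) p *\<^sub>R ?F p)"
    by (rule borel_integrable_compact) (auto intro!: compact_Times D_continuous)
  then have "integrable lborel (\<lambda>p. indicator ?Z p *\<^sub>R (indicator ({0..R2} \<times> {0..2*pi}) p *\<^sub>R ?F p))"
    by (rule integrable_mult_indicator[rotated]) (simp add: borel_open open_Times)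
  moreover have "(\<lambda>p. indicator ?Z p *\<^sub>R (indicator ({0..R2} \<times> {0..2*pi}) p *\<^sub>R ?F p)) = D0"
  proof
    fix p :: "real \<times> real"
    obtain r \<phi> where p: "p = (r, \<phi>)" by (cases p)
    show "indicator ?Z p *\<^sub>R (indicator ({0..R2} \<times> {0..2*pi}) p *\<^sub>R ?F p) = D0 p"
      unfolding p D0_def using D_zero[OF R2(2)[of r \<phi>]] by (cases "r > R2") (auto simp: indicator_def)
  qed
  ultimately show i: "integrable (lborel \<Otimes>\<^sub>M lborel) D0" by (simp add: lborel_prod)
  \<comment> \<open>Along each ray \<open>f\<close> goes from \<open>f x\<close> to 0, which gives
    \<open>- f x\<close> in every direction.\<close>
  have inner: "(\<integral>r. D0 (r, \<phi>) \<partial>lborel) = - f x * indicator {0<..<2*pi} \<phi>" for \<phi>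
  proof (cases "\<phi> \<in> {0<..<2*pi}")
    case True
    have "(\<integral>r. D0 (r, \<phi>) \<partial>lborel) = (\<integral>r. indicator {0..R2 + 1} r *\<^sub>R D \<phi> r \<partial>lborel)"
    proof (rule integral_cong_AE)
      have c: "continuous_on UNIV (D \<phi>)"
        using continuous_on_compose2[OF D_continuous[of UNIV], of UNIV "\<lambda>r. (r, \<phi>)"] by (simp add: continuous_intros)
      then have [measurable]: "D \<phi> \<in> borel_measurable borel" by (rule borel_measurable_continuous_onI)
      show "(\<lambda>r. indicator {0..R2 + 1} r *\<^sub>R D \<phi> r) \<in> borel_measurable lborel" by measurable
      have "(\<lambda>r. D0 (r, \<phi>)) = (\<lambda>r. indicator {0<..} r * D \<phi> r)"
        using True by (auto simp: D0_def indicator_def)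
      then show "(\<lambda>r. D0 (r, \<phi>)) \<in> borel_measurable lborel" by simp
      have "AE r in lborel. r \<noteq> (0 :: real)" by (rule AE_lborel_singleton)
      then show "AE r in lborel. D0 (r, \<phi>) = indicator {0..R2 + 1} r *\<^sub>R D \<phi> r"
      proof eventually_elim
        case (elim r)
        show ?case using True elim D_zero[OF R2(2)[of r \<phi>]]
          by (cases "r > R2") (auto simp: D0_def indicator_def)
      qed
    qed
    also have "\<dots> = f (pt \<phi> (R2 + 1)) - f (pt \<phi> 0)"
    proof (rule integral_FTC_atLeastAtMost)
      show "((\<lambda>r. f (pt \<phi> r)) has_vector_derivative D \<phi> r) (at r within {0..R2 + 1})" for r
        using pt_derivative[of \<phi> r] by (simp add: has_real_derivative_iff_has_vector_derivative has_vector_derivative_at_within)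
      show "continuous_on {0..R2 + 1} (D \<phi>)"
        using continuous_on_compose2[OF D_continuous[of UNIV], of "{0..R2 + 1}" "\<lambda>r. (r, \<phi>)"] by (simp add: continuous_intros)
    qed (use R2 in simp)
    also have "f (pt \<phi> (R2 + 1)) = 0" using supp[OF R2(2)[of "R2 + 1" \<phi>]] by simp
    finally show ?thesis using True by (simp add: pt_def)
  qed (simp add: D0_def)
  have "integral\<^sup>L (lborel \<Otimes>\<^sub>M lborel) D0 = (\<integral>\<phi>. (\<integral>r. D0 (r, \<phi>) \<partial>lborel) \<partial>lborel)"
    using lborel_pair.integral_snd[of "\<lambda>r \<phi>. D0 (r, \<phi>)"] i by simp
  also have "\<dots> = - (2 * pi * f x)" unfolding inner by simp
  finally show "integral\<^sup>L (lborel \<Otimes>\<^sub>M lborel) D0 = - (2 * pi * f x)" .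
qed

text \<open>The polar Jacobian \<open>r\<close> is half of the factor \<open>2 * r\<close> in
  \<open>cos_kernel_tendsto\<close>, and \<open>\<bar>det S\<bar>\<close> cancels
  \<open>\<bar>det A\<bar>\<close>. The constant is the product of 1/2, the \<open>- 2 * pi\<close>
  of the kernel and the \<open>- 2 * pi\<close> of \<open>D0_integral\<close>.\<close>

lemma H_limit: "(\<lambda>m. integral\<^sup>L lborel (H m)) \<longlonglongrightarrow> 2 * pi\<^sup>2 * f x"
proof -
  let ?I = "\<lambda>r \<phi>. indicator ({0<..} \<times> {0<..<2*pi}) (r, \<phi>) :: real"
  let ?G = "\<lambda>m. \<lambda>(r, \<phi>). ?I r \<phi> * (r * H m (x + r *\<^sub>R (S *v dir \<phi>)))"
  define \<delta> where "\<delta> = \<bar>det A\<bar>"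
  have \<delta>: "\<delta> > 0" using det by (simp add: \<delta>_def)
  define \<kappa> where "\<kappa> = (1 + norm (B *v (x - c))) / 2"
  have "norm (B *v (x - c)) < 1" using x by (simp only: E_def image_ball_iff) simp
  then have \<kappa>: "0 \<le> \<kappa>" "\<kappa> < 1" by (auto simp: \<kappa>_def)
  define C where "C = 2 * pi * (2 + 1 / (1 - \<kappa>))"
  have detS: "det S \<noteq> 0" and adetS: "\<bar>det S\<bar> = 1 / \<delta>" using det by (simp_all add: det_inv_transpose2 \<delta>_def)
  note polar = polar_coordinates_lborel[OF H_integrable detS, where c = x]
  have G: "(case p of (r, \<phi>) \<Rightarrow> ?I r \<phi> * (r * H m (x + r *\<^sub>R (S *v dir \<phi>))))
      = \<delta> / 2 * (D0 p * (2 * fst p * cos_kernel (\<alpha> (snd p) (fst p)) (2 * fst p) (eps m)))" for p m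
  proof (cases p)
    case (Pair r \<phi>)
    show ?thesis
      using H_eq[of m \<phi> r] unfolding Pair pt_def[symmetric] D0_def \<delta>_def by simp
  qed
  have eps0: "eps m \<noteq> 0" for m using eps_pos[of m] by simp
  \<comment> \<open>The bound on \<open>\<alpha>\<close> is available inside \<open>E\<close>;
    outside, \<open>D0\<close> vanishes.\<close>
  have zero: "D0 p = 0 \<or> fst p > 0 \<and> \<bar>\<alpha> (snd p) (fst p)\<bar> \<le> \<kappa> * (2 * fst p)" for p
  proof (cases p)
    case (Pair r \<phi>)
    show ?thesis

      using D_zero[of \<phi> r] pt_bound[of \<phi> r] unfolding Pair \<kappa>_def
      by (cases "pt \<phi> r \<in> E") (auto simp: D0_def indicator_def)
  qed
  have "(\<lambda>m. integral\<^sup>L (lborel \<Otimes>\<^sub>M lborel) (?G m)) \<longlonglongrightarrow> (\<integral>p. \<delta> / 2 * (D0 p * (- 2 * pi)) \<partial>(lborel \<Otimes>\<^sub>M lborel))"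
  proof (rule integral_dominated_convergence)
    show "?G m \<in> borel_measurable (lborel \<Otimes>\<^sub>M lborel)" for m
      by (rule borel_measurable_integrable[OF polar(1)])
    show "(\<lambda>p. \<delta> / 2 * (D0 p * (- 2 * pi))) \<in> borel_measurable (lborel \<Otimes>\<^sub>M lborel)"
      using borel_measurable_integrable[OF D0_integrable] by measurable
    show "integrable (lborel \<Otimes>\<^sub>M lborel) (\<lambda>p. \<delta> / 2 * (\<bar>D0 p\<bar> * C))"
      by (intro Bochner_Integration.integrable_mult_right Bochner_Integration.integrable_mult_left integrable_abs D0_integrable)
    show "AE p in lborel \<Otimes>\<^sub>M lborel. (\<lambda>m. ?G m p) \<longlonglongrightarrow> \<delta> / 2 * (D0 p * (- 2 * pi))"
    proof (rule AE_I2)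
      fix p :: "real \<times> real"
      show "(\<lambda>m. ?G m p) \<longlonglongrightarrow> \<delta> / 2 * (D0 p * (- 2 * pi))"
      proof (cases "D0 p = 0")
        case False
        then have r: "fst p > 0" and a: "\<bar>\<alpha> (snd p) (fst p)\<bar> \<le> \<kappa> * (2 * fst p)" using zero[of p] by auto
        have "\<kappa> * (2 * fst p) < 2 * fst p" using \<kappa> r by simp
        then have lt: "\<bar>\<alpha> (snd p) (fst p)\<bar> < 2 * fst p" using a by linarith
        have l: "(\<lambda>m. 2 * fst p * cos_kernel (\<alpha> (snd p) (fst p)) (2 * fst p) (eps m)) \<longlonglongrightarrow> - 2 * pi"
          by (intro cos_kernel_tendsto eps_tendsto eps0) (use r lt in auto)
        show ?thesis unfolding G by (rule tendsto_mult[OF tendsto_const tendsto_mult[OF tendsto_const l]])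
      qed (simp add: G)
    qed
    show "AE p in lborel \<Otimes>\<^sub>M lborel. norm (?G m p) \<le> \<delta> / 2 * (\<bar>D0 p\<bar> * C)" for m
    proof (rule AE_I2)
      fix p :: "real \<times> real"
      show "norm (?G m p) \<le> \<delta> / 2 * (\<bar>D0 p\<bar> * C)"
      proof (cases "D0 p = 0")
        case False
        then have r: "fst p > 0" and a: "\<bar>\<alpha> (snd p) (fst p)\<bar> \<le> \<kappa> * (2 * fst p)" using zero[of p] by auto
        have "\<bar>2 * fst p * cos_kernel (\<alpha> (snd p) (fst p)) (2 * fst p) (eps m)\<bar> \<le> C"
          unfolding C_def by (rule cos_kernel_bound[OF \<kappa> _ a eps0]) (use r in simp)
        then have "\<bar>D0 p\<bar> * \<bar>2 * fst p * cos_kernel (\<alpha> (snd p) (fst p)) (2 * fst p) (eps m)\<bar> \<le> \<bar>D0 p\<bar> * C"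
          by (rule mult_left_mono) simp
        then show ?thesis unfolding G real_norm_def abs_mult[of "\<delta> / 2"] abs_mult[of "D0 p"]
          using \<delta> by (simp add: mult_left_mono)
      qed (simp add: G)
    qed
  qed
  also have "(\<integral>p. \<delta> / 2 * (D0 p * (- 2 * pi)) \<partial>(lborel \<Otimes>\<^sub>M lborel)) = \<delta> * (2 * pi\<^sup>2 * f x)"
    using D0_integrable by (simp add: D0_integral power2_eq_square)
  finally have "(\<lambda>m. integral\<^sup>L lborel (H m) * \<delta>) \<longlonglongrightarrow> \<delta> * (2 * pi\<^sup>2 * f x)"
    unfolding polar(2) adetS by simp
  from tendsto_divide[OF this tendsto_const[of \<delta>]] show ?thesis using \<delta> by simp
qed

text \<open>\<open>2 * pi\<close> times the integral of \<open>Q m\<close> is the integral of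
  \<open>H m\<close>, with limit \<open>2 * pi^2 * f x\<close>. The uniform bound on
  \<open>Q\<close> allows the passage to \<open>J\<close> under the integral.\<close>

theorem J_has_integral: "has_bochner_integral lborel (\<lambda>\<theta>. indicator {0..2*pi} \<theta> * J \<theta>) (pi * f x)"
proof -
  obtain K where K: "\<And>m \<theta>. \<bar>Q m \<theta>\<bar> \<le> K" using Q_bound by blast
  let ?q = "\<lambda>m \<theta>. indicator {0..2*pi} \<theta> * Q m \<theta>"
  let ?j = "\<lambda>\<theta>. indicator {0..2*pi} \<theta> * J \<theta>"
  have lim: "(\<lambda>m. ?q m \<theta>) \<longlonglongrightarrow> ?j \<theta>" for \<theta> by (intro tendsto_intros Q_limit)
  have qm: "?q m \<in> borel_measurable lborel" for m by (rule borel_measurable_integrable[OF Q_integral(1)])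
  have jm: "?j \<in> borel_measurable lborel"
    by (rule borel_measurable_LIMSEQ_real[OF lim qm])
  have w: "integrable lborel (\<lambda>\<theta>. indicator {0..2*pi} \<theta> * K)" by (intro integrable_mult_left) simp
  have b: "AE \<theta> in lborel. norm (?q m \<theta>) \<le> indicator {0..2*pi} \<theta> * K" for m
    by (rule AE_I2) (use K in \<open>simp add: indicator_def\<close>)
  have "(\<lambda>m. 2 * pi * integral\<^sup>L lborel (?q m)) \<longlonglongrightarrow> 2 * pi * integral\<^sup>L lborel ?j"
    by (intro tendsto_intros integral_dominated_convergence[OF jm qm w AE_I2 b] lim)
  then have "2 * pi * integral\<^sup>L lborel ?j = 2 * pi\<^sup>2 * f x"
    using H_limit unfolding Q_integral(2) by (rule LIMSEQ_unique)
  then have "integral\<^sup>L lborel ?j = pi * f x" by (simp add: power2_eq_square)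
  moreover have "integrable lborel ?j"
    by (rule integrable_dominated_convergence[OF jm qm w AE_I2 b]) (rule lim)
  ultimately show ?thesis by (simp add: has_bochner_integral_iff)
qed

end

section \<open>The inversion formula for an affine image of the disc\<close>

context ellipse_data
begin

text \<open>A Borel extension of the normal field, so that the integrand on the boundary is visibly measurable.\<close>

definition "\<nu>ext z = S *v (B *v (z - c)) /\<^sub>R norm (S *v (B *v (z - c)))"

lemma \<nu>ext_y: "\<nu>ext (y \<theta>) = \<nu> \<theta>"
  by (simp add: \<nu>ext_def \<nu>_def y_def B_A)

lemma \<nu>_tangent: "norm (A *v dir' \<theta>) *\<^sub>R \<nu> \<theta> = n \<theta>"
  using norm_S_pos[of \<theta>] unfolding norm_tangent[OF det] \<nu>_def n_def by (simp only: scaleR_scaleR) simp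

lemma T_measurable:
  assumes "continuous_on UNIV (\<lambda>(z, t). k z t)"
  shows "T k \<in> borel_measurable borel"
proof -
  have k: "(\<lambda>p. k (fst p) (snd p)) \<in> borel_measurable (borel \<Otimes>\<^sub>M borel)"
    unfolding borel_prod using assms by (intro borel_measurable_continuous_onI) (simp add: case_prod_unfold)
  have "(\<lambda>p. indicator {norm (x - fst p)<..} (snd p) *\<^sub>R (k (fst p) (snd p) / sqrt ((snd p)\<^sup>2 - (norm (x - fst p))\<^sup>2)))
      \<in> borel_measurable (borel \<Otimes>\<^sub>M lborel)"
    using k unfolding indicator_def greaterThan_iff by measurable
  then have "(\<lambda>(z, t). indicator {norm (x - z)<..} t *\<^sub>R (k z t / sqrt (t\<^sup>2 - (norm (x - z))\<^sup>2)))
      \<in> borel_measurable (borel \<Otimes>\<^sub>M lborel)"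
    by (simp add: case_prod_unfold)
  then show ?thesis
    unfolding T_def[abs_def] set_lebesgue_integral_def by (rule lborel.borel_measurable_lebesgue_integral)
qed

lemma normal_derivative_wave:
  assumes w: "wave_solution f u" and t: "t > 0"
  shows "normal_derivative E (\<lambda>z. u z t) (y \<theta>) = \<nu> \<theta> $ 1 * kd1 (y \<theta>) t + \<nu> \<theta> $ 2 * kd2 (y \<theta>) t"
  unfolding normal_derivative_def outward_unit_normal_E wave_solution_gradient[OF w f f1 f2 cont t]
  by (simp add: inner_vec2 kd1_def kd2_def)

text \<open>Integrability is part of the claim, because the integral of a function that is not
  integrable would be 0 by convention.\<close>

theorem normal_derivative_inversion:
  fixes u :: "real^2 \<Rightarrow> real \<Rightarrow> real"
  defines "\<sigma> \<equiv> arc_length_measure (frontier E)"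
    and "K \<equiv> (\<lambda>y t. normal_derivative E (\<lambda>z. u z t) y / sqrt (t\<^sup>2 - (norm (x - y))\<^sup>2))"
  assumes w: "wave_solution f u"
  shows "\<forall>y\<in>frontier E. set_integrable lborel {norm (x - y)<..} (K y)"
    and "set_integrable \<sigma> (frontier E) (\<lambda>y. \<integral>t\<in>{norm (x - y)<..}. K y t \<partial>lborel)"
    and "f x = 1 / pi * (\<integral>y\<in>frontier E. (\<integral>t\<in>{norm (x - y)<..}. K y t \<partial>lborel) \<partial>\<sigma>)"
proof -
  define h where "h z = \<nu>ext z $ 1 * T kd1 z + \<nu>ext z $ 2 * T kd2 z" for z
  define k1 where "k1 \<theta> t = kd1 (y \<theta>) t / sqrt (t\<^sup>2 - (norm (x - y \<theta>))\<^sup>2)" for \<theta> t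
  define k2 where "k2 \<theta> t = kd2 (y \<theta>) t / sqrt (t\<^sup>2 - (norm (x - y \<theta>))\<^sup>2)" for \<theta> t
  have i: "set_integrable lborel {norm (x - y \<theta>)<..} (k1 \<theta>)" "set_integrable lborel {norm (x - y \<theta>)<..} (k2 \<theta>)" for \<theta>
    unfolding k1_def k2_def by (rule T_integrable)+
  have K: "K (y \<theta>) t = \<nu> \<theta> $ 1 * k1 \<theta> t + \<nu> \<theta> $ 2 * k2 \<theta> t" if "t \<in> {norm (x - y \<theta>)<..}" for \<theta> t
  proof -
    have "t > 0" using that norm_ge_zero[of "x - y \<theta>"] by (simp del: norm_ge_zero)
    from normal_derivative_wave[OF w this] show ?thesis
      unfolding K_def k1_def k2_def by (simp add: add_divide_distrib)
  qed
  have sum: "set_integrable lborel {norm (x - y \<theta>)<..} (\<lambda>t. \<nu> \<theta> $ 1 * k1 \<theta> t + \<nu> \<theta> $ 2 * k2 \<theta> t)" for \<theta>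
    by (intro set_integral_add(1) set_integrable_mult_right i)
  have "set_integrable lborel {norm (x - y \<theta>)<..} (K (y \<theta>))" for \<theta>
    using sum[of \<theta>] K[of _ \<theta>] by (subst set_integrable_cong[OF refl refl]) auto
  then show "\<forall>y\<in>frontier E. set_integrable lborel {norm (x - y)<..} (K y)"
    unfolding frontier_E by auto
  have inner: "(\<integral>t\<in>{norm (x - z)<..}. K z t \<partial>lborel) = h z" if zf: "z \<in> frontier E" for z
  proof -
    obtain \<theta> where z: "z = y \<theta>" using zf unfolding frontier_E by blast
    have "(\<integral>t\<in>{norm (x - z)<..}. K z t \<partial>lborel)
        = (\<integral>t\<in>{norm (x - z)<..}. \<nu> \<theta> $ 1 * k1 \<theta> t + \<nu> \<theta> $ 2 * k2 \<theta> t \<partial>lborel)"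
      unfolding z by (rule set_lebesgue_integral_cong) (use K[of _ \<theta>] in auto)
    also have "\<dots> = \<nu> \<theta> $ 1 * (\<integral>t\<in>{norm (x - z)<..}. k1 \<theta> t \<partial>lborel) + \<nu> \<theta> $ 2 * (\<integral>t\<in>{norm (x - z)<..}. k2 \<theta> t \<partial>lborel)"
      unfolding z by (subst set_integral_add(2)) (auto intro!: set_integrable_mult_right i)
    also have "\<dots> = h z"
      unfolding h_def z \<nu>ext_y T_def k1_def k2_def ..
    finally show ?thesis .
  qed
  have "h \<in> borel_measurable borel"
    unfolding h_def[abs_def]
  proof (intro borel_measurable_add borel_measurable_times T_measurable kd_continuous)
    have "(\<lambda>z. S *v (B *v (z - c))) \<in> borel_measurable borel"
      by (intro borel_measurable_continuous_onI continuous_intros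
          linear_continuous_on_compose[OF _ matrix_vector_mul_linear])
    then have [measurable]: "\<nu>ext \<in> borel_measurable borel"
      unfolding \<nu>ext_def[abs_def] by measurable
    have "(\<lambda>v :: real^2. v $ i) \<in> borel_measurable borel" for i
      by (intro borel_measurable_continuous_onI continuous_intros)
    note [measurable] = this
    show "(\<lambda>z. \<nu>ext z $ 1) \<in> borel_measurable borel" "(\<lambda>z. \<nu>ext z $ 2) \<in> borel_measurable borel"
      by (rule measurable_compose[OF \<open>\<nu>ext \<in> borel_measurable borel\<close> \<open>(\<lambda>v. v $ _) \<in> _\<close>])+
  qed
  moreover have "h (y \<theta>) * norm (A *v dir' \<theta>) = J \<theta>" for \<theta>
    unfolding h_def \<nu>ext_y J_def \<nu>_tangent[symmetric] by (simp add: algebra_simps)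
  ultimately have "has_bochner_integral \<sigma> (\<lambda>z. indicator (frontier E) z * h z) (pi * f x)"
    unfolding \<sigma>_def using J_has_integral by (intro arc_length_has_integral) simp_all
  moreover have "indicator (frontier E) z * h z = indicator (frontier E) z *\<^sub>R (\<integral>t\<in>{norm (x - z)<..}. K z t \<partial>lborel)" for z
    using inner[of z] by (auto simp: indicator_def)
  ultimately have hb: "has_bochner_integral \<sigma> (\<lambda>z. indicator (frontier E) z *\<^sub>R (\<integral>t\<in>{norm (x - z)<..}. K z t \<partial>lborel)) (pi * f x)"
    by simp
  then show "set_integrable \<sigma> (frontier E) (\<lambda>y. \<integral>t\<in>{norm (x - y)<..}. K y t \<partial>lborel)"
    by (simp add: set_integrable_def has_bochner_integral_iff)
  show "f x = 1 / pi * (\<integral>y\<in>frontier E. (\<integral>t\<in>{norm (x - y)<..}. K y t \<partial>lborel) \<partial>\<sigma>)"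
    unfolding set_lebesgue_integral_def[of \<sigma>] has_bochner_integral_integral_eq[OF hb] by simp
qed

end

section \<open>Circular and elliptical domains\<close>

lemma circular_domain_affine:
  assumes "circular_domain \<Omega>"
  obtains c A where "det A \<noteq> 0" "\<Omega> = (\<lambda>\<xi>. c + A *v \<xi>) ` ball (0 :: real^2) 1"
proof -
  obtain c r where r: "r > 0" "\<Omega> = ball c r" using assms by (auto simp: circular_domain_def)
  have m: "mat r *v \<xi> = r *\<^sub>R \<xi>" for \<xi> :: "real^2" by (simp add: vec2_eq_iff matvec2_nth mat_def)
  have "\<Omega> = (\<lambda>\<xi>. c + mat r *v \<xi>) ` ball 0 1"
  proof (intro set_eqI iffI)
    fix z assume "z \<in> \<Omega>"
    then have "norm (z - c) < r" using r(2) by (simp add: dist_norm norm_minus_commute)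
    then have "norm ((z - c) /\<^sub>R r) < 1" using r(1) by (simp add: divide_inverse_commute[symmetric])
    moreover have "z = c + r *\<^sub>R ((z - c) /\<^sub>R r)" using r(1) by simp
    ultimately show "z \<in> (\<lambda>\<xi>. c + mat r *v \<xi>) ` ball 0 1"
      unfolding m by (intro image_eqI[of z _ "(z - c) /\<^sub>R r"]) simp_all
  next
    fix z assume "z \<in> (\<lambda>\<xi>. c + mat r *v \<xi>) ` ball 0 1"
    then obtain \<xi> where "\<xi> \<in> ball 0 1" "z = c + r *\<^sub>R \<xi>" unfolding m by blast
    then show "z \<in> \<Omega>" using r by (simp add: dist_norm)
  qed
  moreover have "det (mat r :: real^2^2) \<noteq> 0" using r by (simp add: det_2 mat_def)
  ultimately show ?thesis using that by blast
qed

text \<open>Connected open sets with the same frontier are equal or disjoint. In the disjoint case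
  \<open>\<Omega>\<close> meets the complement of \<open>closure E\<close>, which is connected
  because \<open>E\<close> is bounded and convex in the plane; so \<open>\<Omega>\<close> contains
  that complement and is unbounded.\<close>

lemma bounded_connected_eq_convex_of_frontier_eq:
  fixes \<Omega> E :: "(real^2) set"
  assumes \<Omega>: "open \<Omega>" "connected \<Omega>" "bounded \<Omega>" "\<Omega> \<noteq> {}"
    and E: "open E" "convex E" "bounded E" "E \<noteq> {}" and fr: "frontier \<Omega> = frontier E"
  shows "\<Omega> = E"
proof -
  have d: "\<Omega> \<inter> frontier E = {}" "E \<inter> frontier \<Omega> = {}"
    using \<Omega>(1) E(1) fr by (auto simp: frontier_def interior_open)
  have E': "connected E" using E(2) by (rule convex_connected)
  show ?thesis
  proof (cases "\<Omega> \<inter> E = {}")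
    case False
    then have "\<Omega> \<subseteq> E" using connected_Int_frontier[OF \<Omega>(2), of E] d(1) by blast
    moreover have "E \<subseteq> \<Omega>" using connected_Int_frontier[OF E', of \<Omega>] d(2) False by blast
    ultimately show ?thesis by blast
  next
    case True
    let ?V = "- closure E"
    have cl: "closure E = E \<union> frontier E"
      using closure_subset[of E] unfolding frontier_def interior_open[OF E(1)] by blast
    have "\<Omega> \<subseteq> ?V" using True d(1) unfolding cl by blast
    then have ne: "?V \<inter> \<Omega> \<noteq> {}" using \<Omega>(4) by blast
    have "connected ?V"
      by (rule connected_complement_bounded_convex) (simp_all add: E(2,3) bounded_closure convex_closure)
    moreover have "?V \<inter> frontier \<Omega> = {}" unfolding fr cl by blast
    ultimately have "?V \<subseteq> \<Omega>" using connected_Int_frontier[of ?V \<Omega>] ne by blast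
    then have "UNIV \<subseteq> \<Omega> \<union> closure E" by blast
    then have "bounded (UNIV :: (real^2) set)"
      by (rule bounded_subset[rotated]) (intro bounded_Un[THEN iffD2] conjI \<Omega>(3) bounded_closure E(3))
    then show ?thesis by simp
  qed
qed

text \<open>The definition describes the domain through its boundary. So the affine image of the
  disc with that boundary is built first and then identified with \<open>\<Omega>\<close>.\<close>

lemma elliptical_domain_affine:
  assumes "elliptical_domain \<Omega>" "\<Omega> \<noteq> {}"
  obtains c A where "det A \<noteq> 0" "\<Omega> = (\<lambda>\<xi>. c + A *v \<xi>) ` ball (0 :: real^2) 1"
proof -
  obtain e1 e2 and Q :: "real^2^2" where e: "e1 > 0" "e2 > 0" and Q: "orthogonal_matrix Q"
    and fr: "frontier \<Omega> = (\<lambda>v. Q *v v) ` {x. (x$1)\<^sup>2 / e1\<^sup>2 + (x$2)\<^sup>2 / e2\<^sup>2 = 1}"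
    and \<Omega>: "open \<Omega>" "connected \<Omega>" "bounded \<Omega>"
    using assms(1) unfolding elliptical_domain_def by blast
  define D :: "real^2^2" where "D = vector [vector [e1, 0], vector [0, e2]]"
  have Dv: "(D *v w) $ 1 = e1 * w $ 1" "(D *v w) $ 2 = e2 * w $ 2" for w
    by (simp_all add: matvec2_nth D_def)
  have "det Q \<noteq> 0" using det_orthogonal_matrix[OF Q] by auto
  moreover have "det D = e1 * e2" by (simp add: D_def det_2)
  ultimately have det: "det (Q ** D) \<noteq> 0" using e by (simp add: det_mul)
  interpret ellipse_param 0 "Q ** D" by unfold_locales (rule det)
  have ell: "{x :: real^2. (x$1)\<^sup>2 / e1\<^sup>2 + (x$2)\<^sup>2 / e2\<^sup>2 = 1} = (*v) D ` sphere 0 1"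
  proof (intro set_eqI iffI)
    fix v :: "real^2" assume v: "v \<in> {x. (x$1)\<^sup>2 / e1\<^sup>2 + (x$2)\<^sup>2 / e2\<^sup>2 = 1}"
    define w :: "real^2" where "w = vector [v$1 / e1, v$2 / e2]"
    have "v = D *v w" using e by (simp add: vec2_eq_iff Dv w_def del: matvec2_nth)
    moreover have "(norm w)\<^sup>2 = 1" using v by (simp add: norm_vec2_sq w_def power_divide)
    then have "norm w = 1" using norm_ge_zero[of w] by (simp add: power2_eq_1_iff del: norm_ge_zero)
    ultimately show "v \<in> (*v) D ` sphere 0 1" by (intro image_eqI[of v _ w]) simp_all
  next
    fix v :: "real^2" assume "v \<in> (*v) D ` sphere 0 1"
    then obtain w where w: "v = D *v w" "norm w = 1" by auto
    then have "(w$1)\<^sup>2 + (w$2)\<^sup>2 = 1" using norm_vec2_sq[of w] by simp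
    then show "v \<in> {x. (x$1)\<^sup>2 / e1\<^sup>2 + (x$2)\<^sup>2 / e2\<^sup>2 = 1}"
      using e by (simp add: w(1) Dv power_mult_distrib del: matvec2_nth)
  qed
  have "frontier \<Omega> = (\<lambda>\<xi>. 0 + (Q ** D) *v \<xi>) ` sphere 0 1"
    unfolding fr ell image_image matrix_vector_mul_assoc by simp
  also have "\<dots> = frontier E"
    by (intro set_eqI) (simp only: image_ball_iff frontier_E_iff mem_sphere_0)
  finally have "frontier \<Omega> = frontier E" .
  moreover have "convex E" "bounded E" "E \<noteq> {}"
  proof -
    have E: "E = (*v) (Q ** D) ` ball 0 1" unfolding E_def by simp
    show "convex E"
      unfolding E by (rule convex_linear_image[OF matrix_vector_mul_linear convex_ball])
    show "bounded E"
      unfolding E by (rule bounded_linear_image[OF bounded_ball matrix_vector_mul_bounded_linear])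
    show "E \<noteq> {}" unfolding E by simp
  qed
  ultimately have "\<Omega> = E"
    using bounded_connected_eq_convex_of_frontier_eq[OF \<Omega> assms(2) E_open] by simp
  then show ?thesis using that[OF det, of 0] unfolding E_def by blast
qed

lemma has_partials2_zero_on_open:
  assumes g: "has_partials2 g g1 g2" and U: "open U" "z \<in> U" "\<And>w. w \<in> U \<Longrightarrow> g w = 0"
  shows "g1 z = 0" "g2 z = 0"
proof -
  have "(g has_derivative (\<lambda>v. 0)) (at z)"
    by (rule has_derivative_transform_within_open[OF has_derivative_const[of 0] U(1,2)]) (simp add: U(3))
  from has_derivative_unique[OF g[unfolded has_partials2_def, rule_format] this]
  have "v$1 * g1 z + v$2 * g2 z = 0" for v :: "real^2" by (rule fun_cong)
  from this[of "vector [1, 0]"] this[of "vector [0, 1]"] show "g1 z = 0" "g2 z = 0" by simp_all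
qed

theorem theorem3p3:
  fixes \<Omega> :: "(real^2) set" and f :: "real^2 \<Rightarrow> real" and u :: "real^2 \<Rightarrow> real \<Rightarrow> real"
    and x :: "real^2"
  defines "\<sigma> \<equiv> arc_length_measure (frontier \<Omega>)"
    and "K \<equiv> (\<lambda>y t. normal_derivative \<Omega> (\<lambda>z. u z t) y / sqrt (t\<^sup>2 - (norm (x - y))\<^sup>2))"
  assumes "circular_domain \<Omega> \<or> elliptical_domain \<Omega>"
    and "smooth_compact_support \<Omega> f"
    and "wave_solution f u"
    and "x \<in> \<Omega>"
  shows "(\<forall>y\<in>frontier \<Omega>. set_integrable lborel {norm (x - y)<..} (K y)) \<and>
         set_integrable \<sigma> (frontier \<Omega>) (\<lambda>y. \<integral>t\<in>{norm (x - y)<..}. K y t \<partial>lborel) \<and>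
         f x = 1 / pi * (\<integral>y\<in>frontier \<Omega>. (\<integral>t\<in>{norm (x - y)<..}. K y t \<partial>lborel) \<partial>\<sigma>)"
proof -
  obtain c A where det: "det A \<noteq> 0" and \<Omega>: "\<Omega> = (\<lambda>\<xi>. c + A *v \<xi>) ` ball 0 1"
  proof -
    from assms(3) show ?thesis
    proof
      assume "circular_domain \<Omega>"
      then show ?thesis by (rule circular_domain_affine) (rule that)
    next
      assume "elliptical_domain \<Omega>"
      then show ?thesis by (rule elliptical_domain_affine) (use assms(6) in blast, rule that)
    qed
  qed
  interpret ellipse_param c A by unfold_locales (rule det)
  have E: "\<Omega> = E" unfolding \<Omega> E_def ..
  have "Ck_on (Suc (Suc 0)) f UNIV" using assms(4) by (simp only: smooth_compact_support_def)
  then obtain f1 f2 where f: "has_partials2 f f1 f2" "Ck_on (Suc 0) f1 UNIV" "Ck_on (Suc 0) f2 UNIV"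
    by (rule Ck_on_Suc_partials2)
  obtain f11 f12 where f1: "has_partials2 f1 f11 f12" "Ck_on 0 f11 UNIV" "Ck_on 0 f12 UNIV"
    using f(2) by (rule Ck_on_Suc_partials2)
  obtain f21 f22 where f2: "has_partials2 f2 f21 f22" "Ck_on 0 f21 UNIV" "Ck_on 0 f22 UNIV"
    using f(3) by (rule Ck_on_Suc_partials2)
  \<comment> \<open>\<open>U\<close> is open and \<open>f\<close> vanishes on it, so all derivatives
    vanish there too; this provides the support condition of the locale.\<close>
  define U where "U = - closure {x. f x \<noteq> 0}"
  have U: "open U" unfolding U_def by (intro open_Compl closed_closure)
  have U0: "f z = 0" if "z \<in> U" for z
    using that closure_subset[of "{x. f x \<noteq> 0}"] by (auto simp: U_def)
  note U1 = has_partials2_zero_on_open[OF f(1) U _ U0]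
  note U2 = has_partials2_zero_on_open[OF f1(1) U _ U1(1)] has_partials2_zero_on_open[OF f2(1) U _ U1(2)]
  have EU: "z \<in> U" if "z \<notin> E" for z
    using that assms(4) unfolding smooth_compact_support_def U_def E by blast
  interpret ellipse_data c A f f1 f2 f11 f12 f21 f22 x
  proof
    show "f z = 0 \<and> f1 z = 0 \<and> f2 z = 0 \<and> f11 z = 0 \<and> f12 z = 0 \<and> f21 z = 0 \<and> f22 z = 0" if "z \<notin> E" for z
      using U0[OF EU] U1[OF EU] U2[OF EU] that by simp
    show "x \<in> E" using assms(6) unfolding E .
  qed (use f f1 f2 in \<open>simp_all only: Ck_on.simps\<close>)
  show ?thesis
    unfolding \<sigma>_def K_def E by (intro conjI normal_derivative_inversion assms(5))
qed

end
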